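(* Under the standing setting of the context, let $1/v(\mathbf{x})$ denote, for $\mathbf{x}\in\Gamma$, the product of the nonzero eigenvalues of $\nabla\nabla\varphi(\mathbf{x})$. Then $\sqrt{v(\mathbf{x})}\,\|\omega(\mathbf{x})\boldsymbol\gamma(\mathbf{x})\|$ is constant on $\Gamma$. Furthermore, if $g_\epsilon$ denotes the marginal density of $\pi_\epsilon$ on $\Gamma$ (obtained by integrating $\pi_\epsilon$ over the cross-section through $\mathbf{x}$ perpendicular to $\boldsymbol\gamma(\mathbf{x})$), then for $\mathbf{x}\in\Gamma$ $$g_\epsilon(\mathbf{x})=\frac{\omega(\mathbf{x})\sqrt{v(\mathbf{x})}}{\int_\Gamma\omega(\mathbf{y})\sqrt{v(\mathbf{y})}\,\mathrm{d}\mathbf{y}}+O(\epsilon),$$ and there is a constant $K$ such that $g_\epsilon(\mathbf{x})\,\|\boldsymbol\gamma(\mathbf{x})\|=K+O(\epsilon)$ for $\mathbf{x}\in\Gamma$.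
   Context: Standing setting: $\mathrm{d}\mathbf{X}_\epsilon=\mathbf{b}(\mathbf{X}_\epsilon)\mathrm{d}t+[2\epsilon\mathbf{D}]^{1/2}\mathrm{d}\mathbf{B}(t)$ on $\mathbb{R}^n$, $\mathbf{b}$ smooth, $\mathbf{D}$ constant symmetric positive definite; $\dot{\mathbf{x}}=\mathbf{b}(\mathbf{x})$ has a stable limit cycle $\Gamma$. A stationary density $\pi_\epsilon$ exists with divergence-free flux $\mathbf{J}[\pi_\epsilon]=\mathbf{b}\pi_\epsilon-\epsilon\mathbf{D}\nabla\pi_\epsilon$, and $\pi_\epsilon(\mathbf{x})=\hat a(\epsilon)\exp[-\varphi(\mathbf{x})/\epsilon+\ln\omega(\mathbf{x})+O(\epsilon)]$ with smooth $\varphi\ge0$, $\omega>0$ satisfying $\mathbf{b}=-\mathbf{D}\nabla\varphi+\boldsymbol\gamma$, $\nabla\varphi\cdot\boldsymbol\gamma=0$, $\nabla\cdot(\omega\boldsymbol\gamma)=-\nabla\varphi\cdot\mathbf{D}\nabla\omega$; $\varphi$ vanishes exactly on $\Gamma$ (in a neighborhood), $\nabla\varphi=0$ on $\Gamma$, and on $\Gamma$ the Hessian $\nabla\nabla\varphi$ has a simple zero eigenvalue with eigenvector tangent to $\Gamma$ (parallel to $\boldsymbol\gamma$) and positive eigenvalues in the normal hyperplane. $\boldsymbol\gamma_\epsilon=\mathbf{J}[\pi_\epsilon]/\pi_\epsilon\to\boldsymbol\gamma$ as $\epsilon\to0$. *)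

theory Defs
  imports "HOL-Analysis.Analysis" "HOL-Computational_Algebra.Polynomial"
begin

fun iter_dderiv :: "'a::real_normed_vector list \<Rightarrow> ('a \<Rightarrow> 'b::real_normed_vector) \<Rightarrow> 'a \<Rightarrow> 'b" where
  "iter_dderiv [] f = f"
| "iter_dderiv (v # vs) f = (\<lambda>x. frechet_derivative (iter_dderiv vs f) (at x) v)"

text \<open>f is smooth on the open set S: every iterated derivative exists (hence all are continuous).\<close>
definition smooth_on :: "'a::real_normed_vector set \<Rightarrow> ('a \<Rightarrow> 'b::real_normed_vector) \<Rightarrow> bool" where
  "smooth_on S f \<longleftrightarrow> open S \<and> (\<forall>vs. iter_dderiv vs f differentiable_on S)"

definition grad :: "(real^'n \<Rightarrow> real) \<Rightarrow> real^'n \<Rightarrow> real^'n" where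
  "grad f x = (\<chi> i. frechet_derivative f (at x) (axis i 1))"

definition divg :: "(real^'n \<Rightarrow> real^'n) \<Rightarrow> real^'n \<Rightarrow> real" where
  "divg F x = (\<Sum>i\<in>UNIV. frechet_derivative F (at x) (axis i 1) $ i)"

definition hess :: "(real^'n \<Rightarrow> real) \<Rightarrow> real^'n \<Rightarrow> real^'n^'n" where
  "hess f x = (\<chi> i j. frechet_derivative (\<lambda>y. grad f y $ i) (at x) (axis j 1))"

definition charpoly :: "real^'n^'n \<Rightarrow> real poly" where
  "charpoly A = det (\<chi> i j. (if i = j then [:0, 1:] else 0) - [:A $ i $ j:])"

definition prod_nonzero_eigenvalues :: "real^'n^'n \<Rightarrow> real" where
  "prod_nonzero_eigenvalues A = prod_mset (filter_mset (\<lambda>e. e \<noteq> 0) (proots (charpoly A)))"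

definition ode_solution_from0 :: "(real^'n \<Rightarrow> real^'n) \<Rightarrow> (real \<Rightarrow> real^'n) \<Rightarrow> bool" where
  "ode_solution_from0 b x \<longleftrightarrow> (\<forall>t\<ge>0. (x has_vector_derivative b (x t)) (at t within {0..}))"

definition orbitally_asymptotically_stable :: "(real^'n \<Rightarrow> real^'n) \<Rightarrow> (real^'n) set \<Rightarrow> bool" where
  "orbitally_asymptotically_stable b \<Gamma> \<longleftrightarrow>
     (\<forall>e>0. \<exists>d>0. \<forall>x. ode_solution_from0 b x \<and> infdist (x 0) \<Gamma> < d \<longrightarrow> (\<forall>t\<ge>0. infdist (x t) \<Gamma> < e))
   \<and> (\<exists>d>0. \<forall>x. ode_solution_from0 b x \<and> infdist (x 0) \<Gamma> < d \<longrightarrow> ((\<lambda>t. infdist (x t) \<Gamma>) \<longlongrightarrow> 0) at_top)"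

text \<open>Arc-length integral over the closed orbit parametrised by p on [0,T] with velocity b(p t).\<close>
definition cycle_integral :: "(real \<Rightarrow> real^'n) \<Rightarrow> real \<Rightarrow> (real^'n \<Rightarrow> real^'n) \<Rightarrow> (real^'n \<Rightarrow> real) \<Rightarrow> real" where
  "cycle_integral p T b f = integral {0..T} (\<lambda>t. f (p t) * norm (b (p t)))"

text \<open>(n-1)-dimensional Lebesgue integral of F over the hyperplane through x with unit normal u:
  the image of Lebesgue measure on the unit-thickness slab under orthogonal projection onto
  the hyperplane (Fubini in orthonormal coordinates adapted to u).\<close>
definition hyperplane_integral :: "real^'n \<Rightarrow> real^'n \<Rightarrow> (real^'n \<Rightarrow> real) \<Rightarrow> real" where
  "hyperplane_integral x u F =
     (LINT y : {y. 0 \<le> (y - x) \<bullet> u \<and> (y - x) \<bullet> u \<le> 1} | lborel. F (y - ((y - x) \<bullet> u) *\<^sub>R u))"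

definition cross_section_mass :: "(real^'n \<Rightarrow> real^'n) \<Rightarrow> real \<Rightarrow> (real^'n \<Rightarrow> real) \<Rightarrow> real^'n \<Rightarrow> real" where
  "cross_section_mass g \<delta> \<rho> x =
     hyperplane_integral x (sgn (g x)) (\<lambda>y. \<rho> y * indicator (ball x \<delta>) y)"

definition marginal_density ::
  "(real \<Rightarrow> real^'n) \<Rightarrow> real \<Rightarrow> (real^'n \<Rightarrow> real^'n) \<Rightarrow> (real^'n \<Rightarrow> real^'n) \<Rightarrow> real \<Rightarrow> (real^'n \<Rightarrow> real) \<Rightarrow> real^'n \<Rightarrow> real" where
  "marginal_density p T b g \<delta> \<rho> x =
     cross_section_mass g \<delta> \<rho> x / cycle_integral p T b (cross_section_mass g \<delta> \<rho>)"

end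

theory Submission
  imports Defs "HOL-Probability.Distributions"
begin

text \<open>
  On the cycle \<open>\<nabla>\<phi> = 0\<close>, so differentiating \<open>\<nabla>\<phi> \<bullet> \<gamma> = 0\<close> twice gives \<open>H' = - (H A + A\<^sup>T H)\<close> along the flow,
  where \<open>H\<close> is the Hessian of \<open>\<phi>\<close> and \<open>A\<close> the Jacobian of \<open>\<gamma>\<close>, while the transport equation gives
  \<open>\<omega>' = - \<omega> tr A\<close>. The product of the nonzero eigenvalues of \<open>H\<close> is \<open>det (H + \<gamma> \<gamma>\<^sup>T) / |\<gamma>|\<^sup>2\<close>; computing the
  logarithmic derivative of this determinant in an orthonormal eigenbasis of \<open>H\<close> adapted to \<open>\<gamma>\<close> shows that
  \<open>\<omega>\<^sup>2 |\<gamma>|\<^sup>4 / det (H + \<gamma> \<gamma>\<^sup>T)\<close> is constant.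

  The cross-sectional mass is a Laplace integral. In coordinates that turn the Hessian into the identity and
  are scaled by \<open>\<surd>\<epsilon>\<close>, the integrand averaged over opposite points differs from the Gaussian times
  \<open>\<omega>\<close> by \<open>O(\<epsilon>)\<close> times a wider Gaussian, because all terms of odd order cancel. This is uniform
  on the compact cycle, and the Gaussian constant and the amplitude \<open>a(\<epsilon>)\<close> cancel in the marginal density. By
  the first part the normalising integral is the constant times the period.
\<close>

subsection \<open>Iterated directional derivatives\<close>

text \<open>Eigenvalues may cross along the cycle, so the product of the nonzero ones is awkward to
  differentiate directly. The determinant of the filled Hessian is a polynomial in its entries, and
  at each instant it can be differentiated in the eigenbasis of that instant, held fixed; no
  eigenvector is followed in time.

  Uniformity is the obstacle in the Laplace integral: the rescaling comes from an eigenbasis chosen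
  separately at each point, with no continuity in the point. All estimates are therefore made before
  the change of variables, with constants that depend only on the compact cycle, and in terms of q =
  w \<bullet> H w / (2 \<epsilon>), which every such rescaling turns into half a squared norm. The
  one factor left that varies with the point, the Jacobian, is bounded through the constancy proved
  first. The cross-sectional mass is only shown to be measurable in the point; together with the
  uniform estimate this suffices to integrate it over the cycle.\<close>

lemma smooth_differentiable:
  assumes "smooth_on UNIV f" shows "iter_dderiv vs f differentiable (at x)"
  using assms by (auto simp: smooth_on_def differentiable_on_def)

lemma smooth_has_derivative:
  assumes "smooth_on UNIV f"
  shows "(iter_dderiv vs f has_derivative (\<lambda>v. iter_dderiv (v # vs) f x)) (at x)"
  using smooth_differentiable[OF assms, of vs x] by (simp add: frechet_derivative_works)

lemma smooth_continuous:
  assumes "smooth_on UNIV f" shows "continuous_on S (iter_dderiv vs f)"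
  using smooth_differentiable[OF assms]
  by (meson continuous_at_imp_continuous_on differentiable_imp_continuous_within)

lemma iter_dderiv_append: "iter_dderiv (us @ vs) f = iter_dderiv us (iter_dderiv vs f)"
  by (induction us) auto

lemma smooth_iter_dderiv:
  assumes "smooth_on UNIV f" shows "smooth_on UNIV (iter_dderiv vs f)"
  using assms unfolding smooth_on_def by (metis iter_dderiv_append)

lemma iter_dderiv_linear_image:
  assumes "smooth_on UNIV f" and "bounded_linear L"
  shows "iter_dderiv vs (\<lambda>x. L (f x)) = (\<lambda>x. L (iter_dderiv vs f x))"
proof (induction vs)
  case (Cons v vs)
  have "frechet_derivative (\<lambda>x. L (iter_dderiv vs f x)) (at x) = (\<lambda>v. L (iter_dderiv (v # vs) f x))" for x
    using frechet_derivative_at[OF bounded_linear.has_derivative[OF assms(2) smooth_has_derivative[OF assms(1)], of vs x]]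
    by simp
  then show ?case using Cons by simp
qed simp

lemma smooth_linear_image:
  assumes "smooth_on UNIV f" and "bounded_linear L"
  shows "smooth_on UNIV (\<lambda>x. L (f x))"
  unfolding smooth_on_def iter_dderiv_linear_image[OF assms] differentiable_on_def
  using bounded_linear.has_derivative[OF assms(2) smooth_has_derivative[OF assms(1)]]
  by (simp del: iter_dderiv.simps) (meson differentiableI)

lemma iter_dderiv_add:
  assumes "smooth_on UNIV f" and "smooth_on UNIV g"
  shows "iter_dderiv vs (\<lambda>x. f x + g x) = (\<lambda>x. iter_dderiv vs f x + iter_dderiv vs g x)"
proof (induction vs)
  case (Cons v vs)
  have "frechet_derivative (\<lambda>x. iter_dderiv vs f x + iter_dderiv vs g x) (at x)
      = (\<lambda>v. iter_dderiv (v # vs) f x + iter_dderiv (v # vs) g x)" for x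
    using frechet_derivative_at[OF has_derivative_add[OF smooth_has_derivative[OF assms(1), of vs x]
        smooth_has_derivative[OF assms(2), of vs x]]]
    by simp
  then show ?case using Cons by simp
qed simp

lemma smooth_add:
  assumes "smooth_on UNIV f" and "smooth_on UNIV g"
  shows "smooth_on UNIV (\<lambda>x. f x + g x)"
  unfolding smooth_on_def iter_dderiv_add[OF assms] differentiable_on_def
  using smooth_differentiable[OF assms(1)] smooth_differentiable[OF assms(2)]
  by (auto intro: differentiable_add)

lemma iter_dderiv_zero: "iter_dderiv vs (\<lambda>x. 0) = (\<lambda>x. 0)"
  by (induction vs) (simp_all add: frechet_derivative_const)

lemma smooth_zero: "smooth_on UNIV (\<lambda>x. 0)"
  by (simp add: smooth_on_def iter_dderiv_zero)

lemma smooth_sum: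
  assumes "\<And>i. i \<in> I \<Longrightarrow> smooth_on UNIV (f i)"
  shows "smooth_on UNIV (\<lambda>x. \<Sum>i\<in>I. f i x)"
  using assms by (induction I rule: infinite_finite_induct) (auto intro: smooth_zero smooth_add)

lemma iter_dderiv_sum:
  assumes "\<And>i. i \<in> I \<Longrightarrow> smooth_on UNIV (f i)"
  shows "iter_dderiv vs (\<lambda>x. \<Sum>i\<in>I. f i x) = (\<lambda>x. \<Sum>i\<in>I. iter_dderiv vs (f i) x)"
  using assms
proof (induction I rule: infinite_finite_induct)
  case (insert i I)
  then show ?case
    using iter_dderiv_add[of "f i" "\<lambda>x. \<Sum>i\<in>I. f i x" vs] smooth_sum[of I f] by auto
qed (auto simp: iter_dderiv_zero)

lemma iter_dderiv_direction_expand: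
  fixes f :: "'a::euclidean_space \<Rightarrow> 'b::real_normed_vector"
  assumes "smooth_on UNIV f"
  shows "iter_dderiv (v # vs) f x = (\<Sum>b\<in>Basis. (v \<bullet> b) *\<^sub>R iter_dderiv (b # vs) f x)"
proof -
  interpret bounded_linear "\<lambda>v. iter_dderiv (v # vs) f x"
    using smooth_has_derivative[OF assms] by (rule has_derivative_bounded_linear)
  have "iter_dderiv (v # vs) f x = iter_dderiv ((\<Sum>b\<in>Basis. (v \<bullet> b) *\<^sub>R b) # vs) f x"
    by (simp add: euclidean_representation)
  also have "\<dots> = (\<Sum>b\<in>Basis. (v \<bullet> b) *\<^sub>R iter_dderiv (b # vs) f x)"
    unfolding sum scaleR ..
  finally show ?thesis .
qed

text \<open>Peeling off the innermost direction, not the outermost, replaces \<open>f\<close> by its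
  partial derivatives along \<open>Basis\<close>, finitely many fixed smooth functions. Hence the
  induction generalises over \<open>f\<close>, and compactness is used only for the bare
  function.\<close>

lemma iter_dderiv_replicate_bound:
  fixes f :: "'a::euclidean_space \<Rightarrow> real"
  assumes "smooth_on UNIV f" and "compact K"
  shows "\<exists>M\<ge>0. \<forall>x\<in>K. \<forall>w. \<bar>iter_dderiv (replicate m w) f x\<bar> \<le> M * norm w ^ m"
  using assms(1)
proof (induction m arbitrary: f)
  case 0
  have "compact (f ` K)"
    using smooth_continuous[OF 0, of K "[]"] assms(2) by (simp add: compact_continuous_image)
  then obtain M where "\<forall>x\<in>K. \<bar>f x\<bar> \<le> M"
    using compact_imp_bounded[of "f ` K"] by (auto simp: bounded_iff)
  then show ?case by (intro exI[of _ "max M 0"]) auto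
next
  case (Suc m)
  have sm: "smooth_on UNIV (iter_dderiv [b] f)" for b
    by (rule smooth_iter_dderiv[OF Suc.prems])
  have "\<forall>b. \<exists>M\<ge>0. \<forall>x\<in>K. \<forall>w. \<bar>iter_dderiv (replicate m w) (iter_dderiv [b] f) x\<bar> \<le> M * norm w ^ m"
    using Suc.IH[OF sm] by blast
  then obtain M where M: "\<And>b. M b \<ge> 0"
    "\<And>b x w. x \<in> K \<Longrightarrow> \<bar>iter_dderiv (replicate m w) (iter_dderiv [b] f) x\<bar> \<le> M b * norm w ^ m"
    by metis
  show ?case
  proof (intro exI[of _ "\<Sum>b\<in>Basis. M b"] conjI ballI allI)
    show "0 \<le> (\<Sum>b\<in>Basis. M b)" using M(1) by (simp add: sum_nonneg)
    fix x w assume x: "x \<in> K"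
    have "iter_dderiv (replicate (Suc m) w) f x = iter_dderiv (replicate m w) (iter_dderiv [w] f) x"
      using iter_dderiv_append[of "replicate m w" "[w]" f] by (simp add: replicate_append_same)
    also have "iter_dderiv [w] f = (\<lambda>x. \<Sum>b\<in>Basis. (w \<bullet> b) *\<^sub>R iter_dderiv [b] f x)"
      using iter_dderiv_direction_expand[OF Suc.prems, of w "[]"] by blast
    also have "iter_dderiv (replicate m w) \<dots> x
        = (\<Sum>b\<in>Basis. (w \<bullet> b) *\<^sub>R iter_dderiv (replicate m w) (iter_dderiv [b] f) x)"
      by (subst iter_dderiv_sum)
         (simp_all only: smooth_linear_image[OF sm bounded_linear_scaleR_right]
           iter_dderiv_linear_image[OF sm bounded_linear_scaleR_right])
    finally have eq: "iter_dderiv (replicate (Suc m) w) f x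
        = (\<Sum>b\<in>Basis. (w \<bullet> b) *\<^sub>R iter_dderiv (replicate m w) (iter_dderiv [b] f) x)" .
    have "\<bar>iter_dderiv (replicate (Suc m) w) f x\<bar>
        \<le> (\<Sum>b\<in>Basis. \<bar>w \<bullet> b\<bar> * \<bar>iter_dderiv (replicate m w) (iter_dderiv [b] f) x\<bar>)"
      unfolding eq by (rule order_trans[OF sum_abs]) (simp add: abs_mult del: iter_dderiv.simps)
    also have "\<dots> \<le> (\<Sum>b\<in>Basis. norm w * (M b * norm w ^ m))"
      using M x by (intro sum_mono mult_mono Basis_le_norm) auto
    finally show "\<bar>iter_dderiv (replicate (Suc m) w) f x\<bar> \<le> (\<Sum>b\<in>Basis. M b) * norm w ^ Suc m"
      by (simp add: sum_distrib_left sum_distrib_right mult_ac)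
  qed
qed

section \<open>Mean values, symmetry of mixed derivatives, Taylor's formula\<close>

lemma smooth_has_real_derivative_line:
  fixes f :: "'a::real_normed_vector \<Rightarrow> real"
  assumes "smooth_on UNIV f"
  shows "((\<lambda>s. iter_dderiv vs f (y + s *\<^sub>R w)) has_real_derivative iter_dderiv (w # vs) f (y + s *\<^sub>R w)) (at s)"
proof -
  have "((\<lambda>s. y + s *\<^sub>R w) has_derivative (\<lambda>h. h *\<^sub>R w)) (at s)"
    by (auto intro!: derivative_eq_intros)
  from has_derivative_compose[OF this smooth_has_derivative[OF assms]]
  have "((\<lambda>s. iter_dderiv vs f (y + s *\<^sub>R w)) has_derivative (\<lambda>h. iter_dderiv (h *\<^sub>R w # vs) f (y + s *\<^sub>R w))) (at s)" .
  moreover have "iter_dderiv (h *\<^sub>R w # vs) f z = h * iter_dderiv (w # vs) f z" for h z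
    using bounded_linear.linear[OF has_derivative_bounded_linear[OF smooth_has_derivative[OF assms, of vs z]]]
    by (simp add: linear_cmul)
  ultimately show ?thesis
    unfolding has_field_derivative_def by (simp add: mult_commute_abs del: iter_dderiv.simps)
qed

lemma smooth_mean_value:
  fixes f :: "'a::real_normed_vector \<Rightarrow> real"
  assumes "smooth_on UNIV f" and "h > 0"
  obtains s where "0 < s" "s < h" "f (y + h *\<^sub>R w) - f y = h * iter_dderiv [w] f (y + s *\<^sub>R w)"
  using MVT2[of 0 h "\<lambda>s. f (y + s *\<^sub>R w)" "\<lambda>s. iter_dderiv [w] f (y + s *\<^sub>R w)"]
    smooth_has_real_derivative_line[OF assms(1), of "[]"] assms(2)
  by (auto simp del: iter_dderiv.simps(2))

text \<open>The mean value theorem twice: in direction \<open>u\<close> for the increment of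
  \<open>f\<close> by \<open>h\<close> times \<open>v\<close>, then in direction \<open>v\<close>
  for the derivative along \<open>u\<close>.\<close>

lemma second_difference:
  fixes f :: "'a::real_normed_vector \<Rightarrow> real"
  assumes f: "smooth_on UNIV f" and h: "h > 0"
  obtains s t where "0 < s" "s < h" "0 < t" "t < h"
    "f (x + h *\<^sub>R u + h *\<^sub>R v) - f (x + h *\<^sub>R u) - f (x + h *\<^sub>R v) + f x
      = h\<^sup>2 * iter_dderiv [v, u] f (x + s *\<^sub>R u + t *\<^sub>R v)"
proof -
  define g where "g = (\<lambda>s. f (x + s *\<^sub>R u + h *\<^sub>R v) - f (x + s *\<^sub>R u))"
  have 1: "((\<lambda>s. f (z + s *\<^sub>R u)) has_real_derivative iter_dderiv [u] f (z + s *\<^sub>R u)) (at s)" for z s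
    using smooth_has_real_derivative_line[OF f, of "[]"] by simp
  have "(g has_real_derivative iter_dderiv [u] f (x + s *\<^sub>R u + h *\<^sub>R v) - iter_dderiv [u] f (x + s *\<^sub>R u)) (at s)" for s
    unfolding g_def using DERIV_diff[OF 1[of "x + h *\<^sub>R v" s] 1[of x s]]
    by (simp add: ac_simps del: iter_dderiv.simps)
  then obtain s where s: "0 < s" "s < h"
    "g h - g 0 = h * (iter_dderiv [u] f (x + s *\<^sub>R u + h *\<^sub>R v) - iter_dderiv [u] f (x + s *\<^sub>R u))"
    using MVT2[of 0 h g "\<lambda>s. iter_dderiv [u] f (x + s *\<^sub>R u + h *\<^sub>R v) - iter_dderiv [u] f (x + s *\<^sub>R u)"] h
    by (auto simp del: iter_dderiv.simps)
  obtain t where t: "0 < t" "t < h"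
    "iter_dderiv [u] f (x + s *\<^sub>R u + h *\<^sub>R v) - iter_dderiv [u] f (x + s *\<^sub>R u)
      = h * iter_dderiv [v] (iter_dderiv [u] f) (x + s *\<^sub>R u + t *\<^sub>R v)"
    using smooth_mean_value[OF smooth_iter_dderiv[OF f] h] by metis
  show ?thesis
    using that[OF s(1,2) t(1,2)] s(3) t(3) iter_dderiv_append[of "[v]" "[u]" f]
    by (simp add: g_def power2_eq_square algebra_simps del: iter_dderiv.simps)
qed

text \<open>Schwarz's theorem. The second difference quotient is symmetric in \<open>u\<close> and
  \<open>v\<close>, and by \<open>second_difference\<close> it is a value of either mixed derivative
  at points tending to \<open>x\<close>.\<close>

lemma iter_dderiv_swap:
  fixes f :: "'a::real_normed_vector \<Rightarrow> real"
  assumes f: "smooth_on UNIV f"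
  shows "iter_dderiv [u, v] f = iter_dderiv [v, u] f"
proof
  fix x
  define h where "h = (\<lambda>n. inverse (real (Suc n)))"
  have hpos: "h n > 0" for n by (simp add: h_def)
  have h0: "h \<longlonglongrightarrow> 0" unfolding h_def by (rule LIMSEQ_inverse_real_of_nat)
  define Dl where "Dl = (\<lambda>n. (f (x + h n *\<^sub>R u + h n *\<^sub>R v) - f (x + h n *\<^sub>R u) - f (x + h n *\<^sub>R v) + f x) / (h n)\<^sup>2)"
  \<comment> \<open>One argument serves both orders, since \<open>Dl\<close> does not change when
    \<open>u\<close> and \<open>v\<close> are exchanged.\<close>
  have lim: "Dl \<longlonglongrightarrow> iter_dderiv [b, a] f x" if ab: "(a = u \<and> b = v) \<or> (a = v \<and> b = u)" for a b
  proof -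
    have "\<exists>s t. 0 < s \<and> s < h n \<and> 0 < t \<and> t < h n \<and> Dl n = iter_dderiv [b, a] f (x + s *\<^sub>R a + t *\<^sub>R b)" for n
    proof -
      obtain s t where st: "0 < s" "s < h n" "0 < t" "t < h n"
        "f (x + h n *\<^sub>R a + h n *\<^sub>R b) - f (x + h n *\<^sub>R a) - f (x + h n *\<^sub>R b) + f x
          = (h n)\<^sup>2 * iter_dderiv [b, a] f (x + s *\<^sub>R a + t *\<^sub>R b)"
        using second_difference[OF f hpos] by metis
      have "Dl n = (f (x + h n *\<^sub>R a + h n *\<^sub>R b) - f (x + h n *\<^sub>R a) - f (x + h n *\<^sub>R b) + f x) / (h n)\<^sup>2"
        using ab by (auto simp: Dl_def add.assoc add.commute[of "h n *\<^sub>R u"])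
      then have "Dl n = iter_dderiv [b, a] f (x + s *\<^sub>R a + t *\<^sub>R b)"
        using st(5) hpos[of n] by (simp del: iter_dderiv.simps)
      then show ?thesis using st by blast
    qed
    then obtain s t where st: "\<And>n. 0 < s n" "\<And>n. s n < h n" "\<And>n. 0 < t n" "\<And>n. t n < h n"
      "\<And>n. Dl n = iter_dderiv [b, a] f (x + s n *\<^sub>R a + t n *\<^sub>R b)"
      by metis
    have "s \<longlonglongrightarrow> 0" "t \<longlonglongrightarrow> 0"
      using st(1-4) by (auto intro!: tendsto_sandwich[OF _ _ tendsto_const h0] eventuallyI less_imp_le)
    then have "(\<lambda>n. x + s n *\<^sub>R a + t n *\<^sub>R b) \<longlonglongrightarrow> x + 0 *\<^sub>R a + 0 *\<^sub>R b"
      by (intro tendsto_intros)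
    from continuous_on_tendsto_compose[OF smooth_continuous[OF f, of UNIV "[b, a]"] this]
    have "(\<lambda>n. iter_dderiv [b, a] f (x + s n *\<^sub>R a + t n *\<^sub>R b)) \<longlonglongrightarrow> iter_dderiv [b, a] f x"
      by (simp del: iter_dderiv.simps)
    moreover have "Dl = (\<lambda>n. iter_dderiv [b, a] f (x + s n *\<^sub>R a + t n *\<^sub>R b))"
      using st(5) by (rule ext)
    ultimately show ?thesis by metis
  qed
  show "iter_dderiv [u, v] f x = iter_dderiv [v, u] f x"
    using LIMSEQ_unique[OF lim lim] by metis
qed

text \<open>Moves a direction from the innermost slot, where an inner product with the gradient puts
  it, to the outermost slot, where differentiation along the flow puts it.\<close>

lemma iter_dderiv_rotate3:
  fixes f :: "'a::real_normed_vector \<Rightarrow> real"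
  assumes f: "smooth_on UNIV f"
  shows "iter_dderiv [u, v, w] f = iter_dderiv [v, w, u] f"
proof -
  have "iter_dderiv [u, v, w] f = iter_dderiv [v, u] (iter_dderiv [w] f)"
    using iter_dderiv_swap[OF smooth_iter_dderiv[OF f], of u v "[w]"] by simp
  also have "\<dots> = iter_dderiv [v] (iter_dderiv [u, w] f)" by simp
  also have "\<dots> = iter_dderiv [v] (iter_dderiv [w, u] f)" using iter_dderiv_swap[OF f] by metis
  finally show ?thesis by simp
qed

lemma smooth_Maclaurin:
  fixes f :: "'a::real_normed_vector \<Rightarrow> real"
  assumes "smooth_on UNIV f"
  obtains t where "\<bar>t\<bar> \<le> 1" "f (x + w) = (\<Sum>m<n. iter_dderiv (replicate m w) f x / fact m)
      + iter_dderiv (replicate n w) f (x + t *\<^sub>R w) / fact n"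
  using Maclaurin_all_le[of "\<lambda>m s. iter_dderiv (replicate m w) f (x + s *\<^sub>R w)" "\<lambda>s. f (x + s *\<^sub>R w)" 1 n]
    smooth_has_real_derivative_line[OF assms, of "replicate _ w"]
  by auto

text \<open>The intermediate point of Taylor's formula stays within distance 1 of \<open>S\<close>,
  so one bound on the derivatives of order \<open>n\<close> over a larger ball serves all
  \<open>x\<close> and \<open>w\<close>.\<close>

lemma smooth_Maclaurin_bound:
  fixes f :: "'a::euclidean_space \<Rightarrow> real"
  assumes "smooth_on UNIV f" and "bounded S"
  shows "\<exists>M\<ge>0. \<forall>x\<in>S. \<forall>w. norm w \<le> 1 \<longrightarrow>
    \<bar>f (x + w) - (\<Sum>m<n. iter_dderiv (replicate m w) f x / fact m)\<bar> \<le> M * norm w ^ n"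
proof -
  obtain R where R: "\<And>x. x \<in> S \<Longrightarrow> norm x \<le> R" using assms(2) by (auto simp: bounded_iff)
  obtain M where M: "M \<ge> 0" "\<forall>x\<in>cball 0 (R + 1). \<forall>w. \<bar>iter_dderiv (replicate n w) f x\<bar> \<le> M * norm w ^ n"
    using iter_dderiv_replicate_bound[OF assms(1) compact_cball[of 0 "R + 1"], of n] by blast
  show ?thesis
  proof (intro exI[of _ M] conjI ballI allI impI M(1))
    fix x w :: 'a assume x: "x \<in> S" and w: "norm w \<le> 1"
    obtain t where t: "\<bar>t\<bar> \<le> 1" "f (x + w) = (\<Sum>m<n. iter_dderiv (replicate m w) f x / fact m)
      + iter_dderiv (replicate n w) f (x + t *\<^sub>R w) / fact n"
      using smooth_Maclaurin[OF assms(1)] by metis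
    have "norm (t *\<^sub>R w) \<le> 1" using t(1) w by (simp add: mult_le_one)
    then have "x + t *\<^sub>R w \<in> cball 0 (R + 1)"
      using R[OF x] norm_triangle_ineq[of x "t *\<^sub>R w"] by simp
    then have "\<bar>iter_dderiv (replicate n w) f (x + t *\<^sub>R w)\<bar> \<le> M * norm w ^ n" using M(2) by blast
    moreover have "\<bar>a / fact n\<bar> \<le> \<bar>a\<bar>" for a :: real
      by (simp add: divide_le_eq mult_le_cancel_left1)
    ultimately show "\<bar>f (x + w) - (\<Sum>m<n. iter_dderiv (replicate m w) f x / fact m)\<bar> \<le> M * norm w ^ n"
      using t(2) by (smt (verit))
  qed
qed

section \<open>Gradient and Hessian as first and second iterated derivatives\<close>

lemma grad_inner:
  assumes "smooth_on UNIV f"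
  shows "grad f x \<bullet> v = iter_dderiv [v] f x"
proof -
  have "grad f x \<bullet> v = (\<Sum>i\<in>UNIV. v $ i * iter_dderiv [axis i 1] f x)"
    by (simp add: grad_def inner_vec_def mult.commute)
  also have "\<dots> = (\<Sum>b\<in>Basis. (v \<bullet> b) *\<^sub>R iter_dderiv [b] f x)"
    unfolding Basis_vec_def
    by (simp add: UNION_singleton_eq_range sum.reindex inj_on_def axis_eq_axis inner_axis)
  finally show ?thesis using iter_dderiv_direction_expand[OF assms, of v "[]" x] by simp
qed

lemma grad_expand: "grad f = (\<lambda>x. \<Sum>i\<in>UNIV. iter_dderiv [axis i 1] f x *\<^sub>R axis i 1)"
  by (rule ext) (simp add: grad_def vec_eq_iff axis_def if_distrib cong: if_cong)

lemma smooth_grad: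
  assumes "smooth_on UNIV f" shows "smooth_on UNIV (grad f)"
  unfolding grad_expand
  by (intro smooth_sum smooth_linear_image[OF _ bounded_linear_scaleR_left] smooth_iter_dderiv assms)

lemma iter_dderiv_grad_inner:
  assumes "smooth_on UNIV f"
  shows "iter_dderiv vs (grad f) x \<bullet> w = iter_dderiv (vs @ [w]) f x"
proof -
  have "iter_dderiv vs (\<lambda>x. grad f x \<bullet> w) = (\<lambda>x. iter_dderiv vs (grad f) x \<bullet> w)"
    by (rule iter_dderiv_linear_image[OF smooth_grad[OF assms] bounded_linear_inner_left])
  then show ?thesis
    by (simp add: iter_dderiv_append grad_inner[OF assms] fun_eq_iff)
qed

lemma hess_mult:
  assumes "smooth_on UNIV f"
  shows "hess f x *v v = iter_dderiv [v] (grad f) x"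
proof (rule vec_eq_iff[THEN iffD2], rule allI)
  fix i
  have 1: "smooth_on UNIV (\<lambda>y. grad f y $ i)"
    by (rule smooth_linear_image[OF smooth_grad[OF assms] bounded_linear_vec_nth])
  have "(hess f x *v v) $ i = (\<Sum>j\<in>UNIV. v $ j * iter_dderiv [axis j 1] (\<lambda>y. grad f y $ i) x)"
    by (simp add: hess_def matrix_vector_mult_def mult.commute)
  also have "\<dots> = grad (\<lambda>y. grad f y $ i) x \<bullet> v"
    by (simp add: grad_def inner_vec_def mult.commute)
  also have "\<dots> = iter_dderiv [v] (\<lambda>y. grad f y $ i) x" by (rule grad_inner[OF 1])
  also have "\<dots> = iter_dderiv [v] (grad f) x $ i"
    using iter_dderiv_linear_image[OF smooth_grad[OF assms] bounded_linear_vec_nth, of "[v]"] by metis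
  finally show "(hess f x *v v) $ i = iter_dderiv [v] (grad f) x $ i" .
qed

lemma hess_form:
  assumes "smooth_on UNIV f"
  shows "w \<bullet> (hess f x *v v) = iter_dderiv [v, w] f x"
  using iter_dderiv_grad_inner[OF assms, of "[v]" x w]
  by (simp add: hess_mult[OF assms] inner_commute del: iter_dderiv.simps)

lemma matrix_entry_inner: "axis i 1 \<bullet> (A *v axis j 1) = (A::real^'n^'n) $ i $ j"
  by (simp add: inner_axis' matrix_vector_mul_component inner_axis)

lemma hess_symmetric:
  assumes "smooth_on UNIV f" shows "transpose (hess f x) = hess f x"
proof -
  have "hess f x $ j $ i = hess f x $ i $ j" for i j
    unfolding matrix_entry_inner[symmetric] hess_form[OF assms]
    by (metis iter_dderiv_swap[OF assms])
  then show ?thesis by (simp add: vec_eq_iff transpose_def)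
qed

subsection \<open>Orthonormal eigenbases\<close>

text \<open>Indexed by the coordinate type itself, so that a family is a full basis and forms the
  columns of a square matrix.\<close>

definition orthonormal_family :: "('n::finite \<Rightarrow> real^'n) \<Rightarrow> bool" where
  "orthonormal_family e \<longleftrightarrow> (\<forall>i j. e i \<bullet> e j = (if i = j then 1 else 0))"

lemma symmetric_matrix_inner:
  fixes H :: "real^'n^'n"
  assumes "transpose H = H"
  shows "x \<bullet> (H *v y) = (H *v x) \<bullet> y"
  by (metis assms dot_lmul_matrix vector_transpose_matrix)

text \<open>A maximiser \<open>y\<close> of the quadratic form on the unit sphere of
  \<open>W\<close> is an eigenvector: the form \<open>G\<close> is nonnegative on \<open>W\<close>
  and vanishes at \<open>y\<close>, and its first variation along the residual \<open>w\<close> is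
  \<open>2 * (w \<bullet> w)\<close>, which must then be zero. Invariance keeps the residual inside
  \<open>W\<close>.\<close>

lemma symmetric_eigenvector_in_subspace:
  fixes H :: "real^'n^'n"
  assumes sym: "transpose H = H" and W: "subspace W" and inv: "\<And>y. y \<in> W \<Longrightarrow> H *v y \<in> W"
    and ne: "w0 \<in> W" "w0 \<noteq> 0"
  obtains y l where "y \<in> W" "norm y = 1" "H *v y = l *\<^sub>R y"
proof -
  let ?S = "W \<inter> sphere 0 1"
  have cp: "compact ?S" using closed_subspace[OF W] by (simp add: closed_Int_compact)
  have "(1 / norm w0) *\<^sub>R w0 \<in> ?S" using ne W by (auto simp: subspace_scale)
  then have ne': "?S \<noteq> {}" by blast
  have ct: "continuous_on ?S (\<lambda>y. y \<bullet> (H *v y))"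
    by (intro continuous_on_inner continuous_on_id linear_continuous_on matrix_vector_mul_bounded_linear)
  obtain y where y: "y \<in> ?S" and max: "\<And>z. z \<in> ?S \<Longrightarrow> z \<bullet> (H *v z) \<le> y \<bullet> (H *v y)"
    using continuous_attains_sup[OF cp ne' ct] by blast
  define l where "l = y \<bullet> (H *v y)"
  define G where "G = (\<lambda>z. l * (z \<bullet> z) - z \<bullet> (H *v z))"
  have Gpos: "G z \<ge> 0" if "z \<in> W" for z
  proof (cases "z = 0")
    case False
    let ?z = "(1 / norm z) *\<^sub>R z"
    have "?z \<in> ?S" using that False W by (auto simp: subspace_scale)
    from max[OF this] have "(z \<bullet> (H *v z)) / (norm z)\<^sup>2 \<le> l"
      by (simp add: l_def matrix_vector_mult_scaleR power2_eq_square divide_divide_eq_left')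
    then show ?thesis using False by (simp add: G_def field_simps power2_norm_eq_inner)
  qed (simp add: G_def)
  define w where "w = l *\<^sub>R y - H *v y"
  have wW: "w \<in> W" using y W inv by (auto simp: w_def subspace_diff subspace_scale)
  have yy: "y \<bullet> y = 1" using y by (simp add: norm_eq_1)
  have exp: "G (y + t *\<^sub>R w) = 2 * t * (w \<bullet> w) + t\<^sup>2 * G w" for t
  proof -
    have 1: "y \<bullet> (H *v w) = w \<bullet> (H *v y)"
      using symmetric_matrix_inner[OF sym, of y w] by (simp add: inner_commute)
    have 2: "w \<bullet> w = l * (w \<bullet> y) - w \<bullet> (H *v y)"
      by (subst (2) w_def) (simp add: inner_diff_right)
    have 3: "G y = 0" by (simp add: G_def yy l_def)
    have "G (y + t *\<^sub>R w) = G y + 2 * t * (l * (w \<bullet> y) - w \<bullet> (H *v y)) + t\<^sup>2 * G w"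
      by (simp add: G_def matrix_vector_right_distrib inner_add_left inner_add_right 1
          inner_commute[of y w] power2_eq_square algebra_simps)
    then show ?thesis by (simp only: 2 3 add_0)
  qed
  have "w \<bullet> w = 0"
  proof (rule ccontr)
    assume "w \<bullet> w \<noteq> 0"
    then have pos: "w \<bullet> w > 0" using inner_ge_zero[of w] by linarith
    have Gw: "G w \<ge> 0" by (rule Gpos[OF wW])
    \<comment> \<open>A negative step so short that the linear term in \<open>exp\<close> beats the
      quadratic one; the \<open>1 +\<close> covers \<open>G w = 0\<close>.\<close>
    let ?t = "- (w \<bullet> w) / (1 + G w)"
    have "0 \<le> G (y + ?t *\<^sub>R w)" using y wW W by (intro Gpos subspace_add subspace_scale) auto
    also have "\<dots> = (w \<bullet> w) * (?t * (2 - G w / (1 + G w)))"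
      unfolding exp by (simp add: power2_eq_square diff_divide_distrib algebra_simps)
    also have "\<dots> < 0"
      using pos Gw by (intro mult_pos_neg mult_neg_pos) (auto simp: field_simps)
    finally show False by simp
  qed
  then have "H *v y = l *\<^sub>R y" by (simp add: w_def)
  then show ?thesis using that[of y l] y by simp
qed

text \<open>The orthogonal complement of a set of eigenvectors is invariant because \<open>H\<close>
  is symmetric, so the set can be enlarged by one eigenvector at a time until it is full. Starting
  from \<open>u\<close> puts a prescribed eigenvector into the basis.\<close>

lemma symmetric_orthonormal_eigenbasis:
  fixes H :: "real^'n^'n"
  assumes sym: "transpose H = H" and u: "norm u = 1" "H *v u = l0 *\<^sub>R u"
  obtains e l where "orthonormal_family e" "e k = u" "\<And>i. H *v e i = l i *\<^sub>R e i"
proof -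
  define P where "P = (\<lambda>S. finite S \<and> pairwise orthogonal S \<and> u \<in> S \<and> (\<forall>s\<in>S. norm s = 1 \<and> (\<exists>l. H *v s = l *\<^sub>R s)))"
  have "\<exists>S. P S \<and> card S = Suc m" if "Suc m \<le> CARD('n)" for m
    using that
  proof (induction m)
    case 0
    show ?case by (intro exI[of _ "{u}"]) (use u in \<open>auto simp: P_def\<close>)
  next
    case (Suc m)
    then obtain S where S: "P S" "card S = Suc m" by auto
    let ?W = "{y. \<forall>s\<in>S. s \<bullet> y = 0}"
    have "dim S < DIM(real^'n)"
      using dim_le_card'[of S] S Suc.prems by (simp add: P_def)
    then obtain w0 where w0: "w0 \<noteq> 0" "\<And>y. y \<in> span S \<Longrightarrow> orthogonal w0 y"
      by (rule orthogonal_to_subspace_exists) blast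
    have w0W: "w0 \<in> ?W" using w0(2) by (auto simp: orthogonal_def inner_commute span_base)
    have sW: "subspace ?W" by (auto simp: subspace_def inner_add_right)
    have iW: "H *v y \<in> ?W" if "y \<in> ?W" for y
    proof -
      have "s \<bullet> (H *v y) = 0" if "s \<in> S" for s
      proof -
        obtain l where "H *v s = l *\<^sub>R s" using S(1) \<open>s \<in> S\<close> by (auto simp: P_def)
        then show ?thesis
          using symmetric_matrix_inner[OF sym, of s y] \<open>s \<in> S\<close> \<open>y \<in> ?W\<close> by simp
      qed
      then show ?thesis by simp
    qed
    obtain y l where y: "y \<in> ?W" "norm y = 1" "H *v y = l *\<^sub>R y"
      by (rule symmetric_eigenvector_in_subspace[OF sym sW iW w0W w0(1)])
    have yS: "y \<notin> S" using y(1,2) norm_eq_1[of y] by auto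
    have "P (insert y S)"
      using S(1) y by (auto simp: P_def pairwise_insert orthogonal_def inner_commute)
    then show ?case using S yS by (intro exI[of _ "insert y S"]) (auto simp: P_def)
  qed
  from this[of "CARD('n) - 1"] obtain S where S: "P S" "card S = CARD('n)" by auto
  \<comment> \<open>The bijection fills only the other slots, so that slot \<open>k\<close> is left
    for \<open>u\<close>.\<close>
  then have "card (S - {u}) = card (UNIV - {k})" by (simp add: P_def)
  then obtain g where g: "bij_betw g (UNIV - {k}) (S - {u})"
    using S(1) by (metis P_def finite finite_Diff finite_same_card_bij)
  define e where "e = g(k := u)"
  have eS: "e i \<in> S" for i
    using g S(1) by (auto simp: e_def P_def bij_betw_def)
  have einj: "e i \<noteq> e j" if "i \<noteq> j" for i j
    using g that by (auto simp: e_def bij_betw_def inj_on_def)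
  have "\<forall>i. \<exists>l. H *v e i = l *\<^sub>R e i" using S(1) eS by (auto simp: P_def)
  then obtain l where l: "\<And>i. H *v e i = l i *\<^sub>R e i" by metis
  moreover have "orthonormal_family e"
    unfolding orthonormal_family_def
  proof (intro allI)
    fix i j
    have "norm (e i) = 1" using S(1) eS by (auto simp: P_def)
    then have "e i \<bullet> e i = 1" by (simp add: norm_eq_1)
    moreover have "e i \<bullet> e j = 0" if "i \<noteq> j"
      using S(1) eS[of i] eS[of j] einj[OF that] by (auto simp: P_def pairwise_def orthogonal_def)
    ultimately show "e i \<bullet> e j = (if i = j then 1 else 0)" by auto
  qed
  moreover have "e k = u" by (simp add: e_def)
  ultimately show ?thesis using that by blast
qed

section \<open>Determinant, trace and characteristic polynomial in an orthonormal eigenbasis\<close>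

definition basis_matrix :: "('n::finite \<Rightarrow> real^'n) \<Rightarrow> real^'n^'n" where
  "basis_matrix e = (\<chi> i j. e j $ i)"

lemma basis_matrix_orthogonal:
  assumes "orthonormal_family e" shows "orthogonal_matrix (basis_matrix e)"
proof -
  have "transpose (basis_matrix e) ** basis_matrix e = mat 1"
    using assms
    by (simp add: orthonormal_family_def vec_eq_iff matrix_matrix_mult_def transpose_def basis_matrix_def mat_def inner_vec_def)
  then show ?thesis by (simp add: orthogonal_matrix)
qed

lemma conj_basis_matrix_entry:
  "(transpose (basis_matrix e) ** A ** basis_matrix e) $ i $ j = e i \<bullet> (A *v e j)"
proof -
  have "basis_matrix e *v axis j 1 = e j" for j
    by (simp add: basis_matrix_def vec_eq_iff matrix_vector_mul_component inner_axis)
  then have "e i \<bullet> (A *v e j) = axis i 1 \<bullet> (transpose (basis_matrix e) *v (A *v (basis_matrix e *v axis j 1)))"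
    by (metis dot_lmul_matrix vector_transpose_matrix transpose_transpose inner_commute)
  also have "\<dots> = axis i 1 \<bullet> ((transpose (basis_matrix e) ** A ** basis_matrix e) *v axis j 1)"
    by (simp add: matrix_vector_mul_assoc matrix_mul_assoc)
  also have "\<dots> = (transpose (basis_matrix e) ** A ** basis_matrix e) $ i $ j"
    by (simp add: inner_axis' matrix_vector_mul_component inner_axis)
  finally show ?thesis by simp
qed

lemma det_conj_basis_matrix:
  assumes "orthonormal_family e"
  shows "det (transpose (basis_matrix e) ** A ** basis_matrix e) = det A"
proof -
  have "det (basis_matrix e) * det (basis_matrix e) = 1"
    using det_orthogonal_matrix[OF basis_matrix_orthogonal[OF assms]] by auto
  then show ?thesis by (simp add: det_mul)
qed

lemma trace_orthonormal:
  assumes "orthonormal_family e"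
  shows "trace A = (\<Sum>i\<in>UNIV. e i \<bullet> (A *v e i))"
proof -
  let ?B = "basis_matrix e"
  have "trace (transpose ?B ** A ** ?B) = trace ((?B ** transpose ?B) ** A)"
    by (metis trace_mul_sym matrix_mul_assoc)
  also have "\<dots> = trace A"
    using basis_matrix_orthogonal[OF assms] by (simp add: orthogonal_matrix_def)
  finally show ?thesis by (simp add: trace_def conj_basis_matrix_entry)
qed

lemma det_eigenbasis:
  assumes "orthonormal_family e" and "\<And>i. A *v e i = m i *\<^sub>R e i"
  shows "det A = (\<Prod>i\<in>UNIV. m i)"
proof -
  have "det A = det (transpose (basis_matrix e) ** A ** basis_matrix e)"
    using det_conj_basis_matrix[OF assms(1)] by simp
  also have "\<dots> = (\<Prod>i\<in>UNIV. m i)"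
    using assms by (subst det_diagonal) (auto simp: conj_basis_matrix_entry orthonormal_family_def)
  finally show ?thesis .
qed

lemma poly_det: "poly (det A) x = det (\<chi> i j. poly (A $ i $ j) x)"
  by (simp add: det_def poly_sum poly_prod poly_mult)

text \<open>Compared value by value: at each real \<open>x\<close> the left side is the determinant
  of \<open>x *\<^sub>R mat 1 - A\<close>, which has the same eigenbasis with eigenvalues
  \<open>x - l i\<close>.\<close>

lemma charpoly_eigenbasis:
  assumes "orthonormal_family e" and "\<And>i. A *v e i = l i *\<^sub>R e i"
  shows "charpoly A = (\<Prod>i\<in>UNIV. [:- l i, 1:])"
proof -
  have "poly (charpoly A) x = poly (\<Prod>i\<in>UNIV. [:- l i, 1:]) x" for x
  proof -
    have "poly (charpoly A) x = det (x *\<^sub>R mat 1 - A)"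
      unfolding charpoly_def poly_det
      by (rule arg_cong[of _ _ det]) (auto simp: vec_eq_iff mat_def)
    also have "\<dots> = (\<Prod>i\<in>UNIV. x - l i)"
      by (rule det_eigenbasis[OF assms(1)])
         (simp add: assms(2) matrix_vector_mult_diff_rdistrib scaleR_matrix_vector_assoc[symmetric] scaleR_left_diff_distrib)
    finally show ?thesis by (simp add: poly_prod)
  qed
  then show ?thesis using poly_eq_poly_eq_iff by blast
qed

text \<open>\<open>proots\<close> counts multiplicities, so a repeated eigenvalue occurs once for
  every index that carries it, and the product over roots becomes a product over indices.\<close>

lemma prod_nonzero_eigenvalues_eigenbasis:
  assumes "orthonormal_family e" and "\<And>i. A *v e i = l i *\<^sub>R e i"
  shows "prod_nonzero_eigenvalues A = (\<Prod>i\<in>{i. l i \<noteq> 0}. l i)"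
proof -
  have fin: "prod_mset (filter_mset (\<lambda>e. e \<noteq> 0) (\<Sum>i\<in>I. {#l i#})) = (\<Prod>i\<in>{i\<in>I. l i \<noteq> 0}. l i)" if "finite I" for I
    using that
  proof (induction I)
    case (insert i I)
    have "{j \<in> insert i I. l j \<noteq> 0} = (if l i = 0 then {j\<in>I. l j \<noteq> 0} else insert i {j\<in>I. l j \<noteq> 0})" by auto
    then show ?case using insert by auto
  qed simp
  have "proots (charpoly A) = (\<Sum>i\<in>UNIV. {#l i#})"
    unfolding charpoly_eigenbasis[OF assms] by (subst proots_prod) auto
  then show ?thesis unfolding prod_nonzero_eigenvalues_def using fin[of UNIV] by simp
qed

text \<open>A permutation other than the identity moves at least two indices. Differentiating one
  factor of its Leibniz term leaves an off-diagonal factor, which is zero, so only the identity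
  survives.\<close>

lemma has_real_derivative_det_at_diagonal:
  fixes N :: "real \<Rightarrow> real^'n^'n"
  assumes der: "\<And>i j. ((\<lambda>t. N t $ i $ j) has_real_derivative N' i j) (at t)"
    and diag: "\<And>i j. i \<noteq> j \<Longrightarrow> N t $ i $ j = 0"
  shows "((\<lambda>t. det (N t)) has_real_derivative (\<Sum>i\<in>UNIV. N' i i * (\<Prod>j\<in>UNIV - {i}. N t $ j $ j))) (at t)"
proof -
  let ?P = "{q. q permutes (UNIV::'n set)}"
  have "((\<lambda>t. det (N t)) has_real_derivative
      (\<Sum>q\<in>?P. of_int (sign q) * (\<Sum>i\<in>UNIV. N' i (q i) * (\<Prod>j\<in>UNIV - {i}. N t $ j $ q j)))) (at t)"
    unfolding det_def by (intro DERIV_sum DERIV_cmult has_field_derivative_prod der)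
  also have "(\<Sum>q\<in>?P. of_int (sign q) * (\<Sum>i\<in>UNIV. N' i (q i) * (\<Prod>j\<in>UNIV - {i}. N t $ j $ q j)))
      = (\<Sum>q\<in>?P. if q = id then (\<Sum>i\<in>UNIV. N' i i * (\<Prod>j\<in>UNIV - {i}. N t $ j $ j)) else 0)"
  proof (intro sum.cong refl)
    fix q assume q: "q \<in> ?P"
    have z: "(\<Prod>j\<in>UNIV - {i}. N t $ j $ q j) = 0" if nid: "q \<noteq> id" for i
    proof -
      obtain j where j: "q j \<noteq> j" using nid by (auto simp: fun_eq_iff)
      have inj: "inj q" using q by (simp add: permutes_inj)
      \<comment> \<open>Both \<open>j\<close> and \<open>q j\<close> are moved, and at most one of
        them is the differentiated index \<open>i\<close>.\<close>
      have "q (q j) \<noteq> q j" using j inj by (metis injD)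
      then obtain j' where "j' \<noteq> i" "q j' \<noteq> j'" using j by metis
      then show ?thesis using diag[of j' "q j'"] by (intro prod_zero) auto
    qed
    show "of_int (sign q) * (\<Sum>i\<in>UNIV. N' i (q i) * (\<Prod>j\<in>UNIV - {i}. N t $ j $ q j))
        = (if q = id then (\<Sum>i\<in>UNIV. N' i i * (\<Prod>j\<in>UNIV - {i}. N t $ j $ j)) else 0)"
    proof (cases "q = id")
      case False
      show ?thesis unfolding z[OF False] using False by simp
    qed simp
  qed
  also have "\<dots> = (\<Sum>i\<in>UNIV. N' i i * (\<Prod>j\<in>UNIV - {i}. N t $ j $ j))"
    by (simp add: permutes_id finite_permutations)
  finally show ?thesis .
qed

lemma orthonormal_family_orthogonal_transformation:
  assumes "orthonormal_family e"
  shows "orthogonal_transformation (\<lambda>z. \<Sum>i\<in>UNIV. (z $ i) *\<^sub>R e i)"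
proof -
  have eq: "(\<Sum>i\<in>UNIV. (z $ i) *\<^sub>R e i) = basis_matrix e *v z" for z
    by (simp add: vec_eq_iff basis_matrix_def matrix_vector_mult_def mult.commute)
  show ?thesis
    unfolding eq using basis_matrix_orthogonal[OF assms]
    by (simp add: orthogonal_transformation_matrix)
qed

subsection \<open>Lebesgue measure and slab integrals\<close>

lemma nn_integral_lborel_translate:
  fixes f :: "'a::euclidean_space \<Rightarrow> ennreal"
  assumes [measurable]: "f \<in> borel_measurable borel"
  shows "(\<integral>\<^sup>+ x. f (x + t) \<partial>lborel) = (\<integral>\<^sup>+ x. f x \<partial>lborel)"
proof -
  have "(\<integral>\<^sup>+ x. f x \<partial>lborel) = (\<integral>\<^sup>+ x. f x \<partial>distr lborel borel ((+) t))"
    by (simp add: lborel_distr_plus)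
  also have "\<dots> = (\<integral>\<^sup>+ x. f (x + t) \<partial>lborel)"
    by (subst nn_integral_distr) (auto simp: add.commute)
  finally show ?thesis by simp
qed

lemma nn_integral_lborel_reflect:
  fixes f :: "'a::euclidean_space \<Rightarrow> ennreal"
  assumes [measurable]: "f \<in> borel_measurable borel"
  shows "(\<integral>\<^sup>+ x. f (t - x) \<partial>lborel) = (\<integral>\<^sup>+ x. f x \<partial>lborel)"
proof -
  have "(\<integral>\<^sup>+ x. f x \<partial>lborel) = (\<integral>\<^sup>+ x. f x \<partial>distr lborel borel (\<lambda>x. t + (-1) *\<^sub>R x))"
    by (subst lborel_affine[of "-1" t]) (simp_all add: density_1)
  also have "\<dots> = (\<integral>\<^sup>+ x. f (t - x) \<partial>lborel)"
    by (subst nn_integral_distr) auto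
  finally show ?thesis by simp
qed

text \<open>The classical uniqueness proof for invariant measures: comparing the double integral of
  \<open>f (x + y) * g y\<close> in both orders shows that the image measure and Lebesgue measure agree up to
  the factor they assign to the ball, and the ball is rotation invariant.\<close>

lemma lborel_distr_orthogonal:
  fixes R :: "'a::euclidean_space \<Rightarrow> 'a"
  assumes R: "orthogonal_transformation R"
  shows "distr lborel borel R = lborel"
proof -
  have lin: "linear R" using R by (simp add: orthogonal_transformation_def)
  have [measurable]: "R \<in> borel \<rightarrow>\<^sub>M borel"
    by (intro borel_measurable_continuous_onI linear_continuous_on linear_conv_bounded_linear[THEN iffD1] lin)
  obtain R' where R': "\<And>x. R (R' x) = x"
    using orthogonal_transformation_surj[OF R] by (metis surj_def)
  define g where "g = (indicator (ball (0::'a) 1) :: 'a \<Rightarrow> ennreal)"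
  have [measurable]: "g \<in> borel_measurable borel" by (simp add: g_def borel_measurable_indicator)
  have gR: "g (R x) = g x" for x
    using orthogonal_transformation_norm[OF R] by (simp add: g_def indicator_def)
  define c where "c = emeasure lborel (ball (0::'a) 1)"
  have c0: "c \<noteq> 0"
    using content_ball_pos[of 1 "0::'a"] by (auto simp: c_def measure_def)
  have ctop: "c \<noteq> \<infinity>" unfolding c_def using emeasure_lborel_ball_finite by (metis less_irrefl infinity_ennreal_def)
  have cg: "(\<integral>\<^sup>+ x. g x \<partial>lborel) = c" by (simp add: c_def g_def)
  have main: "(\<integral>\<^sup>+ x. f (R x) \<partial>lborel) = (\<integral>\<^sup>+ x. f x \<partial>lborel)" if [measurable]: "f \<in> borel_measurable borel" for f :: "'a \<Rightarrow> ennreal"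
  proof -
    have "(\<integral>\<^sup>+ x. f x \<partial>lborel) * c = (\<integral>\<^sup>+ y. (\<integral>\<^sup>+ x. f (x + R y) * g (R y) \<partial>lborel) \<partial>lborel)"
      unfolding gR using nn_integral_lborel_translate[of f]
      by (simp add: nn_integral_multc nn_integral_cmult cg)
    also have "\<dots> = (\<integral>\<^sup>+ x. (\<integral>\<^sup>+ y. f (x + R y) * g (R y) \<partial>lborel) \<partial>lborel)"
      by (intro lborel_pair.Fubini') measurable
    also have "\<dots> = (\<integral>\<^sup>+ x. (\<integral>\<^sup>+ y. f (R y) * g (R y - x) \<partial>lborel) \<partial>lborel)"
    proof (rule nn_integral_cong)
      fix x :: 'a
      have "(\<integral>\<^sup>+ y. f (R y) * g (R y - x) \<partial>lborel) = (\<integral>\<^sup>+ y. f (R (y + R' x)) * g (R (y + R' x) - x) \<partial>lborel)"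
        by (rule nn_integral_lborel_translate[symmetric, of "\<lambda>y. f (R y) * g (R y - x)" "R' x"]) measurable
      then show "(\<integral>\<^sup>+ y. f (x + R y) * g (R y) \<partial>lborel) = (\<integral>\<^sup>+ y. f (R y) * g (R y - x) \<partial>lborel)"
        by (simp add: linear_add[OF lin] R' add.commute)
    qed
    also have "\<dots> = (\<integral>\<^sup>+ y. (\<integral>\<^sup>+ x. f (R y) * g (R y - x) \<partial>lborel) \<partial>lborel)"
      by (intro lborel_pair.Fubini') measurable
    also have "\<dots> = (\<integral>\<^sup>+ y. f (R y) * c \<partial>lborel)"
      using nn_integral_lborel_reflect[of g] by (simp add: nn_integral_cmult cg)
    also have "\<dots> = (\<integral>\<^sup>+ y. f (R y) \<partial>lborel) * c"
      by (simp add: nn_integral_multc)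
    finally show ?thesis
      using c0 ctop by (metis ennreal_mult_cancel_left mult.commute infinity_ennreal_def)
  qed
  show ?thesis
  proof (rule measure_eqI)
    fix A assume "A \<in> sets (distr lborel borel R)"
    then have [measurable]: "A \<in> sets borel" by simp
    have "emeasure (distr lborel borel R) A = (\<integral>\<^sup>+ x. indicator A (R x) \<partial>lborel)"
      by (subst nn_integral_distr[of R lborel borel "indicator A", symmetric]) auto
    then show "emeasure (distr lborel borel R) A = emeasure lborel A"
      using main[of "indicator A"] by simp
  qed simp
qed

text \<open>Rotation and coordinate stretches are kept apart so that the factor along one axis can
  be 1 while the others shrink; the Jacobian is just the product of the factors.\<close>

lemma integral_lborel_stretch_orthogonal:
  fixes R :: "'a::euclidean_space \<Rightarrow> 'a" and f :: "'a \<Rightarrow> real"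
  assumes R: "orthogonal_transformation R" and f [measurable]: "f \<in> borel_measurable borel"
    and c: "\<And>j. j \<in> Basis \<Longrightarrow> c j > 0"
  shows "(LINT y|lborel. f y) = (\<Prod>j\<in>Basis. c j) * (LINT z|lborel. f (x + R (\<Sum>j\<in>Basis. (c j * (z \<bullet> j)) *\<^sub>R j)))"
proof -
  have lin: "linear R" using R by (simp add: orthogonal_transformation_def)
  have [measurable]: "R \<in> borel \<rightarrow>\<^sub>M borel"
    by (intro borel_measurable_continuous_onI linear_continuous_on linear_conv_bounded_linear[THEN iffD1] lin)
  let ?T = "\<lambda>z::'a. 0 + (\<Sum>j\<in>Basis. (c j * (z \<bullet> j)) *\<^sub>R j)"
  have "(LINT y|lborel. f y) = (LINT y|distr lborel borel ((+) x). f y)"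
    by (simp add: lborel_distr_plus)
  also have "\<dots> = (LINT y|lborel. f (x + y))"
    by (subst integral_distr) auto
  also have "\<dots> = (LINT y|distr lborel borel R. f (x + y))"
    by (simp add: lborel_distr_orthogonal[OF R])
  also have "\<dots> = (LINT y|lborel. f (x + R y))"
    by (subst integral_distr) auto
  also have "\<dots> = (LINT y|density (distr lborel borel ?T) (\<lambda>_. ennreal (\<Prod>j\<in>Basis. \<bar>c j\<bar>)). f (x + R y))"
    using c by (subst lborel_affine_euclidean[of c 0, symmetric]) force+
  also have "\<dots> = (LINT y|distr lborel borel ?T. (\<Prod>j\<in>Basis. \<bar>c j\<bar>) *\<^sub>R f (x + R y))"
    by (subst integral_density) (auto simp: prod_nonneg)
  also have "\<dots> = (LINT z|lborel. (\<Prod>j\<in>Basis. \<bar>c j\<bar>) *\<^sub>R f (x + R (?T z)))"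
    by (subst integral_distr) auto
  also have "(\<Prod>j\<in>Basis. \<bar>c j\<bar>) = (\<Prod>j\<in>Basis. c j)" using c by (intro prod.cong) (auto simp: less_imp_le)
  finally show ?thesis by simp
qed

section \<open>Gaussian integrals over the unit slab\<close>

lemma integrable_lborel_prod:
  fixes f :: "'a::euclidean_space \<Rightarrow> real \<Rightarrow> real"
  assumes "\<And>b. b \<in> Basis \<Longrightarrow> integrable lborel (f b)"
  shows "integrable lborel (\<lambda>x::'a. \<Prod>b\<in>Basis. f b (x \<bullet> b))"
proof -
  interpret product_sigma_finite "\<lambda>_::'a. lborel :: real measure" ..
  have [measurable]: "f b \<in> borel_measurable borel" if "b \<in> Basis" for b
    using borel_measurable_integrable[OF assms[OF that]] by simp
  have "integrable (\<Pi>\<^sub>M b\<in>Basis. lborel) (\<lambda>x. \<Prod>b\<in>Basis. f b (x b))"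
    using assms by (intro product_integrable_prod) auto
  then have "integrable (\<Pi>\<^sub>M b\<in>Basis. lborel) (\<lambda>x. \<Prod>b\<in>Basis. f b ((\<Sum>j\<in>Basis. x j *\<^sub>R j) \<bullet> b))"
    by (rule Bochner_Integration.integrable_cong[OF refl, THEN iffD1, rotated])
       (auto intro!: prod.cong simp: inner_sum_left inner_Basis if_distrib cong: if_cong)
  then show ?thesis
    by (subst lborel_eq, subst integrable_distr_eq) auto
qed

lemma integrable_gaussian:
  assumes "c > 0" shows "integrable lborel (\<lambda>x::real. exp (- c * x\<^sup>2))"
proof -
  \<comment> \<open>Variance \<open>1 / (2 * c)\<close> produces the exponent
    \<open>- c * x\<^sup>2\<close>; the prefactor undoes the normalisation of the density.\<close>
  have "integrable lborel (\<lambda>x. sqrt (2 * pi * (1 / (2 * c))) * normal_density 0 (sqrt (1 / (2 * c))) x)"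
    using assms by (intro integrable_mult_right integrable_normal_density) simp
  moreover have "(\<lambda>x. sqrt (2 * pi * (1 / (2 * c))) * normal_density 0 (sqrt (1 / (2 * c))) x) = (\<lambda>x. exp (- c * x\<^sup>2))"
    using assms by (simp add: normal_density_def real_sqrt_mult real_sqrt_divide power_divide field_simps)
  ultimately show ?thesis by metis
qed

text \<open>The weight splits over the coordinates, with an interval indicator in slot
  \<open>k\<close> and one-dimensional Gaussians elsewhere, so integrability reduces to the real
  line.\<close>

lemma indicator_slab_gaussian_eq_prod:
  fixes z :: "real^'n"
  shows "indicator {z. 0 \<le> z $ k \<and> z $ k \<le> 1} z * exp (- c * (norm (z - (z $ k) *\<^sub>R axis k 1))\<^sup>2)
    = (\<Prod>b\<in>Basis. if b = axis k 1 then indicator {0..1} (z \<bullet> b) else exp (- c * (z \<bullet> b)\<^sup>2))"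
proof -
  have "(norm (z - (z $ k) *\<^sub>R axis k 1))\<^sup>2 = (\<Sum>i\<in>UNIV. if i = k then 0 else (z $ i)\<^sup>2)"
    unfolding power2_norm_eq_inner inner_vec_def
    by (intro sum.cong) (auto simp: axis_def power2_eq_square)
  also have "\<dots> = (\<Sum>i\<in>UNIV - {k}. (z $ i)\<^sup>2)"
    by (simp add: sum.remove[of UNIV k] cong: sum.cong) (rule sum.cong, auto)
  finally have n: "(norm (z - (z $ k) *\<^sub>R axis k 1))\<^sup>2 = (\<Sum>i\<in>UNIV - {k}. (z $ i)\<^sup>2)" .
  have "(\<Prod>b\<in>Basis. if b = axis k 1 then indicator {0..1} (z \<bullet> b) else exp (- c * (z \<bullet> b)\<^sup>2))
     = (\<Prod>i\<in>UNIV. if i = k then indicator {0..1} (z $ i) else exp (- c * (z $ i)\<^sup>2))"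
    unfolding Basis_vec_def
    by (simp add: UNION_singleton_eq_range prod.reindex inj_on_def axis_eq_axis)
       (intro prod.cong refl, simp add: inner_axis)
  also have "\<dots> = indicator {0..1} (z $ k) * (\<Prod>i\<in>UNIV - {k}. exp (- c * (z $ i)\<^sup>2))"
    by (subst prod.remove[of UNIV k]) (auto intro!: prod.cong)
  also have "(\<Prod>i\<in>UNIV - {k}. exp (- c * (z $ i)\<^sup>2)) = exp (- c * (\<Sum>i\<in>UNIV - {k}. (z $ i)\<^sup>2))"
    by (simp add: exp_sum sum_distrib_left sum_negf[symmetric] del: sum_negf)
  finally show ?thesis unfolding n by (simp add: indicator_def)
qed

lemma integrable_slab_gaussian:
  fixes k :: "'n::finite"
  assumes "c > 0"
  shows "integrable lborel (\<lambda>z::real^'n. indicator {z. 0 \<le> z $ k \<and> z $ k \<le> 1} z * exp (- c * (norm (z - (z $ k) *\<^sub>R axis k 1))\<^sup>2))"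
  unfolding indicator_slab_gaussian_eq_prod
proof (rule integrable_lborel_prod)
  fix b :: "real^'n"
  show "integrable lborel (\<lambda>t. if b = axis k 1 then indicator {0..1} t else exp (- c * t\<^sup>2))"
    using integrable_gaussian[OF assms] by (cases "b = axis k 1") (auto intro!: integrable_real_indicator)
qed

text \<open>Were the integral zero, the integrand would vanish almost everywhere, yet it is positive
  on the open unit box, which has measure one. Strict positivity matters because this constant is
  later divided by.\<close>

lemma slab_gaussian_integral_pos:
  fixes k :: "'n::finite"
  assumes "c > 0"
  shows "(LINT z:{z::real^'n. 0 \<le> z $ k \<and> z $ k \<le> 1}|lborel. exp (- c * (norm (z - (z $ k) *\<^sub>R axis k 1))\<^sup>2)) > 0"
    (is "?I > 0")
proof -
  let ?f = "\<lambda>z::real^'n. indicator {z. 0 \<le> z $ k \<and> z $ k \<le> 1} z * exp (- c * (norm (z - (z $ k) *\<^sub>R axis k 1))\<^sup>2)"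
  have int: "integrable lborel ?f" by (rule integrable_slab_gaussian[OF assms])
  have nn: "?f z \<ge> 0" for z by simp
  have "integral\<^sup>L lborel ?f \<noteq> 0"
  proof
    assume "integral\<^sup>L lborel ?f = 0"
    then have "AE z in lborel. ?f z = 0"
      using integral_nonneg_eq_0_iff_AE[OF int] by simp
    then have "AE z in lborel. z \<notin> box 0 (1 :: real^'n)"
      by (rule AE_mp) (auto intro!: AE_I2 simp: mem_box_cart indicator_def intro: less_imp_le)
    then have "emeasure lborel (box 0 (1::real^'n)) = 0"
      by (subst (asm) AE_iff_measurable[of "box 0 1"]) auto
    moreover have "emeasure lborel (box 0 (1::real^'n)) = 1"
      by (subst emeasure_lborel_box) (auto simp: Basis_vec_def inner_axis intro!: prod.neutral)
    ultimately show False by simp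
  qed
  moreover have "integral\<^sup>L lborel ?f \<ge> 0" by (rule Bochner_Integration.integral_nonneg) (rule nn)
  ultimately have "integral\<^sup>L lborel ?f > 0" by linarith
  then show ?thesis by (simp add: set_lebesgue_integral_def)
qed

text \<open>The point reflection \<open>z \<mapsto> axis k 1 - z\<close> preserves the slab and
  negates the projection to the hyperplane. This is what permits averaging over opposite
  points.\<close>

lemma slab_integral_reflect:
  fixes f :: "real^'n \<Rightarrow> real"
  assumes [measurable]: "f \<in> borel_measurable borel"
  shows "(LINT z:{z. 0 \<le> z $ k \<and> z $ k \<le> 1}|lborel. f (z - (z $ k) *\<^sub>R axis k 1))
    = (LINT z:{z. 0 \<le> z $ k \<and> z $ k \<le> 1}|lborel. f (- (z - (z $ k) *\<^sub>R axis k 1)))"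
proof -
  let ?S = "{z::real^'n. 0 \<le> z $ k \<and> z $ k \<le> 1}"
  let ?h = "\<lambda>z. indicator ?S z *\<^sub>R f (z - (z $ k) *\<^sub>R axis k 1)"
  have [measurable]: "?S \<in> sets borel" by measurable
  have [measurable]: "?h \<in> borel_measurable borel" by measurable
  have "(LINT z|lborel. ?h z) = (LINT z|distr lborel borel (\<lambda>z. axis k 1 + (-1) *\<^sub>R z). ?h z)"
    by (subst lborel_affine[of "-1" "axis k 1"]) (simp_all add: density_1)
  also have "\<dots> = (LINT z|lborel. ?h (axis k 1 + (-1) *\<^sub>R z))"
    by (subst integral_distr) auto
  also have "\<dots> = (LINT z|lborel. indicator ?S z *\<^sub>R f (- (z - (z $ k) *\<^sub>R axis k 1)))"
    by (intro Bochner_Integration.integral_cong)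
       (auto simp: indicator_def axis_def algebra_simps)
  finally show ?thesis by (simp add: set_lebesgue_integral_def)
qed

subsection \<open>Estimates for the exponential\<close>

text \<open>A mean value bound in which the derivative is controlled by a common lower bound
  \<open>m\<close> of both exponents; a smaller \<open>m\<close> leaves decay to spare for
  polynomial factors.\<close>

lemma exp_minus_diff_le:
  fixes P q m :: real
  assumes "m \<le> P" "m \<le> q"
  shows "\<bar>exp (- P) - exp (- q)\<bar> \<le> \<bar>P - q\<bar> * exp (- m)"
proof -
  have *: "exp (- x) - exp (- y) \<le> (y - x) * exp (- m)" if "x \<le> y" "m \<le> x" for x y :: real
  proof -
    have "exp (- x) - exp (- y) = exp (- x) * (1 - exp (x - y))"
      by (simp add: right_diff_distrib mult_exp_exp)
    also have "\<dots> \<le> exp (- m) * (y - x)"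
    proof (intro mult_mono)
      show "1 - exp (x - y) \<le> y - x" using exp_ge_add_one_self[of "x - y"] by linarith
    qed (use that in auto)
    finally show ?thesis by (simp add: mult.commute)
  qed
  show ?thesis
  proof (cases "P \<le> q")
    case True
    then show ?thesis using *[OF True assms(1)] by simp
  next
    case False
    then show ?thesis using *[of q P] assms by simp
  qed
qed

text \<open>With \<open>s = q - P\<close> the error is \<open>exp (- q) * (exp s - 1 - s)\<close>,
  which is nonnegative and at most \<open>exp (- q) * (s * (exp s - 1))\<close>; the first-order
  bound finishes. This gives up the factor 1/2 of Taylor's formula but treats both signs of
  \<open>s\<close> alike.\<close>

lemma exp_minus_second_order:
  fixes P q m :: real
  assumes "m \<le> P" "m \<le> q"
  shows "\<bar>exp (- P) - exp (- q) + (P - q) * exp (- q)\<bar> \<le> (P - q)\<^sup>2 * exp (- m)"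
proof -
  define s where "s = q - P"
  have eq: "exp (- P) - exp (- q) + (P - q) * exp (- q) = exp (- q) * (exp s - 1 - s)"
    by (simp add: s_def algebra_simps mult_exp_exp)
  have low: "0 \<le> exp s - 1 - s" using exp_ge_add_one_self[of s] by linarith
  have "exp s * (1 - s) \<le> exp s * exp (- s)"
    using exp_ge_add_one_self[of "- s"] by (intro mult_left_mono) auto
  then have up: "exp s - 1 - s \<le> s * (exp s - 1)" by (simp add: algebra_simps mult_exp_exp)
  have es: "exp (- q) * exp s = exp (- P)" by (simp add: s_def mult_exp_exp)
  have "s * (exp (- q) * (exp s - 1)) \<le> \<bar>s\<bar> * (\<bar>s\<bar> * exp (- m))"
  proof -
    have "\<bar>exp (- q) * (exp s - 1)\<bar> \<le> \<bar>s\<bar> * exp (- m)"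
      using exp_minus_diff_le[OF assms] es by (simp add: s_def right_diff_distrib abs_minus_commute)
    then have "\<bar>s * (exp (- q) * (exp s - 1))\<bar> \<le> \<bar>s\<bar> * (\<bar>s\<bar> * exp (- m))"
      unfolding abs_mult[of s] by (intro mult_left_mono) auto
    then show ?thesis by linarith
  qed
  moreover have "exp (- q) * (exp s - 1 - s) \<le> exp (- q) * (s * (exp s - 1))"
    using up by (intro mult_left_mono) auto
  moreover have "exp (- q) * (s * (exp s - 1)) = s * (exp (- q) * (exp s - 1))" by (rule mult.left_commute)
  ultimately have "exp (- q) * (exp s - 1 - s) \<le> \<bar>s\<bar> * (\<bar>s\<bar> * exp (- m))" by linarith
  also have "\<dots> = (P - q)\<^sup>2 * exp (- m)"
    by (simp add: s_def power2_eq_square abs_minus_commute[of q P] mult.assoc[symmetric])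
  finally show ?thesis unfolding eq using low by simp
qed

text \<open>Averaging over the two opposite points makes the first-order errors \<open>P - q\<close> and \<open>u1 - u0\<close> enter
  only through their products and through \<open>P + N - 2 * q\<close> and \<open>u1 + u2 - 2 * u0\<close>.\<close>

lemma symmetrised_exp_bound:
  fixes P N q u1 u2 u0 :: real
  assumes q: "q \<ge> 0" and P: "P \<ge> q / 2" and N: "N \<ge> q / 2"
    and a3: "\<bar>P - q\<bar> \<le> a3" "\<bar>N - q\<bar> \<le> a3" and a4: "\<bar>P + N - 2 * q\<bar> \<le> a4"
    and b1: "\<bar>u1 - u0\<bar> \<le> b1" "\<bar>u2 - u0\<bar> \<le> b1" and b2: "\<bar>u1 + u2 - 2 * u0\<bar> \<le> b2" and B: "\<bar>u0\<bar> \<le> B"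
  shows "\<bar>(exp (- P) * u1 + exp (- N) * u2) / 2 - exp (- q) * u0\<bar>
    \<le> exp (- (q / 2)) * (B * (a4 / 2 + a3\<^sup>2) + a3 * b1 + b2 / 2)"
proof -
  define E where "E = exp (- (q / 2))"
  have Eq: "exp (- q) \<le> E" using q by (simp add: E_def)
  have E0: "E > 0" by (simp add: E_def)
  have q2: "q / 2 \<le> q" using q by simp
  have dP: "\<bar>exp (- P) - exp (- q)\<bar> \<le> a3 * E"
    using exp_minus_diff_le[OF P q2] mult_right_mono[OF a3(1), of E] E0 unfolding E_def by linarith
  have dN: "\<bar>exp (- N) - exp (- q)\<bar> \<le> a3 * E"
    using exp_minus_diff_le[OF N q2] mult_right_mono[OF a3(2), of E] E0 unfolding E_def by linarith
  have sq: "(P - q)\<^sup>2 * E \<le> a3\<^sup>2 * E" "(N - q)\<^sup>2 * E \<le> a3\<^sup>2 * E"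
    using a3 E0 by (auto intro!: mult_right_mono simp: abs_le_square_iff[symmetric])
  have "exp (- P) + exp (- N) - 2 * exp (- q)
     = (exp (- P) - exp (- q) + (P - q) * exp (- q)) + (exp (- N) - exp (- q) + (N - q) * exp (- q)) - (P + N - 2 * q) * exp (- q)"
    by (simp add: algebra_simps)
  moreover have "\<bar>(P + N - 2 * q) * exp (- q)\<bar> \<le> a4 * E"
    unfolding abs_mult using a4 Eq by (intro mult_mono) auto
  ultimately have s: "\<bar>exp (- P) + exp (- N) - 2 * exp (- q)\<bar> \<le> (a4 + 2 * a3\<^sup>2) * E"
    using exp_minus_second_order[OF P q2] exp_minus_second_order[OF N q2] sq
    unfolding E_def[symmetric] by (simp add: algebra_simps)
  have t1: "\<bar>u0 * (exp (- P) + exp (- N) - 2 * exp (- q))\<bar> \<le> B * ((a4 + 2 * a3\<^sup>2) * E)"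
    unfolding abs_mult using B s by (intro mult_mono) auto
  have t2: "\<bar>exp (- q) * (u1 + u2 - 2 * u0)\<bar> \<le> E * b2"
    unfolding abs_mult using Eq b2 E0 by (intro mult_mono) auto
  have t3: "\<bar>(exp (- P) - exp (- q)) * (u1 - u0)\<bar> \<le> (a3 * E) * b1"
    unfolding abs_mult using dP b1 by (intro mult_mono) auto
  have t4: "\<bar>(exp (- N) - exp (- q)) * (u2 - u0)\<bar> \<le> (a3 * E) * b1"
    unfolding abs_mult using dN b1 by (intro mult_mono) auto
  have "2 * ((exp (- P) * u1 + exp (- N) * u2) / 2 - exp (- q) * u0)
    = u0 * (exp (- P) + exp (- N) - 2 * exp (- q)) + exp (- q) * (u1 + u2 - 2 * u0)
      + (exp (- P) - exp (- q)) * (u1 - u0) + (exp (- N) - exp (- q)) * (u2 - u0)"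
    by (simp add: algebra_simps)
  then have "\<bar>2 * ((exp (- P) * u1 + exp (- N) * u2) / 2 - exp (- q) * u0)\<bar>
    \<le> B * ((a4 + 2 * a3\<^sup>2) * E) + E * b2 + (a3 * E) * b1 + (a3 * E) * b1"
    using t1 t2 t3 t4 by linarith
  also have "\<dots> = 2 * (E * (B * (a4 / 2 + a3\<^sup>2) + a3 * b1 + b2 / 2))" by (simp add: algebra_simps)
  finally show ?thesis unfolding E_def[symmetric] abs_mult by simp
qed

text \<open>The decay \<open>exp (- (q / 2))\<close> is split into two equal factors: one absorbs
  the polynomial, the other remains. The powers of \<open>R\<close> are those that the Taylor
  remainders produce after rescaling.\<close>

lemma poly_times_exp_bound:
  assumes "\<kappa> \<ge> (0::real)"
  shows "\<exists>K\<ge>0. \<forall>q\<ge>0. \<forall>R\<ge>0. R \<le> \<kappa> * q \<longrightarrow> (R + R\<^sup>2 + R ^ 3) * exp (- (q / 2)) \<le> K * exp (- (q / 4))"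
\<comment> \<open>The 6 clears the denominators of the cubic Taylor polynomial of
  \<open>exp\<close>; the base is at least 1, so its cube dominates its lower powers.\<close>
proof (intro exI[of _ "6 * (1 + 4 * \<kappa>) ^ 3"] conjI allI impI)
  show "0 \<le> 6 * (1 + 4 * \<kappa>) ^ 3" using assms by simp
  fix q R :: real assume q: "q \<ge> 0" and R: "R \<ge> 0" "R \<le> \<kappa> * q"
  define h where "h = q / 4"
  have h: "h \<ge> 0" using q by (simp add: h_def)
  obtain t where "\<bar>t\<bar> \<le> \<bar>h\<bar>" and t: "exp h = (\<Sum>m<4. h ^ m / fact m) + exp t / fact 4 * h ^ 4"
    using Maclaurin_exp_le[of h 4] by (metis (no_types, lifting) mult.commute times_divide_eq_left)
  then have "exp h \<ge> 1 + h + h\<^sup>2 / 2 + h ^ 3 / 6"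
    using h by (simp add: t eval_nat_numeral fact_numeral)
  moreover have "0 \<le> h\<^sup>2" "0 \<le> h ^ 3" using h by auto
  ultimately have e: "h + h\<^sup>2 + h ^ 3 \<le> 6 * exp h" using h by linarith
  define k where "k = 1 + 4 * \<kappa>"
  have k: "k \<ge> 1" using assms by (simp add: k_def)
  have R': "R \<le> k * h"
  proof -
    have "R \<le> 4 * \<kappa> * h" using R by (simp add: h_def)
    also have "\<dots> \<le> k * h" using h by (simp add: k_def algebra_simps)
    finally show ?thesis .
  qed
  have "R + R\<^sup>2 + R ^ 3 \<le> k * h + (k * h)\<^sup>2 + (k * h) ^ 3"
    using R(1) R' by (intro add_mono power_mono) auto
  also have "\<dots> \<le> k ^ 3 * h + k ^ 3 * h\<^sup>2 + k ^ 3 * h ^ 3"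
    unfolding power_mult_distrib using k h
    by (intro add_mono mult_right_mono power_increasing self_le_power) auto
  also have "\<dots> \<le> k ^ 3 * (6 * exp h)"
    unfolding distrib_left[symmetric] using e k by (intro mult_left_mono) auto
  finally have "(R + R\<^sup>2 + R ^ 3) * exp (- (q / 2)) \<le> (k ^ 3 * (6 * exp h)) * exp (- (q / 2))"
    by (intro mult_right_mono) auto
  also have "\<dots> = 6 * k ^ 3 * exp (- (q / 4))"
    by (simp add: h_def mult_exp_exp)
  finally show "(R + R\<^sup>2 + R ^ 3) * exp (- (q / 2)) \<le> 6 * (1 + 4 * \<kappa>) ^ 3 * exp (- (q / 4))"
    by (simp add: k_def)
qed

lemma abs_exp_minus_one_le:
  fixes r :: real
  assumes "\<bar>r\<bar> \<le> 1" shows "\<bar>exp r - 1\<bar> \<le> 3 * \<bar>r\<bar>"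
proof -
  have "\<bar>exp (- (- r)) - exp (- 0)\<bar> \<le> \<bar>- r - 0\<bar> * exp (- (- 1))"
    using assms by (intro exp_minus_diff_le) auto
  also have "\<dots> \<le> \<bar>r\<bar> * 3" using exp_le by (intro mult_mono) auto
  finally show ?thesis by simp
qed

text \<open>Parity of the Taylor terms: at opposite displacements even orders agree and odd orders
  cancel.\<close>

lemma iter_dderiv_replicate_minus:
  fixes f :: "'a::real_normed_vector \<Rightarrow> 'b::real_normed_vector"
  assumes f: "smooth_on UNIV f"
  shows "iter_dderiv (replicate m (- w)) f = (\<lambda>x. (- 1) ^ m *\<^sub>R iter_dderiv (replicate m w) f x)"
proof (induction m)
  case (Suc m)
  have "iter_dderiv (replicate (Suc m) (- w)) f x = (- 1) ^ Suc m *\<^sub>R iter_dderiv (replicate (Suc m) w) f x" for x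
  proof -
    have "((\<lambda>x. (- 1) ^ m *\<^sub>R iter_dderiv (replicate m w) f x) has_derivative
        (\<lambda>v. (- 1) ^ m *\<^sub>R iter_dderiv (v # replicate m w) f x)) (at x)"
      by (intro has_derivative_scaleR_right smooth_has_derivative[OF f])
    from frechet_derivative_at[OF this, symmetric]
    have "iter_dderiv (replicate (Suc m) (- w)) f x = (- 1) ^ m *\<^sub>R iter_dderiv ((- w) # replicate m w) f x"
      by (simp add: Suc)
    also have "iter_dderiv ((- w) # replicate m w) f x = - iter_dderiv (w # replicate m w) f x"
      using linear_neg[OF has_derivative_linear[OF smooth_has_derivative[OF f, of "replicate m w" x]]] .
    finally show ?thesis by simp
  qed
  then show ?case by (rule ext)
qed simp

lemma quadratic_form_eigenbasis:
  assumes "orthonormal_family e" and "\<And>i. H *v e i = l i *\<^sub>R e i"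
  shows "(\<Sum>i\<in>UNIV. z i *\<^sub>R e i) \<bullet> (H *v (\<Sum>i\<in>UNIV. z i *\<^sub>R e i)) = (\<Sum>i\<in>UNIV. l i * (z i)\<^sup>2)"
proof -
  have "H *v (\<Sum>i\<in>UNIV. z i *\<^sub>R e i) = (\<Sum>i\<in>UNIV. (z i * l i) *\<^sub>R e i)"
    by (simp add: linear_sum[OF matrix_vector_mul_linear] matrix_vector_mult_scaleR assms(2))
  moreover have "e i \<bullet> (\<Sum>j\<in>UNIV. (z j * l j) *\<^sub>R e j) = z i * l i" for i
  proof -
    have "e i \<bullet> (\<Sum>j\<in>UNIV. (z j * l j) *\<^sub>R e j) = (\<Sum>j\<in>UNIV. if j = i then z i * l i else 0)"
      using assms(1) unfolding inner_sum_right orthonormal_family_def by (intro sum.cong) auto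
    then show ?thesis by simp
  qed
  ultimately show ?thesis
    by (simp add: inner_sum_left power2_eq_square mult_ac)
qed

subsection \<open>The invariant on the cycle\<close>

text \<open>The data in the form they take on the cycle: since \<nabla>\<phi> = 0 there, the drift
  equals \<gamma> and the transport equation becomes div(\<omega> \<gamma>) = 0.\<close>

locale cycle_potential =
  fixes \<phi> \<omega> :: "real^'n \<Rightarrow> real" and \<gamma> :: "real^'n \<Rightarrow> real^'n"
    and p :: "real \<Rightarrow> real^'n" and T :: real and \<Gamma> :: "(real^'n) set"
  assumes \<phi>_smooth: "smooth_on UNIV \<phi>"
    and \<omega>_smooth: "smooth_on UNIV \<omega>"
    and \<gamma>_smooth: "smooth_on UNIV \<gamma>"
    and \<omega>_pos: "\<omega> x > 0"
    and orth: "grad \<phi> x \<bullet> \<gamma> x = 0"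
    and transport: "x \<in> \<Gamma> \<Longrightarrow> divg (\<lambda>y. \<omega> y *\<^sub>R \<gamma> y) x = 0"
    and T_pos: "T > 0"
    and p_ode: "t \<in> {0..T} \<Longrightarrow> (p has_vector_derivative \<gamma> (p t)) (at t)"
    and \<Gamma>_eq: "\<Gamma> = p ` {0..T}"
    and \<phi>_zero: "x \<in> \<Gamma> \<Longrightarrow> \<phi> x = 0"
    and grad_zero: "x \<in> \<Gamma> \<Longrightarrow> grad \<phi> x = 0"
    and hess_zero: "x \<in> \<Gamma> \<Longrightarrow> order 0 (charpoly (hess \<phi> x)) = 1"
    and hess_tangent: "x \<in> \<Gamma> \<Longrightarrow> hess \<phi> x *v \<gamma> x = 0"
    and hess_normal_pos: "x \<in> \<Gamma> \<Longrightarrow> y \<noteq> 0 \<Longrightarrow> y \<bullet> \<gamma> x = 0 \<Longrightarrow> hess \<phi> x *v y = l *\<^sub>R y \<Longrightarrow> l > 0"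
begin

text \<open>If \<gamma> vanished at \<open>x\<close>, every vector would be normal to it and all
  eigenvalues of the Hessian positive, against the zero root of the characteristic
  polynomial.\<close>

lemma \<gamma>_nonzero:
  assumes x: "x \<in> \<Gamma>" shows "\<gamma> x \<noteq> 0"
proof
  assume z: "\<gamma> x = 0"
  note sym = hess_symmetric[OF \<phi>_smooth, of x]
  have "axis undefined 1 \<noteq> (0::real^'n)" by (simp add: axis_eq_0_iff)
  \<comment> \<open>Any unit eigenvector will do as the seed of the eigenbasis.\<close>
  then obtain u :: "real^'n" and l0 where u: "norm u = 1" "hess \<phi> x *v u = l0 *\<^sub>R u"
    using symmetric_eigenvector_in_subspace[OF sym subspace_UNIV, of "axis undefined 1"] by auto
  obtain e l where e: "orthonormal_family e" "\<And>i. hess \<phi> x *v e i = l i *\<^sub>R e i"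
    using symmetric_orthonormal_eigenbasis[OF sym u] by metis
  have "e i \<noteq> 0" for i using e(1) by (metis inner_zero_left orthonormal_family_def zero_neq_one)
  then have "l i > 0" for i using hess_normal_pos[OF x _ _ e(2)] z by simp
  then have "poly (charpoly (hess \<phi> x)) 0 \<noteq> 0"
    unfolding charpoly_eigenbasis[OF e] by (simp add: poly_prod less_imp_neq[symmetric])
  moreover have "poly (charpoly (hess \<phi> x)) 0 = 0" using hess_zero[OF x] by (simp add: order_root)
  ultimately show False by simp
qed

text \<open>The kernel is the flow direction, and the other basis vectors are normal to it, so their
  eigenvalues are positive. The caller chooses \<open>k\<close>, so that one fixed slot can serve
  all points of the cycle.\<close>

lemma adapted_eigenbasis:
  assumes x: "x \<in> \<Gamma>"
  obtains e l where "orthonormal_family e" "e k = sgn (\<gamma> x)" "\<And>i. hess \<phi> x *v e i = l i *\<^sub>R e i"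
    "l k = 0" "\<And>i. i \<noteq> k \<Longrightarrow> l i > 0" "\<And>i. i \<noteq> k \<Longrightarrow> e i \<bullet> \<gamma> x = 0"
    "prod_nonzero_eigenvalues (hess \<phi> x) = (\<Prod>i\<in>UNIV - {k}. l i)"
proof -
  note sym = hess_symmetric[OF \<phi>_smooth, of x]
  have g: "\<gamma> x \<noteq> 0" by (rule \<gamma>_nonzero[OF x])
  have u: "norm (sgn (\<gamma> x)) = 1" "hess \<phi> x *v sgn (\<gamma> x) = 0 *\<^sub>R sgn (\<gamma> x)"
    using g hess_tangent[OF x] by (auto simp: norm_sgn sgn_div_norm matrix_vector_mult_scaleR)
  obtain e l where e: "orthonormal_family e" "e k = sgn (\<gamma> x)" "\<And>i. hess \<phi> x *v e i = l i *\<^sub>R e i"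
    using symmetric_orthonormal_eigenbasis[OF sym u] by metis
  have lk: "l k = 0" using e(3)[of k] u g by (simp add: e(2) sgn_zero_iff)
  have gk: "\<gamma> x = norm (\<gamma> x) *\<^sub>R e k" using g by (simp add: e(2) sgn_div_norm)
  have o: "e i \<bullet> \<gamma> x = 0" if "i \<noteq> k" for i
    using e(1) that by (subst gk) (simp add: orthonormal_family_def)
  have "e i \<noteq> 0" for i using e(1) by (metis inner_zero_left orthonormal_family_def zero_neq_one)
  then have lp: "l i > 0" if "i \<noteq> k" for i using hess_normal_pos[OF x _ o[OF that] e(3)] by simp
  have "{i. l i \<noteq> 0} = UNIV - {k}" using lk lp by force
  then have "prod_nonzero_eigenvalues (hess \<phi> x) = (\<Prod>i\<in>UNIV - {k}. l i)"
    using prod_nonzero_eigenvalues_eigenbasis[OF e(1,3)] by simp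
  then show ?thesis using that e lk lp o by blast
qed

lemma smooth_along_cycle:
  assumes "smooth_on UNIV f" and "t \<in> {0..T}"
  shows "((\<lambda>s. iter_dderiv vs f (p s)) has_vector_derivative iter_dderiv (\<gamma> (p t) # vs) f (p t)) (at t)"
proof -
  have lin: "linear (\<lambda>v. iter_dderiv (v # vs) f (p t))"
    using smooth_has_derivative[OF assms(1)] by (rule has_derivative_linear)
  have "((\<lambda>s. iter_dderiv vs f (p s)) has_derivative (\<lambda>h. iter_dderiv ((h *\<^sub>R \<gamma> (p t)) # vs) f (p t))) (at t)"
    using has_derivative_compose[OF p_ode[OF assms(2), unfolded has_vector_derivative_def] smooth_has_derivative[OF assms(1)]] .
  then show ?thesis
    unfolding has_vector_derivative_def using linear_cmul[OF lin] by (simp del: iter_dderiv.simps)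
qed

text \<open>The second derivative of the identity \<open>\<nabla>\<phi> \<bullet> \<gamma> = 0\<close>, in which the term with the second derivative of
  \<open>\<gamma>\<close> drops out because \<open>\<nabla>\<phi>\<close> vanishes on the cycle.\<close>

lemma third_derivative_along_flow:
  assumes x: "x \<in> \<Gamma>"
  shows "iter_dderiv [\<gamma> x, a, a] \<phi> x = - 2 * ((hess \<phi> x *v a) \<bullet> iter_dderiv [a] \<gamma> x)"
proof -
  note D = smooth_has_derivative
  define g where "g = grad \<phi>"
  have g: "smooth_on UNIV g" unfolding g_def by (rule smooth_grad[OF \<phi>_smooth])
  have 1: "iter_dderiv [a] g y \<bullet> \<gamma> y + g y \<bullet> iter_dderiv [a] \<gamma> y = 0" for y
  proof -
    have d: "((\<lambda>y. g y \<bullet> \<gamma> y) has_derivative (\<lambda>v. g y \<bullet> iter_dderiv [v] \<gamma> y + iter_dderiv [v] g y \<bullet> \<gamma> y)) (at y)"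
      using has_derivative_inner[OF D[OF g, of "[]"] D[OF \<gamma>_smooth, of "[]"]] by simp
    have "(\<lambda>y. g y \<bullet> \<gamma> y) = (\<lambda>y. 0)" using orth by (simp add: g_def)
    from fun_cong[OF has_derivative_unique[OF d[unfolded this] has_derivative_const], of a]
    show ?thesis by (simp only: add.commute)
  qed
  have "((\<lambda>y. iter_dderiv [a] g y \<bullet> \<gamma> y + g y \<bullet> iter_dderiv [a] \<gamma> y) has_derivative
      (\<lambda>v. (iter_dderiv [a] g x \<bullet> iter_dderiv [v] \<gamma> x + iter_dderiv [v, a] g x \<bullet> \<gamma> x)
         + (g x \<bullet> iter_dderiv [v, a] \<gamma> x + iter_dderiv [v] g x \<bullet> iter_dderiv [a] \<gamma> x))) (at x)"
    using has_derivative_add[OF has_derivative_inner[OF D[OF g, of "[a]"] D[OF \<gamma>_smooth, of "[]"]]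
        has_derivative_inner[OF D[OF g, of "[]"] D[OF \<gamma>_smooth, of "[a]"]]]
    by simp
  then have d: "((\<lambda>y. 0) has_derivative
      (\<lambda>v. (iter_dderiv [a] g x \<bullet> iter_dderiv [v] \<gamma> x + iter_dderiv [v, a] g x \<bullet> \<gamma> x)
         + (g x \<bullet> iter_dderiv [v, a] \<gamma> x + iter_dderiv [v] g x \<bullet> iter_dderiv [a] \<gamma> x))) (at x)"
    unfolding 1 .
  from fun_cong[OF has_derivative_unique[OF d has_derivative_const], of a] grad_zero[OF x]
  have "iter_dderiv [a, a] g x \<bullet> \<gamma> x = - 2 * (iter_dderiv [a] g x \<bullet> iter_dderiv [a] \<gamma> x)"
    by (simp add: g_def del: iter_dderiv.simps)
  moreover have "iter_dderiv [a, a] g x \<bullet> \<gamma> x = iter_dderiv [\<gamma> x, a, a] \<phi> x"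
    unfolding g_def using iter_dderiv_grad_inner[OF \<phi>_smooth, of "[a, a]" x "\<gamma> x"]
      iter_dderiv_rotate3[OF \<phi>_smooth, of "\<gamma> x" a a]
    by (simp del: iter_dderiv.simps)
  ultimately show ?thesis by (simp add: g_def hess_mult[OF \<phi>_smooth] del: iter_dderiv.simps)
qed

text \<open>The product rule for the divergence. The trace of the Jacobian is written in an
  arbitrary orthonormal basis so that it can be compared with the Hessian in its own
  eigenbasis.\<close>

lemma transport_along_cycle:
  assumes x: "x \<in> \<Gamma>" and e: "orthonormal_family e"
  shows "iter_dderiv [\<gamma> x] \<omega> x = - \<omega> x * (\<Sum>i\<in>UNIV. e i \<bullet> iter_dderiv [e i] \<gamma> x)"
proof -
  have "((\<lambda>y. \<omega> y *\<^sub>R \<gamma> y) has_derivative (\<lambda>v. \<omega> x *\<^sub>R iter_dderiv [v] \<gamma> x + iter_dderiv [v] \<omega> x *\<^sub>R \<gamma> x)) (at x)"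
    using has_derivative_scaleR[OF smooth_has_derivative[OF \<omega>_smooth, of "[]"] smooth_has_derivative[OF \<gamma>_smooth, of "[]"]]
    by simp
  from frechet_derivative_at[OF this, symmetric] transport[OF x]
  have "0 = (\<Sum>i\<in>UNIV. \<omega> x * iter_dderiv [axis i 1] \<gamma> x $ i + iter_dderiv [axis i 1] \<omega> x * \<gamma> x $ i)"
    by (simp add: divg_def del: iter_dderiv.simps)
  also have "\<dots> = \<omega> x * (\<Sum>i\<in>UNIV. iter_dderiv [axis i 1] \<gamma> x $ i) + grad \<omega> x \<bullet> \<gamma> x"
    by (simp add: sum.distrib sum_distrib_left grad_def inner_vec_def)
  also have "grad \<omega> x \<bullet> \<gamma> x = iter_dderiv [\<gamma> x] \<omega> x" by (rule grad_inner[OF \<omega>_smooth])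
  also have "(\<Sum>i\<in>UNIV. iter_dderiv [axis i 1] \<gamma> x $ i) = trace (matrix (\<lambda>v. iter_dderiv [v] \<gamma> x))"
    by (simp add: trace_def matrix_def)
  also have "\<dots> = (\<Sum>i\<in>UNIV. e i \<bullet> iter_dderiv [e i] \<gamma> x)"
    using has_derivative_linear[OF smooth_has_derivative[OF \<gamma>_smooth, of "[]" x]]
    by (simp add: trace_orthonormal[OF e] matrix_works del: iter_dderiv.simps)
  finally show ?thesis by simp
qed

text \<open>On the cycle the rank-one term acts only in the flow direction, where the Hessian
  vanishes: it replaces the zero eigenvalue by the squared speed and leaves the others
  unchanged.\<close>

definition filled_hess :: "real^'n \<Rightarrow> real^'n^'n" where
  "filled_hess x = (\<chi> i j. hess \<phi> x $ i $ j + \<gamma> x $ i * \<gamma> x $ j)"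

lemma filled_hess_mult: "filled_hess x *v v = hess \<phi> x *v v + (\<gamma> x \<bullet> v) *\<^sub>R \<gamma> x"
  by (simp add: filled_hess_def vec_eq_iff matrix_vector_mult_def inner_vec_def sum.distrib algebra_simps
      sum_distrib_left)

lemma det_filled_hess:
  assumes x: "x \<in> \<Gamma>"
  shows "det (filled_hess x) = prod_nonzero_eigenvalues (hess \<phi> x) * (\<gamma> x \<bullet> \<gamma> x)"
    and "prod_nonzero_eigenvalues (hess \<phi> x) > 0"
proof -
  fix k :: 'n
  obtain e l where e: "orthonormal_family e" "e k = sgn (\<gamma> x)" "\<And>i. hess \<phi> x *v e i = l i *\<^sub>R e i"
    "l k = 0" "\<And>i. i \<noteq> k \<Longrightarrow> l i > 0" "\<And>i. i \<noteq> k \<Longrightarrow> e i \<bullet> \<gamma> x = 0"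
    "prod_nonzero_eigenvalues (hess \<phi> x) = (\<Prod>i\<in>UNIV - {k}. l i)"
    using adapted_eigenbasis[OF x, where k = k] by metis
  let ?m = "\<lambda>i. if i = k then \<gamma> x \<bullet> \<gamma> x else l i"
  have "filled_hess x *v e i = ?m i *\<^sub>R e i" for i
    using e(3)[of i] e(4,6) \<gamma>_nonzero[OF x]
    by (auto simp: filled_hess_mult inner_commute e(2) sgn_div_norm dot_square_norm power2_eq_square)
  then have "det (filled_hess x) = (\<Prod>i\<in>UNIV. ?m i)" by (rule det_eigenbasis[OF e(1)])
  also have "\<dots> = (\<gamma> x \<bullet> \<gamma> x) * (\<Prod>i\<in>UNIV - {k}. l i)"
    by (subst prod.remove[of UNIV k]) auto
  finally show "det (filled_hess x) = prod_nonzero_eigenvalues (hess \<phi> x) * (\<gamma> x \<bullet> \<gamma> x)"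
    by (simp add: e(7))
  show "prod_nonzero_eigenvalues (hess \<phi> x) > 0"
    unfolding e(7) using e(5) by (intro prod_pos) auto
qed

text \<open>The basis is frozen at time \<open>t\<close>, where the conjugated matrix
  \<open>N\<close> is diagonal, so only its diagonal entries contribute. A normal slot has
  logarithmic rate \<open>- 2 * \<alpha> i\<close>, from the third derivative of \<phi>; the flow
  slot, which holds the rank-one term, has \<open>2 * \<alpha> k\<close>. Completing the normal
  slots to the full trace turns this 2 into 4.\<close>

lemma det_filled_hess_derivative:
  assumes t: "t \<in> {0..T}" and x: "x = p t"
    and e: "orthonormal_family e" "e k = sgn (\<gamma> x)" "\<And>i. hess \<phi> x *v e i = l i *\<^sub>R e i"
    "l k = 0" "\<And>i. i \<noteq> k \<Longrightarrow> e i \<bullet> \<gamma> x = 0"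
  shows "((\<lambda>s. det (filled_hess (p s))) has_real_derivative
    det (filled_hess x) * (4 * (e k \<bullet> iter_dderiv [e k] \<gamma> x) - 2 * (\<Sum>i\<in>UNIV. e i \<bullet> iter_dderiv [e i] \<gamma> x))) (at t)"
proof -
  have x\<Gamma>: "x \<in> \<Gamma>" using t x by (simp add: \<Gamma>_eq)
  define \<alpha> where "\<alpha> = (\<lambda>i. e i \<bullet> iter_dderiv [e i] \<gamma> x)"
  define N where "N = (\<lambda>s. transpose (basis_matrix e) ** filled_hess (p s) ** basis_matrix e)"
  have Nent: "N s $ i $ j = iter_dderiv [e j, e i] \<phi> (p s) + (e i \<bullet> \<gamma> (p s)) * (e j \<bullet> \<gamma> (p s))" for s i j
    unfolding N_def conj_basis_matrix_entry
    by (simp add: filled_hess_mult inner_add_right hess_form[OF \<phi>_smooth] inner_commute mult.commute del: iter_dderiv.simps)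
  have dg: "((\<lambda>s. e i \<bullet> \<gamma> (p s)) has_real_derivative e i \<bullet> iter_dderiv [\<gamma> x] \<gamma> x) (at t)" for i
    using bounded_linear.has_vector_derivative[OF bounded_linear_inner_right smooth_along_cycle[OF \<gamma>_smooth t, of "[]"], of "e i"]
    by (simp add: x has_real_derivative_iff_has_vector_derivative)
  have dh: "((\<lambda>s. iter_dderiv vs \<phi> (p s)) has_real_derivative iter_dderiv (\<gamma> x # vs) \<phi> x) (at t)" for vs
    using smooth_along_cycle[OF \<phi>_smooth t, of vs]
    by (simp add: x has_real_derivative_iff_has_vector_derivative)
  define N' where "N' = (\<lambda>i j. iter_dderiv [\<gamma> x, e j, e i] \<phi> x
      + ((e i \<bullet> iter_dderiv [\<gamma> x] \<gamma> x) * (e j \<bullet> \<gamma> x) + (e j \<bullet> iter_dderiv [\<gamma> x] \<gamma> x) * (e i \<bullet> \<gamma> x)))"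
  have dN: "((\<lambda>s. N s $ i $ j) has_real_derivative N' i j) (at t)" for i j
    unfolding Nent N'_def
    using DERIV_add[OF dh[of "[e j, e i]"] DERIV_mult[OF dg[of i] dg[of j]]] x by (simp del: iter_dderiv.simps)
  have gk: "\<gamma> x = norm (\<gamma> x) *\<^sub>R e k" using \<gamma>_nonzero[OF x\<Gamma>] by (simp add: e(2) sgn_div_norm)
  have ekg: "e k \<bullet> \<gamma> x = norm (\<gamma> x)"
    using e(1) by (subst gk) (simp add: orthonormal_family_def)
  have Nt: "N t $ i $ j = (if i = j then if i = k then (norm (\<gamma> x))\<^sup>2 else l i else 0)" for i j
  proof -
    have "N t $ i $ j = e i \<bullet> (hess \<phi> x *v e j) + (e i \<bullet> \<gamma> x) * (e j \<bullet> \<gamma> x)"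
      by (simp only: Nent hess_form[OF \<phi>_smooth] x)
    also have "\<dots> = (if i = j then l j else 0) + (if i = k \<and> j = k then (norm (\<gamma> x))\<^sup>2 else 0)"
      using e(1,5) ekg by (auto simp: e(3) orthonormal_family_def power2_eq_square)
    finally show ?thesis using e(4) by auto
  qed
  have A\<gamma>: "iter_dderiv [\<gamma> x] \<gamma> x = norm (\<gamma> x) *\<^sub>R iter_dderiv [e k] \<gamma> x"
    using linear_cmul[OF has_derivative_linear[OF smooth_has_derivative[OF \<gamma>_smooth, of "[]" x]], of "norm (\<gamma> x)" "e k"]
    by (simp only: gk[symmetric])
  have N'd: "N' i i = (if i = k then 2 else - 2) * \<alpha> i * N t $ i $ i" for i
  proof (cases "i = k")
    case True
    then show ?thesis
      unfolding N'_def third_derivative_along_flow[OF x\<Gamma>] A\<gamma> Nt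
      using ekg by (simp add: e(3,4) \<alpha>_def power2_eq_square del: iter_dderiv.simps)
  next
    case False
    then show ?thesis
      unfolding N'_def third_derivative_along_flow[OF x\<Gamma>] Nt
      using e(5)[OF False] by (simp add: e(3) \<alpha>_def del: iter_dderiv.simps)
  qed
  have "((\<lambda>s. det (N s)) has_real_derivative (\<Sum>i\<in>UNIV. N' i i * (\<Prod>j\<in>UNIV - {i}. N t $ j $ j))) (at t)"
    using dN by (rule has_real_derivative_det_at_diagonal) (simp add: Nt)
  moreover have "(\<Sum>i\<in>UNIV. N' i i * (\<Prod>j\<in>UNIV - {i}. N t $ j $ j)) = (\<Sum>i\<in>UNIV. (if i = k then 2 else - 2) * \<alpha> i * det (N t))"
  proof (rule sum.cong[OF refl])
    fix i :: 'n
    have "det (N t) = (\<Prod>j\<in>UNIV. N t $ j $ j)" by (rule det_diagonal) (simp add: Nt)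
    also have "\<dots> = N t $ i $ i * (\<Prod>j\<in>UNIV - {i}. N t $ j $ j)" by (rule prod.remove) auto
    finally show "N' i i * (\<Prod>j\<in>UNIV - {i}. N t $ j $ j) = (if i = k then 2 else - 2) * \<alpha> i * det (N t)"
      by (simp add: N'd mult_ac)
  qed
  moreover have "(\<Sum>i\<in>UNIV. (if i = k then 2 else - 2) * \<alpha> i * det (N t)) = det (N t) * (4 * \<alpha> k - 2 * (\<Sum>i\<in>UNIV. \<alpha> i))"
  proof -
    have "(\<Sum>i\<in>UNIV. (if i = k then 2 else - 2) * \<alpha> i) = (\<Sum>i\<in>UNIV. (if i = k then 4 * \<alpha> i else 0) - 2 * \<alpha> i)"
      by (rule sum.cong) auto
    also have "\<dots> = 4 * \<alpha> k - 2 * (\<Sum>i\<in>UNIV. \<alpha> i)" by (simp add: sum_subtractf sum_distrib_left)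
    finally have eq: "(\<Sum>i\<in>UNIV. (if i = k then 2 else - 2) * \<alpha> i) = 4 * \<alpha> k - 2 * (\<Sum>i\<in>UNIV. \<alpha> i)" .
    show ?thesis unfolding sum_distrib_right[symmetric] eq by simp
  qed
  moreover have "det (N s) = det (filled_hess (p s))" for s
    unfolding N_def by (rule det_conj_basis_matrix[OF e(1)])
  ultimately show ?thesis unfolding \<alpha>_def using x by (simp del: iter_dderiv.simps)
qed

text \<open>The cycle is a single orbit, so a zero derivative in time gives constancy on it.
  Positivity is recorded because the constant later enters the normalising integral.\<close>

theorem sqrt_det_flux_constant:
  "\<exists>c>0. \<forall>x\<in>\<Gamma>. sqrt (1 / prod_nonzero_eigenvalues (hess \<phi> x)) * norm (\<omega> x *\<^sub>R \<gamma> x) = c"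
proof -
  \<comment> \<open>By \<open>det_filled_hess\<close> this is the square of the quantity claimed to
    be constant; one of the two factors \<gamma> \<bullet> \<gamma> is cancelled by the
    determinant.\<close>
  define F where "F = (\<lambda>x. (\<omega> x)\<^sup>2 * (\<gamma> x \<bullet> \<gamma> x)\<^sup>2 / det (filled_hess x))"
  have F0: "((\<lambda>s. F (p s)) has_real_derivative 0) (at t)" if t: "t \<in> {0..T}" for t
  proof -
    fix k :: 'n
    define x where "x = p t"
    have x: "x \<in> \<Gamma>" using t by (simp add: x_def \<Gamma>_eq)
    obtain e l where e: "orthonormal_family e" "e k = sgn (\<gamma> x)" "\<And>i. hess \<phi> x *v e i = l i *\<^sub>R e i"
      "l k = 0" "\<And>i. i \<noteq> k \<Longrightarrow> e i \<bullet> \<gamma> x = 0"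
      using adapted_eigenbasis[OF x, where k = k] by metis
    define \<tau> \<alpha> where "\<tau> = (\<Sum>i\<in>UNIV. e i \<bullet> iter_dderiv [e i] \<gamma> x)" and "\<alpha> = e k \<bullet> iter_dderiv [e k] \<gamma> x"
    have d1: "((\<lambda>s. det (filled_hess (p s))) has_real_derivative det (filled_hess x) * (4 * \<alpha> - 2 * \<tau>)) (at t)"
      unfolding \<alpha>_def \<tau>_def by (rule det_filled_hess_derivative[OF t x_def e])
    have d2: "((\<lambda>s. \<omega> (p s)) has_real_derivative - \<omega> x * \<tau>) (at t)"
      using smooth_along_cycle[OF \<omega>_smooth t, of "[]"] transport_along_cycle[OF x e(1)]
      by (simp add: has_real_derivative_iff_has_vector_derivative \<tau>_def x_def)
    have gk: "\<gamma> x = norm (\<gamma> x) *\<^sub>R e k" using \<gamma>_nonzero[OF x] by (simp add: e(2) sgn_div_norm)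
    have "iter_dderiv [\<gamma> x] \<gamma> x = norm (\<gamma> x) *\<^sub>R iter_dderiv [e k] \<gamma> x"
      using linear_cmul[OF has_derivative_linear[OF smooth_has_derivative[OF \<gamma>_smooth, of "[]" x]], of "norm (\<gamma> x)" "e k"]
      by (simp only: gk[symmetric])
    then have "\<gamma> x \<bullet> iter_dderiv [\<gamma> x] \<gamma> x = \<gamma> x \<bullet> \<gamma> x * \<alpha>"
      by (subst gk) (simp add: \<alpha>_def dot_square_norm power2_eq_square del: iter_dderiv.simps)
    then have d3: "((\<lambda>s. \<gamma> (p s) \<bullet> \<gamma> (p s)) has_real_derivative 2 * (\<alpha> * (\<gamma> x \<bullet> \<gamma> x))) (at t)"
      using bounded_bilinear.has_vector_derivative[OF bounded_bilinear_inner
          smooth_along_cycle[OF \<gamma>_smooth t, of "[]"] smooth_along_cycle[OF \<gamma>_smooth t, of "[]"]]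
      by (simp add: has_real_derivative_iff_has_vector_derivative x_def[symmetric] inner_commute del: iter_dderiv.simps(2))
    have dn: "det (filled_hess x) \<noteq> 0"
      using det_filled_hess[OF x] \<gamma>_nonzero[OF x] by simp
    \<comment> \<open>The logarithmic rates are \<open>- 2 * \<tau>\<close> from \<omega>,
      \<open>4 * \<alpha>\<close> from the speed and \<open>- (4 * \<alpha> - 2 * \<tau>)\<close>
      from the determinant; they add up to zero.\<close>
    show ?thesis unfolding F_def
      by (rule derivative_eq_intros d1 d2 d3 refl | simp add: x_def[symmetric] dn)+
         (simp add: field_simps power2_eq_square dn)
  qed
  obtain c where c: "\<And>t. t \<in> {0..T} \<Longrightarrow> F (p t) = c"
    using has_field_derivative_zero_constant[of "{0..T}" "\<lambda>s. F (p s)"] F0 has_field_derivative_at_within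
    by (metis convex_real_interval(5))
  have eq: "sqrt (1 / prod_nonzero_eigenvalues (hess \<phi> x)) * norm (\<omega> x *\<^sub>R \<gamma> x) = sqrt (F x)" if x: "x \<in> \<Gamma>" for x
  proof -
    let ?P = "prod_nonzero_eigenvalues (hess \<phi> x)"
    have "F x = (1 / ?P) * (\<omega> x * norm (\<gamma> x))\<^sup>2"
      using \<gamma>_nonzero[OF x] det_filled_hess[OF x]
      by (simp add: F_def power2_norm_eq_inner[symmetric] power2_eq_square field_simps)
    then have "sqrt (F x) = sqrt (1 / ?P) * (\<omega> x * norm (\<gamma> x))"
      using \<omega>_pos[of x] by (simp only: real_sqrt_mult real_sqrt_abs abs_mult abs_norm_cancel abs_of_pos)
    then show ?thesis using \<omega>_pos[of x] by simp
  qed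
  show ?thesis
  proof (intro exI[of _ "sqrt c"] conjI ballI)
    show "sqrt (1 / prod_nonzero_eigenvalues (hess \<phi> x)) * norm (\<omega> x *\<^sub>R \<gamma> x) = sqrt c" if "x \<in> \<Gamma>" for x
      using eq[OF that] that c by (auto simp: \<Gamma>_eq)
    have x: "p 0 \<in> \<Gamma>" using T_pos by (simp add: \<Gamma>_eq)
    have "F (p 0) > 0"
      unfolding F_def using \<omega>_pos[of "p 0"] \<gamma>_nonzero[OF x] det_filled_hess[OF x] by simp
    then show "0 < sqrt c" using c[of 0] T_pos by simp
  qed
qed

subsection \<open>Asymptotics of the cross-sectional mass\<close>

lemma compact_cycle: "compact \<Gamma>"
proof -
  have "continuous_on {0..T} p"
    using has_vector_derivative_continuous[OF p_ode] by (intro continuous_at_imp_continuous_on ballI)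
  then show ?thesis unfolding \<Gamma>_eq by (rule compact_continuous_image) simp
qed

text \<open>On the cycle \<phi> and its gradient vanish, so the Hessian term leads. In the sums over
  \<open>w\<close> and \<open>- w\<close> the odd terms cancel, which gains one order over the
  one-sided estimates.\<close>

lemma cycle_taylor:
  "\<exists>M\<ge>1. \<forall>x\<in>\<Gamma>. \<bar>\<omega> x\<bar> \<le> M \<and> (\<forall>w. norm w \<le> 1 \<longrightarrow>
      \<bar>\<phi> (x + w) - (w \<bullet> (hess \<phi> x *v w)) / 2\<bar> \<le> M * norm w ^ 3
    \<and> \<bar>\<phi> (x + w) + \<phi> (x - w) - w \<bullet> (hess \<phi> x *v w)\<bar> \<le> M * norm w ^ 4
    \<and> \<bar>\<omega> (x + w) - \<omega> x\<bar> \<le> M * norm w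
    \<and> \<bar>\<omega> (x + w) + \<omega> (x - w) - 2 * \<omega> x\<bar> \<le> M * (norm w)\<^sup>2)"
proof -
  have bd: "bounded \<Gamma>" using compact_cycle by (rule compact_imp_bounded)
  obtain M0 where M0: "\<forall>x\<in>\<Gamma>. \<bar>\<omega> x\<bar> \<le> M0"
    using iter_dderiv_replicate_bound[OF \<omega>_smooth compact_cycle, of 0] by auto
  obtain M1 where M1: "\<forall>x\<in>\<Gamma>. \<forall>w. norm w \<le> 1 \<longrightarrow> \<bar>\<omega> (x + w) - (\<Sum>m<1. iter_dderiv (replicate m w) \<omega> x / fact m)\<bar> \<le> M1 * norm w ^ 1"
    using smooth_Maclaurin_bound[OF \<omega>_smooth bd, of 1] by blast
  obtain M2 where M2: "\<forall>x\<in>\<Gamma>. \<forall>w. norm w \<le> 1 \<longrightarrow> \<bar>\<omega> (x + w) - (\<Sum>m<2. iter_dderiv (replicate m w) \<omega> x / fact m)\<bar> \<le> M2 * norm w ^ 2"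
    using smooth_Maclaurin_bound[OF \<omega>_smooth bd, of 2] by blast
  obtain M3 where M3: "\<forall>x\<in>\<Gamma>. \<forall>w. norm w \<le> 1 \<longrightarrow> \<bar>\<phi> (x + w) - (\<Sum>m<3. iter_dderiv (replicate m w) \<phi> x / fact m)\<bar> \<le> M3 * norm w ^ 3"
    using smooth_Maclaurin_bound[OF \<phi>_smooth bd, of 3] by blast
  obtain M4 where M4: "\<forall>x\<in>\<Gamma>. \<forall>w. norm w \<le> 1 \<longrightarrow> \<bar>\<phi> (x + w) - (\<Sum>m<4. iter_dderiv (replicate m w) \<phi> x / fact m)\<bar> \<le> M4 * norm w ^ 4"
    using smooth_Maclaurin_bound[OF \<phi>_smooth bd, of 4] by blast
  \<comment> \<open>\<open>M2\<close> and \<open>M4\<close> are doubled because each symmetric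
    estimate adds two remainders; \<open>M \<ge> 1\<close> makes powers of \<open>M\<close>
    comparable later.\<close>
  define M where "M = max 1 (max M0 (max M1 (max (2 * M2) (max M3 (2 * M4)))))"
  have M: "1 \<le> M" "M0 \<le> M" "M1 \<le> M" "2 * M2 \<le> M" "M3 \<le> M" "2 * M4 \<le> M" by (auto simp: M_def)
  show ?thesis
  proof (intro exI[of _ M] conjI ballI allI impI M(1))
    fix x assume x: "x \<in> \<Gamma>"
    show "\<bar>\<omega> x\<bar> \<le> M" using M0 x M(2) by force
    fix w :: "real^'n" assume w: "norm w \<le> 1"
    then have w': "norm (- w) \<le> 1" by simp
    note rm = fun_cong[OF iter_dderiv_replicate_minus[where w = w]]
    have r1: "iter_dderiv (replicate 1 (- w)) f x = - iter_dderiv (replicate 1 w) f x" if "smooth_on UNIV f" for f :: "real^'n \<Rightarrow> real"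
      using rm[OF that, of 1] by (simp del: iter_dderiv.simps replicate.simps)
    have r2: "iter_dderiv (replicate 2 (- w)) f x = iter_dderiv (replicate 2 w) f x" if "smooth_on UNIV f" for f :: "real^'n \<Rightarrow> real"
      using rm[OF that, of 2] by (simp del: iter_dderiv.simps replicate.simps)
    have r3: "iter_dderiv (replicate 3 (- w)) f x = - iter_dderiv (replicate 3 w) f x" if "smooth_on UNIV f" for f :: "real^'n \<Rightarrow> real"
      using rm[OF that, of 3] by (simp del: iter_dderiv.simps replicate.simps)
    have p1: "iter_dderiv (replicate 1 v) \<phi> x = 0" for v
      using grad_inner[OF \<phi>_smooth, of x v] grad_zero[OF x] by simp
    have p2: "iter_dderiv (replicate 2 w) \<phi> x = w \<bullet> (hess \<phi> x *v w)"
      unfolding hess_form[OF \<phi>_smooth] numeral_2_eq_2 replicate.simps ..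
    have s2: "(\<Sum>m<2. g m) = g 0 + g 1" for g :: "nat \<Rightarrow> real" by (simp add: numeral_2_eq_2)
    have s3: "(\<Sum>m<3. g m) = g 0 + g 1 + g 2" for g :: "nat \<Rightarrow> real" by (simp add: numeral_3_eq_3 numeral_2_eq_2)
    have s4: "(\<Sum>m<4. g m) = g 0 + g 1 + g 2 + g 3" for g :: "nat \<Rightarrow> real" by (simp add: eval_nat_numeral)
    have z: "iter_dderiv (replicate 0 v) f x = f x" for v and f :: "real^'n \<Rightarrow> real" by simp
    have f2: "fact 0 = (1::real)" "fact 1 = (1::real)" "fact 2 = (2::real)" by auto
    note T3 = M3[rule_format, OF x w, unfolded s3 z f2 p1 p2 \<phi>_zero[OF x]]
    note T4 = M4[rule_format, OF x w, unfolded s4 z f2 p1 p2 \<phi>_zero[OF x]]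
    note T4' = M4[rule_format, OF x w', unfolded s4 z f2 p1 r2[OF \<phi>_smooth] r3[OF \<phi>_smooth] p2 \<phi>_zero[OF x]]
    have W: "M1 * norm w \<le> M * norm w" "2 * M2 * (norm w)\<^sup>2 \<le> M * (norm w)\<^sup>2" "M3 * norm w ^ 3 \<le> M * norm w ^ 3"
      "2 * M4 * norm w ^ 4 \<le> M * norm w ^ 4"
      using M by (auto intro!: mult_right_mono)
    show "\<bar>\<phi> (x + w) - (w \<bullet> (hess \<phi> x *v w)) / 2\<bar> \<le> M * norm w ^ 3"
      using T3 W(3) by simp
    have "\<bar>\<phi> (x + w) + \<phi> (x - w) - w \<bullet> (hess \<phi> x *v w)\<bar> \<le> 2 * M4 * norm w ^ 4"
      using T4 T4' by (simp add: abs_le_iff)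
    then show "\<bar>\<phi> (x + w) + \<phi> (x - w) - w \<bullet> (hess \<phi> x *v w)\<bar> \<le> M * norm w ^ 4"
      using W(4) by linarith
    show "\<bar>\<omega> (x + w) - \<omega> x\<bar> \<le> M * norm w"
      using M1[rule_format, OF x w] W(1) by simp
    note T2 = M2[rule_format, OF x w, unfolded s2 z f2]
    note T2' = M2[rule_format, OF x w', unfolded s2 z f2 r1[OF \<omega>_smooth]]
    have "\<bar>\<omega> (x + w) + \<omega> (x - w) - 2 * \<omega> x\<bar> \<le> 2 * M2 * (norm w)\<^sup>2"
      using T2 T2' by (simp add: abs_le_iff)
    then show "\<bar>\<omega> (x + w) + \<omega> (x - w) - 2 * \<omega> x\<bar> \<le> M * (norm w)\<^sup>2" using W(2) by linarith
  qed
qed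

text \<open>The assumption speaks of eigenvectors only. Expansion in the adapted eigenbasis, where
  normality kills coordinate \<open>k\<close>, extends positivity to all normal vectors.\<close>

lemma hess_normal_form_pos:
  assumes x: "x \<in> \<Gamma>" and y: "y \<noteq> 0" "y \<bullet> \<gamma> x = 0"
  shows "y \<bullet> (hess \<phi> x *v y) > 0"
proof -
  fix k :: 'n
  obtain e l where e: "orthonormal_family e" "e k = sgn (\<gamma> x)" "\<And>i. hess \<phi> x *v e i = l i *\<^sub>R e i"
    "l k = 0" "\<And>i. i \<noteq> k \<Longrightarrow> l i > 0"
    using adapted_eigenbasis[OF x, where k = k] by metis
  have "surj (\<lambda>z. \<Sum>i\<in>UNIV. (z $ i) *\<^sub>R e i)"
    by (rule orthogonal_transformation_surj[OF orthonormal_family_orthogonal_transformation[OF e(1)]])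
  then obtain z where z: "y = (\<Sum>i\<in>UNIV. (z $ i) *\<^sub>R e i)" by (rule surjE)
  have "y \<bullet> e k = (\<Sum>i\<in>UNIV. if i = k then z $ i else 0)"
    using e(1) unfolding z inner_sum_left orthonormal_family_def by (intro sum.cong) auto
  then have "z $ k = 0" using y(2) by (simp add: e(2) sgn_div_norm)
  moreover have "z \<noteq> 0" using y(1) z by auto
  ultimately obtain i where i: "i \<noteq> k" "z $ i \<noteq> 0" by (auto simp: vec_eq_iff) metis
  have nn: "0 \<le> l j * (z $ j)\<^sup>2" for j using e(4) less_imp_le[OF e(5)] by (cases "j = k") auto
  have "0 < l i * (z $ i)\<^sup>2" using e(5)[OF i(1)] i(2) by simp
  also have "\<dots> \<le> (\<Sum>j\<in>UNIV. l j * (z $ j)\<^sup>2)" using nn by (intro member_le_sum) auto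
  also have "\<dots> = y \<bullet> (hess \<phi> x *v y)"
    unfolding z by (rule quadratic_form_eigenbasis[OF e(1,3), symmetric])
  finally show ?thesis .
qed

text \<open>The unit normal bundle of the cycle is compact, so the form has a positive minimum on
  it; homogeneity does the rest.\<close>

lemma hess_lower_bound:
  "\<exists>c>0. \<forall>x\<in>\<Gamma>. \<forall>y. y \<bullet> \<gamma> x = 0 \<longrightarrow> c * (norm y)\<^sup>2 \<le> y \<bullet> (hess \<phi> x *v y)"
proof -
  define S where "S = (\<Gamma> \<times> sphere 0 1) \<inter> {xy. snd xy \<bullet> \<gamma> (fst xy) = 0}"
  have c\<gamma>: "continuous_on UNIV \<gamma>" using smooth_continuous[OF \<gamma>_smooth, of UNIV "[]"] by simp
  have "closed {xy. snd xy \<bullet> \<gamma> (fst xy) = 0}"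
    by (intro closed_Collect_eq continuous_on_inner continuous_on_snd continuous_on_const continuous_on_id
        continuous_on_compose2[OF c\<gamma>] continuous_on_fst) auto
  then have S: "compact S"
    unfolding S_def by (intro compact_Int_closed compact_Times compact_cycle compact_sphere)
  define f where "f = (\<lambda>xy. snd xy \<bullet> (hess \<phi> (fst xy) *v snd xy))"
  have ch: "continuous_on UNIV (\<lambda>x. hess \<phi> x $ i $ j)" for i j
    unfolding matrix_entry_inner[symmetric] hess_form[OF \<phi>_smooth] by (rule smooth_continuous[OF \<phi>_smooth])
  have f: "continuous_on S f"
    unfolding f_def inner_vec_def matrix_vector_mult_def inner_real_def vec_lambda_beta
    by (intro continuous_on_sum continuous_on_mult continuous_on_component continuous_on_snd continuous_on_id
        continuous_on_compose2[OF ch] continuous_on_fst) auto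
  have pos: "f s > 0" if "s \<in> S" for s
  proof -
    have "norm (snd s) = 1" "fst s \<in> \<Gamma>" "snd s \<bullet> \<gamma> (fst s) = 0" using that by (auto simp: S_def)
    then show ?thesis unfolding f_def by (intro hess_normal_form_pos) auto
  qed
  have "\<exists>c>0. \<forall>s\<in>S. c \<le> f s"
  \<comment> \<open>In dimension one there are no unit normals.\<close>
  proof (cases "S = {}")
    case False
    then show ?thesis using continuous_attains_inf[OF S False f] pos by blast
  qed (auto intro: exI[of _ 1])
  then obtain c where c: "c > 0" "\<And>s. s \<in> S \<Longrightarrow> c \<le> f s" by blast
  show ?thesis
  proof (intro exI[of _ c] conjI c(1) ballI allI impI)
    fix x y assume x: "x \<in> \<Gamma>" and y: "y \<bullet> \<gamma> x = 0"
    show "c * (norm y)\<^sup>2 \<le> y \<bullet> (hess \<phi> x *v y)"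
    proof (cases "y = 0")
      case False
      then have "(x, (1 / norm y) *\<^sub>R y) \<in> S" using x y by (simp add: S_def)
      from c(2)[OF this] have "c \<le> (y \<bullet> (hess \<phi> x *v y)) / (norm y)\<^sup>2"
        by (simp add: f_def matrix_vector_mult_scaleR power2_eq_square)
      then show ?thesis using False by (simp add: field_simps)
    qed simp
  qed
qed

text \<open>\<open>L\<close> scales each normal eigendirection by \<open>1 / sqrt (l i)\<close>,
  which turns the Hessian into the identity; the Jacobian on the hyperplane is the square root of v.
  It depends on \<open>x\<close> but not on \<epsilon>, \<rho> or \<delta>.\<close>

lemma cross_section_mass_rescaled:
  fixes k :: 'n
  assumes x: "x \<in> \<Gamma>"
  obtains L where "linear L" "\<And>v. L v \<bullet> \<gamma> x = 0" "\<And>v. v $ k = 0 \<Longrightarrow> L v \<bullet> (hess \<phi> x *v L v) = (norm v)\<^sup>2"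
    "\<And>\<epsilon> \<rho> \<delta>. \<epsilon> > 0 \<Longrightarrow> \<rho> \<in> borel_measurable borel \<Longrightarrow> cross_section_mass \<gamma> \<delta> \<rho> x
      = sqrt \<epsilon> ^ (CARD('n) - 1) * sqrt (1 / prod_nonzero_eigenvalues (hess \<phi> x))
        * (LINT z:{z. 0 \<le> z $ k \<and> z $ k \<le> 1}|lborel. \<rho> (x + sqrt \<epsilon> *\<^sub>R L (z - (z $ k) *\<^sub>R axis k 1))
            * indicator (ball x \<delta>) (x + sqrt \<epsilon> *\<^sub>R L (z - (z $ k) *\<^sub>R axis k 1)))"
proof -
  obtain e l where e: "orthonormal_family e" "e k = sgn (\<gamma> x)" "\<And>i. hess \<phi> x *v e i = l i *\<^sub>R e i"
    "l k = 0" "\<And>i. i \<noteq> k \<Longrightarrow> l i > 0" "\<And>i. i \<noteq> k \<Longrightarrow> e i \<bullet> \<gamma> x = 0"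
    "prod_nonzero_eigenvalues (hess \<phi> x) = (\<Prod>i\<in>UNIV - {k}. l i)"
    using adapted_eigenbasis[OF x, where k = k] by metis
  define R where "R = (\<lambda>z::real^'n. \<Sum>i\<in>UNIV. (z $ i) *\<^sub>R e i)"
  have R: "orthogonal_transformation R"
    unfolding R_def by (rule orthonormal_family_orthogonal_transformation[OF e(1)])
  have linR: "linear R" using R by (simp add: orthogonal_transformation_def)
  have Rk: "R z \<bullet> e k = z $ k" for z
  proof -
    have "R z \<bullet> e k = (\<Sum>i\<in>UNIV. if i = k then z $ i else 0)"
      using e(1) unfolding R_def inner_sum_left orthonormal_family_def by (intro sum.cong) auto
    then show ?thesis by simp
  qed
  have Rax: "R (axis k 1) = e k"
  proof -
    have "R (axis k 1) = (\<Sum>i\<in>UNIV. if i = k then e k else 0)"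
      unfolding R_def by (intro sum.cong) (auto simp: axis_def)
    then show ?thesis by simp
  qed
  \<comment> \<open>The zero in slot \<open>k\<close> makes \<open>L\<close> map into the directions
    normal to the flow.\<close>
  define d where "d = (\<lambda>i. if i = k then 0 else 1 / sqrt (l i))"
  define L where "L = (\<lambda>v::real^'n. R (\<chi> i. d i * v $ i))"
  have linL: "linear L"
  proof -
    have "linear (\<lambda>v::real^'n. \<chi> i. d i * v $ i)"
      by (auto simp: linear_iff vec_eq_iff algebra_simps)
    from linear_compose[OF this linR] show ?thesis by (simp add: L_def o_def)
  qed
  have gk: "\<gamma> x = norm (\<gamma> x) *\<^sub>R e k" using \<gamma>_nonzero[OF x] by (simp add: e(2) sgn_div_norm)
  have Lg: "L v \<bullet> \<gamma> x = 0" for v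
    by (subst gk) (simp add: L_def Rk d_def)
  have LH: "L v \<bullet> (hess \<phi> x *v L v) = (norm v)\<^sup>2" if v: "v $ k = 0" for v
  proof -
    have "L v \<bullet> (hess \<phi> x *v L v) = (\<Sum>i\<in>UNIV. l i * (d i * v $ i)\<^sup>2)"
      unfolding L_def R_def using quadratic_form_eigenbasis[OF e(1,3), of "\<lambda>i. d i * v $ i"] by simp
    also have "\<dots> = (\<Sum>i\<in>UNIV. (v $ i)\<^sup>2)"
    proof (intro sum.cong refl)
      fix i show "l i * (d i * v $ i)\<^sup>2 = (v $ i)\<^sup>2"
        using e(5)[of i] v by (cases "i = k") (auto simp: d_def power_divide power_mult_distrib)
    qed
    also have "\<dots> = (norm v)\<^sup>2"
      unfolding power2_norm_eq_inner inner_vec_def by (simp add: power2_eq_square)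
    finally show ?thesis .
  qed
  have mass: "cross_section_mass \<gamma> \<delta> \<rho> x
      = sqrt \<epsilon> ^ (CARD('n) - 1) * sqrt (1 / prod_nonzero_eigenvalues (hess \<phi> x))
        * (LINT z:{z. 0 \<le> z $ k \<and> z $ k \<le> 1}|lborel. \<rho> (x + sqrt \<epsilon> *\<^sub>R L (z - (z $ k) *\<^sub>R axis k 1))
            * indicator (ball x \<delta>) (x + sqrt \<epsilon> *\<^sub>R L (z - (z $ k) *\<^sub>R axis k 1)))"
    if \<epsilon>: "\<epsilon> > 0" and \<rho>: "\<rho> \<in> borel_measurable borel" for \<epsilon> \<rho> \<delta>
  proof -
    define F where "F = (\<lambda>y. \<rho> y * indicator (ball x \<delta>) y :: real)"
    have F[measurable]: "F \<in> borel_measurable borel" unfolding F_def using \<rho> by (intro borel_measurable_times borel_measurable_indicator) auto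
    define h where "h = (\<lambda>y. indicator {y. 0 \<le> (y - x) \<bullet> e k \<and> (y - x) \<bullet> e k \<le> 1} y *\<^sub>R F (y - ((y - x) \<bullet> e k) *\<^sub>R e k))"
    have h: "h \<in> borel_measurable borel" unfolding h_def by measurable
    \<comment> \<open>A function of basis vectors, written as a product with at most one factor
      other than 1. The value 1 along the flow preserves the unit thickness of the slab.\<close>
    define c where "c = (\<lambda>j::real^'n. \<Prod>i\<in>UNIV. if j = axis i 1 then (if i = k then 1 else sqrt \<epsilon> / sqrt (l i)) else 1)"
    have c: "c (axis i 1) = (if i = k then 1 else sqrt \<epsilon> / sqrt (l i))" for i
      unfolding c_def by (simp add: axis_eq_axis)
    have cpos: "c j > 0" if "j \<in> Basis" for j
      using that c e(5) \<epsilon> by (auto simp: Basis_vec_def)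
    have sqrt_prod: "sqrt (\<Prod>i\<in>I. l i) = (\<Prod>i\<in>I. sqrt (l i))" for I
      by (induction I rule: infinite_finite_induct) (auto simp: real_sqrt_mult)
    have cprod: "(\<Prod>j\<in>Basis. c j) = sqrt \<epsilon> ^ (CARD('n) - 1) * sqrt (1 / prod_nonzero_eigenvalues (hess \<phi> x))"
    proof -
      have "(\<Prod>j\<in>Basis. c j) = (\<Prod>i\<in>UNIV. c (axis i 1))"
        unfolding Basis_vec_def by (simp add: UNION_singleton_eq_range prod.reindex inj_on_def axis_eq_axis)
      also have "\<dots> = (\<Prod>i\<in>UNIV - {k}. sqrt \<epsilon> / sqrt (l i))"
        by (subst prod.remove[of UNIV k]) (auto simp: c intro!: prod.cong)
      also have "\<dots> = sqrt \<epsilon> ^ (CARD('n) - 1) / sqrt (\<Prod>i\<in>UNIV - {k}. l i)"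
        by (simp add: prod_dividef sqrt_prod)
      finally show ?thesis by (simp add: e(7) real_sqrt_divide)
    qed
    have Tz: "(\<Sum>j\<in>Basis. (c j * (z \<bullet> j)) *\<^sub>R j) = (\<chi> i. c (axis i 1) * z $ i)" for z :: "real^'n"
    proof -
      have "(\<Sum>j\<in>Basis. (c j * (z \<bullet> j)) *\<^sub>R j) = (\<Sum>i\<in>UNIV. (c (axis i 1) * z $ i) *\<^sub>R axis i 1)"
        unfolding Basis_vec_def by (simp add: UNION_singleton_eq_range sum.reindex inj_on_def axis_eq_axis inner_axis)
      then show ?thesis by (simp add: vec_eq_iff axis_def if_distrib cong: if_cong)
    qed
    have "cross_section_mass \<gamma> \<delta> \<rho> x = (LINT y|lborel. h y)"
      by (simp add: cross_section_mass_def hyperplane_integral_def set_lebesgue_integral_def h_def F_def e(2))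
    also have "\<dots> = (\<Prod>j\<in>Basis. c j) * (LINT z|lborel. h (x + R (\<Sum>j\<in>Basis. (c j * (z \<bullet> j)) *\<^sub>R j)))"
      by (rule integral_lborel_stretch_orthogonal[OF R h cpos])
    also have "(LINT z|lborel. h (x + R (\<Sum>j\<in>Basis. (c j * (z \<bullet> j)) *\<^sub>R j)))
       = (LINT z|lborel. indicator {z. 0 \<le> z $ k \<and> z $ k \<le> 1} z *\<^sub>R F (x + sqrt \<epsilon> *\<^sub>R L (z - (z $ k) *\<^sub>R axis k 1)))"
    proof (rule Bochner_Integration.integral_cong[OF refl])
      fix z :: "real^'n"
      let ?v = "\<chi> i. c (axis i 1) * z $ i"
      have vk: "R ?v \<bullet> e k = z $ k" by (simp add: Rk c)
      have "?v = sqrt \<epsilon> *\<^sub>R (\<chi> i. d i * (z - (z $ k) *\<^sub>R axis k 1) $ i) + (z $ k) *\<^sub>R axis k 1"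
        unfolding c by (auto simp: vec_eq_iff d_def axis_def)
      then have "R ?v = sqrt \<epsilon> *\<^sub>R L (z - (z $ k) *\<^sub>R axis k 1) + (z $ k) *\<^sub>R e k"
        unfolding L_def by (simp add: linear_add[OF linR] linear_cmul[OF linR] Rax)
      then have eq: "x + R ?v - (z $ k) *\<^sub>R e k = x + sqrt \<epsilon> *\<^sub>R L (z - (z $ k) *\<^sub>R axis k 1)" by simp
      show "h (x + R (\<Sum>j\<in>Basis. (c j * (z \<bullet> j)) *\<^sub>R j))
          = indicator {z. 0 \<le> z $ k \<and> z $ k \<le> 1} z *\<^sub>R F (x + sqrt \<epsilon> *\<^sub>R L (z - (z $ k) *\<^sub>R axis k 1))"
        unfolding Tz h_def by (simp add: vk eq indicator_def)
    qed
    finally show ?thesis unfolding cprod by (simp add: set_lebesgue_integral_def F_def)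
  qed
  show ?thesis by (rule that[OF linL Lg LH mass])
qed

text \<open>\<open>\<delta>0\<close> is fixed before \<delta>, while \<open>K\<close> may depend on
  \<delta>, since cutting off at radius \<delta> costs a multiple of
  \<open>\<epsilon> / \<delta>\<^sup>2\<close>. Displacements outside the ball are included so that
  the bound can be integrated over the whole hyperplane. The first estimate carries the asymptotics,
  the second gives integrability.\<close>

lemma wkb_pointwise_bound:
  fixes \<rho> :: "real \<Rightarrow> real^'n \<Rightarrow> real" and a :: "real \<Rightarrow> real"
  assumes a: "\<forall>\<epsilon>>0. a \<epsilon> > 0"
    and U: "open U" "\<Gamma> \<subseteq> U" and \<epsilon>0: "\<epsilon>0 > 0"
    and wkb: "\<forall>\<epsilon> x. 0 < \<epsilon> \<and> \<epsilon> < \<epsilon>0 \<and> x \<in> U \<longrightarrow>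
      \<rho> \<epsilon> x = a \<epsilon> * exp (- \<phi> x / \<epsilon> + ln (\<omega> x) + r \<epsilon> x) \<and> \<bar>r \<epsilon> x\<bar> \<le> C * \<epsilon>"
  shows "\<exists>\<delta>0>0. \<forall>\<delta>. 0 < \<delta> \<and> \<delta> < \<delta>0 \<longrightarrow> (\<exists>K\<ge>0. \<exists>\<epsilon>1>0. \<forall>\<epsilon> x w q G. 0 < \<epsilon> \<longrightarrow> \<epsilon> < \<epsilon>1 \<longrightarrow> x \<in> \<Gamma> \<longrightarrow> w \<bullet> \<gamma> x = 0 \<longrightarrow>
      q = (w \<bullet> (hess \<phi> x *v w)) / (2 * \<epsilon>) \<longrightarrow> G = (\<lambda>y. \<rho> \<epsilon> y * indicator (ball x \<delta>) y) \<longrightarrow>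
      \<bar>(G (x + w) + G (x - w)) / 2 - a \<epsilon> * (exp (- q) * \<omega> x)\<bar> \<le> a \<epsilon> * (K * \<epsilon> * exp (- (q / 4)))
      \<and> \<bar>G (x + w)\<bar> \<le> a \<epsilon> * (K * exp (- (q / 4))))"
proof -
  obtain M where M1: "M \<ge> 1" and M: "\<And>x. x \<in> \<Gamma> \<Longrightarrow> \<bar>\<omega> x\<bar> \<le> M"
    "\<And>x w. x \<in> \<Gamma> \<Longrightarrow> norm w \<le> 1 \<Longrightarrow> \<bar>\<phi> (x + w) - (w \<bullet> (hess \<phi> x *v w)) / 2\<bar> \<le> M * norm w ^ 3"
    "\<And>x w. x \<in> \<Gamma> \<Longrightarrow> norm w \<le> 1 \<Longrightarrow> \<bar>\<phi> (x + w) + \<phi> (x - w) - w \<bullet> (hess \<phi> x *v w)\<bar> \<le> M * norm w ^ 4"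
    "\<And>x w. x \<in> \<Gamma> \<Longrightarrow> norm w \<le> 1 \<Longrightarrow> \<bar>\<omega> (x + w) - \<omega> x\<bar> \<le> M * norm w"
    "\<And>x w. x \<in> \<Gamma> \<Longrightarrow> norm w \<le> 1 \<Longrightarrow> \<bar>\<omega> (x + w) + \<omega> (x - w) - 2 * \<omega> x\<bar> \<le> M * (norm w)\<^sup>2"
    using cycle_taylor by blast
  obtain c where c: "c > 0" "\<And>x y. x \<in> \<Gamma> \<Longrightarrow> y \<bullet> \<gamma> x = 0 \<Longrightarrow> c * (norm y)\<^sup>2 \<le> y \<bullet> (hess \<phi> x *v y)"
    using hess_lower_bound by blast
  obtain K1 where K1: "K1 \<ge> 0" "\<And>q R. q \<ge> 0 \<Longrightarrow> R \<ge> 0 \<Longrightarrow> R \<le> 2 / c * q \<Longrightarrow>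
      (R + R\<^sup>2 + R ^ 3) * exp (- (q / 2)) \<le> K1 * exp (- (q / 4))"
    using poly_times_exp_bound[of "2 / c"] c(1) by auto
  obtain \<delta>1 where \<delta>1: "\<delta>1 > 0" "(\<Union>x\<in>\<Gamma>. ball x \<delta>1) \<subseteq> U"
    using compact_subset_open_imp_ball_epsilon_subset[OF compact_cycle U] by blast
  \<comment> \<open>The entry \<open>c / (4 * M)\<close> makes the cubic Taylor error at most half
    of the quadratic term, so that \<phi> / \<epsilon> \<ge> q / 2 in the ball; the others keep the
    ball inside \<open>U\<close> and the displacement below 1.\<close>
  define \<delta>0 where "\<delta>0 = min \<delta>1 (min 1 (c / (4 * M)))"
  have \<delta>0: "\<delta>0 > 0" "\<delta>0 \<le> \<delta>1" "\<delta>0 \<le> 1" "\<delta>0 \<le> c / (4 * M)"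
    using \<delta>1(1) c(1) M1 by (auto simp: \<delta>0_def)
  define C' where "C' = \<bar>C\<bar> + 1"
  show ?thesis
  proof (rule exI[of _ \<delta>0], rule conjI[OF \<delta>0(1)], intro allI impI)
    fix \<delta> assume \<delta>: "0 < \<delta> \<and> \<delta> < \<delta>0"
    \<comment> \<open>In order: the Taylor errors, the WKB remainder, the Gaussian beyond the ball,
      and the crude bound on a single value.\<close>
    define K where "K = 3 * M ^ 3 * K1 + 6 * M * C' + M / \<delta>\<^sup>2 * K1 + 8 * M"
    \<comment> \<open>The second entry forces the WKB remainder below 1, where
      \<open>exp r - 1\<close> has a linear bound; \<open>C'\<close> is positive whatever the sign
      of \<open>C\<close>.\<close>
    define \<epsilon>1 where "\<epsilon>1 = min \<epsilon>0 (1 / C')"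
    have K0: "0 \<le> 3 * M ^ 3 * K1" "0 \<le> 6 * M * C'" "0 \<le> M / \<delta>\<^sup>2 * K1"
      using M1 K1(1) by (auto simp: C'_def)
    show "\<exists>K\<ge>0. \<exists>\<epsilon>1>0. \<forall>\<epsilon> x w q G. 0 < \<epsilon> \<longrightarrow> \<epsilon> < \<epsilon>1 \<longrightarrow> x \<in> \<Gamma> \<longrightarrow> w \<bullet> \<gamma> x = 0 \<longrightarrow>
      q = (w \<bullet> (hess \<phi> x *v w)) / (2 * \<epsilon>) \<longrightarrow> G = (\<lambda>y. \<rho> \<epsilon> y * indicator (ball x \<delta>) y) \<longrightarrow>
      \<bar>(G (x + w) + G (x - w)) / 2 - a \<epsilon> * (exp (- q) * \<omega> x)\<bar> \<le> a \<epsilon> * (K * \<epsilon> * exp (- (q / 4)))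
      \<and> \<bar>G (x + w)\<bar> \<le> a \<epsilon> * (K * exp (- (q / 4)))"
    proof (rule exI[of _ K], intro exI[of _ \<epsilon>1] conjI[where P = "0 \<le> K"] conjI[where P = "0 < \<epsilon>1"] allI impI)
      show "0 \<le> K" using K0 M1 by (simp add: K_def)
      show "0 < \<epsilon>1" using \<epsilon>0 by (auto simp: \<epsilon>1_def C'_def)
      fix \<epsilon> x w q G
      assume \<epsilon>: "0 < \<epsilon>" "\<epsilon> < \<epsilon>1" and x: "x \<in> \<Gamma>" and w: "w \<bullet> \<gamma> x = 0"
        and q: "q = (w \<bullet> (hess \<phi> x *v w)) / (2 * \<epsilon>)" and G: "G = (\<lambda>y. \<rho> \<epsilon> y * indicator (ball x \<delta>) y)"
      \<comment> \<open>Squared displacement in units of \<epsilon>; the uniform lower bound on the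
        Hessian controls it by \<open>q\<close>.\<close>
      define R where "R = (norm w)\<^sup>2 / \<epsilon>"
      have R0: "R \<ge> 0" using \<epsilon> by (simp add: R_def)
      have Rq: "R \<le> 2 / c * q"
        using c(2)[OF x w] c(1) \<epsilon>(1) by (simp add: R_def q field_simps)
      have q0: "q \<ge> 0"
      proof -
        have "0 \<le> c * (norm w)\<^sup>2" using c(1) by simp
        also have "\<dots> \<le> w \<bullet> (hess \<phi> x *v w)" by (rule c(2)[OF x w])
        finally show ?thesis using \<epsilon>(1) by (simp add: q)
      qed
      have E24: "exp (- (q / 2)) \<le> exp (- (q / 4))" and E12: "exp (- q) \<le> exp (- (q / 2))" using q0 by auto
      note poly = K1(2)[OF q0 R0 Rq]
      have Rle: "R \<le> R + R\<^sup>2 + R ^ 3" using R0 by simp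
      have ap: "a \<epsilon> > 0" using a \<epsilon>(1) by blast
      have \<epsilon>0': "\<epsilon> < \<epsilon>0" and C'\<epsilon>: "C' * \<epsilon> \<le> 1"
        using \<epsilon> by (auto simp: \<epsilon>1_def C'_def field_simps)
      show "\<bar>(G (x + w) + G (x - w)) / 2 - a \<epsilon> * (exp (- q) * \<omega> x)\<bar> \<le> a \<epsilon> * (K * \<epsilon> * exp (- (q / 4)))
          \<and> \<bar>G (x + w)\<bar> \<le> a \<epsilon> * (K * exp (- (q / 4)))"
      proof (cases "norm w < \<delta>")
        case False
        have G0: "G (x + w) = 0" "G (x - w) = 0" using False by (auto simp: G indicator_def dist_norm)
        \<comment> \<open>Beyond the ball the Gaussian itself is the whole error; this inequality
          supplies the factor \<epsilon> at the price of one power of \<open>R\<close>.\<close>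
        have "1 \<le> \<epsilon> * (R / \<delta>\<^sup>2)"
        proof -
          have "\<delta>\<^sup>2 \<le> (norm w)\<^sup>2" using False \<delta> by (intro power_mono) auto
          then show ?thesis using \<epsilon>(1) \<delta> by (simp add: R_def field_simps)
        qed
        then have "exp (- q) * 1 * \<bar>\<omega> x\<bar> \<le> exp (- (q / 2)) * (\<epsilon> * (R / \<delta>\<^sup>2)) * M"
          using E12 M(1)[OF x] R0 \<epsilon>(1) by (intro mult_mono) auto
        also have "\<dots> = \<epsilon> * (M / \<delta>\<^sup>2) * (R * exp (- (q / 2)))" by simp
        also have "\<dots> \<le> \<epsilon> * (M / \<delta>\<^sup>2) * (K1 * exp (- (q / 4)))"
          using order_trans[OF mult_right_mono[OF Rle] poly] \<epsilon>(1) M1 by (intro mult_left_mono) auto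
        also have "\<dots> = (M / \<delta>\<^sup>2 * K1) * \<epsilon> * exp (- (q / 4))" by simp
        also have "\<dots> \<le> K * \<epsilon> * exp (- (q / 4))"
          using K0 M1 \<epsilon>(1) by (intro mult_right_mono) (auto simp: K_def)
        finally have "\<bar>a \<epsilon> * (exp (- q) * \<omega> x)\<bar> \<le> a \<epsilon> * (K * \<epsilon> * exp (- (q / 4)))"
          using ap by (simp add: abs_mult)
        then show ?thesis using G0 ap \<open>0 \<le> K\<close> by simp
      next
        case True
        have w1: "norm w \<le> 1" and w1': "norm (- w) \<le> 1" using True \<delta> \<delta>0 by auto
        have inball: "x + w \<in> ball x \<delta>" "x - w \<in> ball x \<delta>" using True by (auto simp: dist_norm)
        have inU: "x + w \<in> U" "x - w \<in> U"
          using inball \<delta>1(2) x \<delta> \<delta>0(2) by (force simp: dist_norm)+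
        define P N where "P = \<phi> (x + w) / \<epsilon>" and "N = \<phi> (x - w) / \<epsilon>"
        have Q: "w \<bullet> (hess \<phi> x *v w) = 2 * \<epsilon> * q" using \<epsilon>(1) by (simp add: q)
        have Q': "(- w) \<bullet> (hess \<phi> x *v (- w)) = 2 * \<epsilon> * q"
          unfolding Q[symmetric] using matrix_vector_mult_scaleR[of "hess \<phi> x" "-1" w] by simp
        have cub: "M * norm w ^ 3 \<le> \<epsilon> * q / 2"
        proof -
          have "M * norm w ^ 3 = (M * norm w) * (norm w)\<^sup>2" by (simp add: power3_eq_cube power2_eq_square)
          also have "\<dots> \<le> (c / 4) * (norm w)\<^sup>2"
          proof (rule mult_right_mono)
            have "M * norm w \<le> M * (c / (4 * M))" using True \<delta> \<delta>0(4) M1 by (intro mult_left_mono) auto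
            then show "M * norm w \<le> c / 4" using M1 by simp
          qed simp
          also have "\<dots> \<le> (w \<bullet> (hess \<phi> x *v w)) / 4" using c(2)[OF x w] by simp
          finally show ?thesis by (simp add: Q)
        qed
        have dP: "\<bar>\<phi> (x + w) - \<epsilon> * q\<bar> \<le> M * norm w ^ 3"
          using M(2)[OF x w1] by (simp add: Q)
        have dN: "\<bar>\<phi> (x - w) - \<epsilon> * q\<bar> \<le> M * norm w ^ 3"
          using M(2)[OF x w1'] unfolding Q' by simp
        have div: "\<bar>y / \<epsilon> - z\<bar> \<le> b / \<epsilon>" if "\<bar>y - \<epsilon> * z\<bar> \<le> b" for y z b
        proof -
          have "y / \<epsilon> - z = (y - \<epsilon> * z) / \<epsilon>" using \<epsilon>(1) by (simp add: field_simps)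
          then show ?thesis using that \<epsilon>(1) by (simp add: divide_right_mono)
        qed
        have Plow: "P \<ge> q / 2" and Nlow: "N \<ge> q / 2"
        proof -
          have "\<epsilon> * (q / 2) \<le> \<phi> (x + w)" "\<epsilon> * (q / 2) \<le> \<phi> (x - w)" using dP dN cub by auto
          then show "P \<ge> q / 2" "N \<ge> q / 2" using \<epsilon>(1) by (simp_all add: P_def N_def field_simps)
        qed
        have a3: "\<bar>P - q\<bar> \<le> M * norm w ^ 3 / \<epsilon>" "\<bar>N - q\<bar> \<le> M * norm w ^ 3 / \<epsilon>"
          unfolding P_def N_def using div dP dN by auto
        have a4: "\<bar>P + N - 2 * q\<bar> \<le> M * norm w ^ 4 / \<epsilon>"
          using div[of "\<phi> (x + w) + \<phi> (x - w)" "2 * q"] M(3)[OF x w1]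
          by (simp add: P_def N_def Q add_divide_distrib mult_ac)
        have b1: "\<bar>\<omega> (x + w) - \<omega> x\<bar> \<le> M * norm w" "\<bar>\<omega> (x - w) - \<omega> x\<bar> \<le> M * norm w"
          using M(4)[OF x w1] M(4)[OF x w1'] by auto
        have "\<bar>(exp (- P) * \<omega> (x + w) + exp (- N) * \<omega> (x - w)) / 2 - exp (- q) * \<omega> x\<bar>
            \<le> exp (- (q / 2)) * (M * (M * norm w ^ 4 / \<epsilon> / 2 + (M * norm w ^ 3 / \<epsilon>)\<^sup>2)
                + M * norm w ^ 3 / \<epsilon> * (M * norm w) + M * (norm w)\<^sup>2 / 2)"
          by (rule symmetrised_exp_bound[OF q0 Plow Nlow a3 a4 b1 M(5)[OF x w1] M(1)[OF x]])
        \<comment> \<open>Substitute \<open>(norm w)\<^sup>2 = \<epsilon> * R\<close>: only even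
          total powers of the norm occur, and each term is \<epsilon> times a power of
          \<open>R\<close>.\<close>
        also have "M * (M * norm w ^ 4 / \<epsilon> / 2 + (M * norm w ^ 3 / \<epsilon>)\<^sup>2)
                + M * norm w ^ 3 / \<epsilon> * (M * norm w) + M * (norm w)\<^sup>2 / 2
            = \<epsilon> * (M\<^sup>2 * R\<^sup>2 / 2 + M ^ 3 * R ^ 3 + M\<^sup>2 * R\<^sup>2 + M * R / 2)"
          using \<epsilon>(1) by (simp add: R_def field_simps power2_eq_square power3_eq_cube power4_eq_xxxx)
        also have "\<dots> \<le> \<epsilon> * (3 * M ^ 3 * (R + R\<^sup>2 + R ^ 3))"
        proof (rule mult_left_mono)
          have m: "M \<le> M ^ 3" "M\<^sup>2 \<le> M ^ 3" using M1 by (auto intro: self_le_power power_increasing)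
          have "M\<^sup>2 * R\<^sup>2 \<le> M ^ 3 * R\<^sup>2" "M * R \<le> M ^ 3 * R" "0 \<le> M ^ 3 * R ^ 3" "0 \<le> M ^ 3 * R\<^sup>2" "0 \<le> M ^ 3 * R"
            using m R0 M1 by (auto intro!: mult_right_mono)
          then show "M\<^sup>2 * R\<^sup>2 / 2 + M ^ 3 * R ^ 3 + M\<^sup>2 * R\<^sup>2 + M * R / 2 \<le> 3 * M ^ 3 * (R + R\<^sup>2 + R ^ 3)"
            by (simp add: algebra_simps)
        qed (use \<epsilon> in simp)
        finally have "\<bar>(exp (- P) * \<omega> (x + w) + exp (- N) * \<omega> (x - w)) / 2 - exp (- q) * \<omega> x\<bar>
            \<le> \<epsilon> * (3 * M ^ 3) * ((R + R\<^sup>2 + R ^ 3) * exp (- (q / 2)))"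
          by (simp add: mult_ac)
        also have "\<dots> \<le> \<epsilon> * (3 * M ^ 3) * (K1 * exp (- (q / 4)))"
          using poly \<epsilon>(1) M1 by (intro mult_left_mono) auto
        finally have main: "\<bar>(exp (- P) * \<omega> (x + w) + exp (- N) * \<omega> (x - w)) / 2 - exp (- q) * \<omega> x\<bar>
            \<le> 3 * M ^ 3 * K1 * \<epsilon> * exp (- (q / 4))" by (simp add: mult_ac)
        \<comment> \<open>The WKB remainder is already of order \<epsilon>, so it is removed at each
          of the two points separately, without cancellation. \<open>2 * M\<close> bounds \<omega>
          at \<open>y\<close>; the bound
          \<open>\<bar>exp r - 1\<bar> \<le> 3 * \<bar>r\<bar>\<close> accounts for the rest of 6
          and 8.\<close>
        have single: "\<bar>G y - a \<epsilon> * (exp (- (\<phi> y / \<epsilon>)) * \<omega> y)\<bar> \<le> a \<epsilon> * (6 * M * C' * \<epsilon> * exp (- (q / 4)))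
            \<and> \<bar>G y\<bar> \<le> a \<epsilon> * (8 * M * exp (- (q / 4)))"
          if y: "y \<in> ball x \<delta>" "y \<in> U" "\<phi> y / \<epsilon> \<ge> q / 2" "\<bar>\<omega> y - \<omega> x\<bar> \<le> M * norm w" for y
        proof -
          have "exp (- \<phi> y / \<epsilon> + ln (\<omega> y) + r \<epsilon> y) = exp (- (\<phi> y / \<epsilon>)) * \<omega> y * exp (r \<epsilon> y)"
            unfolding exp_add using \<omega>_pos[of y] by simp
          then have Gy: "G y = a \<epsilon> * (exp (- (\<phi> y / \<epsilon>)) * \<omega> y * exp (r \<epsilon> y))"
            using wkb[rule_format, of \<epsilon> y] \<epsilon>(1) \<epsilon>0' y(2) y(1) by (simp add: G)
          have "C * \<epsilon> \<le> C' * \<epsilon>" using \<epsilon>(1) by (intro mult_right_mono) (auto simp: C'_def)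
          moreover have "\<bar>r \<epsilon> y\<bar> \<le> C * \<epsilon>" using wkb \<epsilon>(1) \<epsilon>0' y(2) by blast
          ultimately have r: "\<bar>r \<epsilon> y\<bar> \<le> C' * \<epsilon>" "\<bar>r \<epsilon> y\<bar> \<le> 1" using C'\<epsilon> by linarith+
          have er: "\<bar>exp (r \<epsilon> y) - 1\<bar> \<le> 3 * (C' * \<epsilon>)" "\<bar>exp (r \<epsilon> y) - 1\<bar> \<le> 3"
            using abs_exp_minus_one_le[OF r(2)] r by auto
          have "M * norm w \<le> M * 1" using w1 M1 by (intro mult_left_mono) auto
          then have oy: "\<omega> y \<le> 2 * M" using y(4) M(1)[OF x] by auto
          have ey: "exp (- (\<phi> y / \<epsilon>)) \<le> exp (- (q / 4))"
            unfolding exp_le_cancel_iff using y(3) q0 by linarith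
          have f: "0 \<le> exp (- (\<phi> y / \<epsilon>)) * \<omega> y" "exp (- (\<phi> y / \<epsilon>)) * \<omega> y \<le> exp (- (q / 4)) * (2 * M)"
            using ey oy \<omega>_pos[of y] by (auto intro!: mult_mono)
          have "\<bar>exp (- (\<phi> y / \<epsilon>)) * \<omega> y * (exp (r \<epsilon> y) - 1)\<bar> \<le> exp (- (q / 4)) * (2 * M) * (3 * (C' * \<epsilon>))"
            unfolding abs_mult[of "_ * \<omega> y"] using f er(1) M1 by (intro mult_mono) auto
          then have "a \<epsilon> * \<bar>exp (- (\<phi> y / \<epsilon>)) * \<omega> y * (exp (r \<epsilon> y) - 1)\<bar> \<le> a \<epsilon> * (6 * M * C' * \<epsilon> * exp (- (q / 4)))"
            using ap by (intro mult_left_mono) (auto simp: mult_ac)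
          moreover have "G y - a \<epsilon> * (exp (- (\<phi> y / \<epsilon>)) * \<omega> y) = a \<epsilon> * (exp (- (\<phi> y / \<epsilon>)) * \<omega> y * (exp (r \<epsilon> y) - 1))"
            by (simp add: Gy algebra_simps)
          ultimately have 1: "\<bar>G y - a \<epsilon> * (exp (- (\<phi> y / \<epsilon>)) * \<omega> y)\<bar> \<le> a \<epsilon> * (6 * M * C' * \<epsilon> * exp (- (q / 4)))"
            using ap by (simp only: abs_mult[of "a \<epsilon>"] abs_of_pos)
          have "exp (- (\<phi> y / \<epsilon>)) * \<omega> y * exp (r \<epsilon> y) \<le> exp (- (q / 4)) * (2 * M) * 4"
            by (rule mult_mono[OF f(2)]) (use er(2) M1 in auto)
          then have "G y \<le> a \<epsilon> * (exp (- (q / 4)) * (2 * M) * 4)"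
            unfolding Gy using ap by (intro mult_left_mono) auto
          moreover have "0 \<le> G y" unfolding Gy using \<omega>_pos[of y] ap by (intro mult_nonneg_nonneg) auto
          ultimately show ?thesis using 1 by (simp add: mult_ac)
        qed
        have s1: "\<bar>G (x + w) - a \<epsilon> * (exp (- P) * \<omega> (x + w))\<bar> \<le> a \<epsilon> * (6 * M * C' * \<epsilon> * exp (- (q / 4)))"
          "\<bar>G (x + w)\<bar> \<le> a \<epsilon> * (8 * M * exp (- (q / 4)))"
          using single[OF inball(1) inU(1) _ b1(1)] Plow by (auto simp: P_def)
        have s2: "\<bar>G (x - w) - a \<epsilon> * (exp (- N) * \<omega> (x - w))\<bar> \<le> a \<epsilon> * (6 * M * C' * \<epsilon> * exp (- (q / 4)))"
          using single[OF inball(2) inU(2) _ b1(2)] Nlow by (auto simp: N_def)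
        have m2: "\<bar>a \<epsilon> * ((exp (- P) * \<omega> (x + w) + exp (- N) * \<omega> (x - w)) / 2 - exp (- q) * \<omega> x)\<bar>
            \<le> a \<epsilon> * (3 * M ^ 3 * K1 * \<epsilon> * exp (- (q / 4)))"
          unfolding abs_mult[of "a \<epsilon>"] using main ap by (intro mult_mono) auto
        have avg: "\<bar>u\<bar> \<le> B1 + B2" if "u = s / 2 + t / 2 + v" "\<bar>s\<bar> \<le> B1" "\<bar>t\<bar> \<le> B1" "\<bar>v\<bar> \<le> B2" for u s t v B1 B2 :: real
          using that by linarith
        have "(G (x + w) + G (x - w)) / 2 - a \<epsilon> * (exp (- q) * \<omega> x)
          = (G (x + w) - a \<epsilon> * (exp (- P) * \<omega> (x + w))) / 2 + (G (x - w) - a \<epsilon> * (exp (- N) * \<omega> (x - w))) / 2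
            + a \<epsilon> * ((exp (- P) * \<omega> (x + w) + exp (- N) * \<omega> (x - w)) / 2 - exp (- q) * \<omega> x)"
          by (simp add: field_simps)
        then have "\<bar>(G (x + w) + G (x - w)) / 2 - a \<epsilon> * (exp (- q) * \<omega> x)\<bar>
            \<le> a \<epsilon> * (6 * M * C' * \<epsilon> * exp (- (q / 4))) + a \<epsilon> * (3 * M ^ 3 * K1 * \<epsilon> * exp (- (q / 4)))"
          by (rule avg[OF _ s1(1) s2 m2])
        also have "\<dots> = a \<epsilon> * ((6 * M * C' + 3 * M ^ 3 * K1) * \<epsilon> * exp (- (q / 4)))" by (simp add: algebra_simps)
        also have "\<dots> \<le> a \<epsilon> * (K * \<epsilon> * exp (- (q / 4)))"
          using ap \<epsilon>(1) K0 M1 by (intro mult_left_mono mult_right_mono) (auto simp: K_def)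
        finally have res1: "\<bar>(G (x + w) + G (x - w)) / 2 - a \<epsilon> * (exp (- q) * \<omega> x)\<bar> \<le> a \<epsilon> * (K * \<epsilon> * exp (- (q / 4)))" .
        have "a \<epsilon> * (8 * M * exp (- (q / 4))) \<le> a \<epsilon> * (K * exp (- (q / 4)))"
          using ap K0 by (intro mult_left_mono mult_right_mono) (auto simp: K_def)
        then show ?thesis using res1 s1(2) by simp
      qed
    qed
  qed
qed

text \<open>\<open>A\<close> is the same for all points and is chosen before \<delta>, so it cancels
  in every quotient of masses.\<close>

lemma cross_section_asymptotics:
  fixes \<rho> :: "real \<Rightarrow> real^'n \<Rightarrow> real" and a :: "real \<Rightarrow> real"
  assumes a: "\<forall>\<epsilon>>0. a \<epsilon> > 0"
    and \<rho>: "\<And>\<epsilon>. \<epsilon> > 0 \<Longrightarrow> \<rho> \<epsilon> \<in> borel_measurable borel"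
    and U: "open U" "\<Gamma> \<subseteq> U" and \<epsilon>0: "\<epsilon>0 > 0"
    and wkb: "\<forall>\<epsilon> x. 0 < \<epsilon> \<and> \<epsilon> < \<epsilon>0 \<and> x \<in> U \<longrightarrow>
      \<rho> \<epsilon> x = a \<epsilon> * exp (- \<phi> x / \<epsilon> + ln (\<omega> x) + r \<epsilon> x) \<and> \<bar>r \<epsilon> x\<bar> \<le> C * \<epsilon>"
  shows "\<exists>A. (\<forall>\<epsilon>>0. A \<epsilon> > 0) \<and> (\<exists>\<delta>0>0. \<forall>\<delta>. 0 < \<delta> \<and> \<delta> < \<delta>0 \<longrightarrow> (\<exists>K\<ge>0. \<exists>\<epsilon>1>0. \<forall>\<epsilon> x. 0 < \<epsilon> \<longrightarrow> \<epsilon> < \<epsilon>1 \<longrightarrow> x \<in> \<Gamma> \<longrightarrow>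
      \<bar>cross_section_mass \<gamma> \<delta> (\<rho> \<epsilon>) x - A \<epsilon> * (\<omega> x * sqrt (1 / prod_nonzero_eigenvalues (hess \<phi> x)))\<bar>
        \<le> A \<epsilon> * (K * \<epsilon>)))"
proof -
  \<comment> \<open>An arbitrary slot for the flow direction, the same at all points, so that the
    Gaussian constants below do not depend on the point.\<close>
  define k :: 'n where "k = undefined"
  define Z where "Z = (\<lambda>z::real^'n. z - (z $ k) *\<^sub>R axis k 1)"
  define I where "I = (\<lambda>z::real^'n. indicator {z. 0 \<le> z $ k \<and> z $ k \<le> 1} z :: real)"
  have Zk: "Z z $ k = 0" for z by (simp add: Z_def axis_def)
  have I01: "0 \<le> I z" for z by (simp add: I_def)
  have [measurable]: "I \<in> borel_measurable borel" unfolding I_def by measurable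
  have [measurable]: "Z \<in> borel \<rightarrow>\<^sub>M borel" unfolding Z_def by measurable
  define \<kappa> where "\<kappa> = (LINT z|lborel. I z * exp (- (1 / 2) * (norm (Z z))\<^sup>2))"
  \<comment> \<open>The rate 1/8 is that of \<open>exp (- (q / 4))\<close> with \<open>q\<close>
    equal to half the squared norm.\<close>
  define \<mu> where "\<mu> = (LINT z|lborel. I z * exp (- (1 / 8) * (norm (Z z))\<^sup>2))"
  have i2: "integrable lborel (\<lambda>z. I z * exp (- (1 / 2) * (norm (Z z))\<^sup>2))"
    and i8: "integrable lborel (\<lambda>z. I z * exp (- (1 / 8) * (norm (Z z))\<^sup>2))"
    unfolding I_def Z_def by (rule integrable_slab_gaussian; simp)+
  have \<kappa>0: "\<kappa> > 0"
    using slab_gaussian_integral_pos[of "1 / 2" k] by (simp add: \<kappa>_def I_def Z_def set_lebesgue_integral_def)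
  have \<mu>0: "\<mu> \<ge> 0" unfolding \<mu>_def using I01 by (intro Bochner_Integration.integral_nonneg) auto
  \<comment> \<open>The Jacobian is this constant divided by the norm of \<omega> \<gamma>, which
    has a positive minimum on the cycle; this yields the uniform bound \<open>V\<close>.\<close>
  obtain c where c: "c > 0" "\<And>x. x \<in> \<Gamma> \<Longrightarrow> sqrt (1 / prod_nonzero_eigenvalues (hess \<phi> x)) * norm (\<omega> x *\<^sub>R \<gamma> x) = c"
    using sqrt_det_flux_constant by blast
  have cn: "continuous_on \<Gamma> (\<lambda>x. norm (\<omega> x *\<^sub>R \<gamma> x))"
    using smooth_continuous[OF \<omega>_smooth, of \<Gamma> "[]"] smooth_continuous[OF \<gamma>_smooth, of \<Gamma> "[]"]
    by (auto intro!: continuous_intros)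
  have "\<Gamma> \<noteq> {}" using T_pos by (simp add: \<Gamma>_eq)
  then obtain x0 where x0: "x0 \<in> \<Gamma>" "\<And>x. x \<in> \<Gamma> \<Longrightarrow> norm (\<omega> x0 *\<^sub>R \<gamma> x0) \<le> norm (\<omega> x *\<^sub>R \<gamma> x)"
    using continuous_attains_inf[OF compact_cycle _ cn] by blast
  define n0 where "n0 = norm (\<omega> x0 *\<^sub>R \<gamma> x0)"
  have n0: "n0 > 0" using \<gamma>_nonzero[OF x0(1)] \<omega>_pos[of x0] by (simp add: n0_def)
  define V where "V = c / n0"
  have V: "0 \<le> sqrt (1 / prod_nonzero_eigenvalues (hess \<phi> x))" "sqrt (1 / prod_nonzero_eigenvalues (hess \<phi> x)) \<le> V"
    if "x \<in> \<Gamma>" for x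
  proof -
    show nn: "0 \<le> sqrt (1 / prod_nonzero_eigenvalues (hess \<phi> x))" using det_filled_hess(2)[OF that] by simp
    have "sqrt (1 / prod_nonzero_eigenvalues (hess \<phi> x)) * n0 \<le> c"
      using mult_left_mono[OF x0(2)[OF that] nn] c(2)[OF that] by (simp add: n0_def)
    then show "sqrt (1 / prod_nonzero_eigenvalues (hess \<phi> x)) \<le> V" using n0 by (simp add: V_def field_simps)
  qed
  have V0: "V \<ge> 0" using c(1) n0 by (simp add: V_def)
  define A where "A = (\<lambda>\<epsilon>. a \<epsilon> * sqrt \<epsilon> ^ (CARD('n) - 1) * \<kappa>)"
  have A0: "A \<epsilon> > 0" if "\<epsilon> > 0" for \<epsilon> using a \<kappa>0 that by (simp add: A_def)
  obtain \<delta>0 where \<delta>0: "\<delta>0 > 0" and pw: "\<And>\<delta>. 0 < \<delta> \<Longrightarrow> \<delta> < \<delta>0 \<Longrightarrow> \<exists>K\<ge>0. \<exists>\<epsilon>1>0. \<forall>\<epsilon> x w q G. 0 < \<epsilon> \<longrightarrow> \<epsilon> < \<epsilon>1 \<longrightarrow> x \<in> \<Gamma> \<longrightarrow> w \<bullet> \<gamma> x = 0 \<longrightarrow>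
      q = (w \<bullet> (hess \<phi> x *v w)) / (2 * \<epsilon>) \<longrightarrow> G = (\<lambda>y. \<rho> \<epsilon> y * indicator (ball x \<delta>) y) \<longrightarrow>
      \<bar>(G (x + w) + G (x - w)) / 2 - a \<epsilon> * (exp (- q) * \<omega> x)\<bar> \<le> a \<epsilon> * (K * \<epsilon> * exp (- (q / 4)))
      \<and> \<bar>G (x + w)\<bar> \<le> a \<epsilon> * (K * exp (- (q / 4)))"
    using wkb_pointwise_bound[OF a U \<epsilon>0 wkb] by (elim exE conjE) blast
  have "\<exists>K\<ge>0. \<exists>\<epsilon>1>0. \<forall>\<epsilon> x. 0 < \<epsilon> \<longrightarrow> \<epsilon> < \<epsilon>1 \<longrightarrow> x \<in> \<Gamma> \<longrightarrow>
      \<bar>cross_section_mass \<gamma> \<delta> (\<rho> \<epsilon>) x - A \<epsilon> * (\<omega> x * sqrt (1 / prod_nonzero_eigenvalues (hess \<phi> x)))\<bar>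
        \<le> A \<epsilon> * (K * \<epsilon>)" if \<delta>: "0 < \<delta>" "\<delta> < \<delta>0" for \<delta>
  proof -
    obtain K \<epsilon>1 where K0: "K \<ge> 0" and \<epsilon>1: "\<epsilon>1 > 0"
      and K: "\<And>\<epsilon> x w q G. 0 < \<epsilon> \<Longrightarrow> \<epsilon> < \<epsilon>1 \<Longrightarrow> x \<in> \<Gamma> \<Longrightarrow> w \<bullet> \<gamma> x = 0 \<Longrightarrow>
      q = (w \<bullet> (hess \<phi> x *v w)) / (2 * \<epsilon>) \<Longrightarrow> G = (\<lambda>y. \<rho> \<epsilon> y * indicator (ball x \<delta>) y) \<Longrightarrow>
      \<bar>(G (x + w) + G (x - w)) / 2 - a \<epsilon> * (exp (- q) * \<omega> x)\<bar> \<le> a \<epsilon> * (K * \<epsilon> * exp (- (q / 4)))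
      \<and> \<bar>G (x + w)\<bar> \<le> a \<epsilon> * (K * exp (- (q / 4)))"
      using pw[OF \<delta>] by (elim exE conjE) blast
    have "\<bar>cross_section_mass \<gamma> \<delta> (\<rho> \<epsilon>) x - A \<epsilon> * (\<omega> x * sqrt (1 / prod_nonzero_eigenvalues (hess \<phi> x)))\<bar>
        \<le> A \<epsilon> * ((V * K * \<mu> / \<kappa>) * \<epsilon>)" if \<epsilon>: "0 < \<epsilon>" "\<epsilon> < \<epsilon>1" and x: "x \<in> \<Gamma>" for \<epsilon> x
    proof -
      define G where "G = (\<lambda>y. \<rho> \<epsilon> y * indicator (ball x \<delta>) y)"
      have [measurable]: "G \<in> borel_measurable borel"
        unfolding G_def using \<rho>[OF \<epsilon>(1)] by (intro borel_measurable_times borel_measurable_indicator) auto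
      obtain L where L: "linear L" "\<And>v. L v \<bullet> \<gamma> x = 0" "\<And>v. v $ k = 0 \<Longrightarrow> L v \<bullet> (hess \<phi> x *v L v) = (norm v)\<^sup>2"
        and mass': "\<And>\<epsilon> \<rho> \<delta>. \<epsilon> > 0 \<Longrightarrow> \<rho> \<in> borel_measurable borel \<Longrightarrow> cross_section_mass \<gamma> \<delta> \<rho> x
          = sqrt \<epsilon> ^ (CARD('n) - 1) * sqrt (1 / prod_nonzero_eigenvalues (hess \<phi> x))
            * (LINT z:{z. 0 \<le> z $ k \<and> z $ k \<le> 1}|lborel. \<rho> (x + sqrt \<epsilon> *\<^sub>R L (z - (z $ k) *\<^sub>R axis k 1))
                * indicator (ball x \<delta>) (x + sqrt \<epsilon> *\<^sub>R L (z - (z $ k) *\<^sub>R axis k 1)))"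
        by (rule cross_section_mass_rescaled[OF x, of k]) blast
      have [measurable]: "L \<in> borel \<rightarrow>\<^sub>M borel"
        by (intro borel_measurable_continuous_onI linear_continuous_on linear_conv_bounded_linear[THEN iffD1] L(1))
      define f where "f = (\<lambda>v. G (x + sqrt \<epsilon> *\<^sub>R L v))"
      have fm[measurable]: "f \<in> borel_measurable borel" unfolding f_def by measurable
      define J where "J = (LINT z|lborel. I z * f (Z z))"
      define vx where "vx = sqrt (1 / prod_nonzero_eigenvalues (hess \<phi> x))"
      have mass: "cross_section_mass \<gamma> \<delta> (\<rho> \<epsilon>) x = sqrt \<epsilon> ^ (CARD('n) - 1) * vx * J"
        using mass'[OF \<epsilon>(1) \<rho>[OF \<epsilon>(1)], of \<delta>]
        by (simp add: J_def I_def Z_def f_def G_def vx_def set_lebesgue_integral_def)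
      have J': "J = (LINT z|lborel. I z * f (- Z z))"
        using slab_integral_reflect[OF fm, of k] by (simp add: J_def I_def Z_def set_lebesgue_integral_def)
      have b: "\<bar>(f v + f (- v)) / 2 - a \<epsilon> * (exp (- (1 / 2) * (norm v)\<^sup>2) * \<omega> x)\<bar> \<le> a \<epsilon> * (K * \<epsilon> * exp (- (1 / 8) * (norm v)\<^sup>2))"
        "\<bar>f v\<bar> \<le> a \<epsilon> * (K * exp (- (1 / 8) * (norm v)\<^sup>2))" if v: "v $ k = 0" for v
      proof -
        let ?w = "sqrt \<epsilon> *\<^sub>R L v"
        have w: "?w \<bullet> \<gamma> x = 0" by (simp add: L(2))
        have q: "(norm v)\<^sup>2 / 2 = (?w \<bullet> (hess \<phi> x *v ?w)) / (2 * \<epsilon>)"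
          using L(3)[OF v] \<epsilon>(1) by (simp add: matrix_vector_mult_scaleR mult.assoc[symmetric])
        have m: "f (- v) = G (x - ?w)" by (simp add: f_def linear_neg[OF L(1)])
        from K[OF \<epsilon> x w q G_def]
        show "\<bar>(f v + f (- v)) / 2 - a \<epsilon> * (exp (- (1 / 2) * (norm v)\<^sup>2) * \<omega> x)\<bar> \<le> a \<epsilon> * (K * \<epsilon> * exp (- (1 / 8) * (norm v)\<^sup>2))"
          "\<bar>f v\<bar> \<le> a \<epsilon> * (K * exp (- (1 / 8) * (norm v)\<^sup>2))"
          unfolding m by (simp_all add: f_def)
      qed
      \<comment> \<open>Both signs are treated at once: the two halves of the average must be
        integrable separately before they are combined under one integral.\<close>
      have int: "integrable lborel (\<lambda>z. I z * f (s *\<^sub>R Z z))" if s: "s = 1 \<or> s = - 1" for s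
      proof (rule Bochner_Integration.integrable_bound[OF integrable_mult_right[OF i8, of "a \<epsilon> * K"]])
        show "(\<lambda>z. I z * f (s *\<^sub>R Z z)) \<in> borel_measurable lborel" by measurable
        show "AE z in lborel. norm (I z * f (s *\<^sub>R Z z)) \<le> norm (a \<epsilon> * K * (I z * exp (- (1 / 8) * (norm (Z z))\<^sup>2)))"
        proof (rule AE_I2)
          fix z
          have n: "norm (s *\<^sub>R Z z) = norm (Z z)" using s by auto
          have "(s *\<^sub>R Z z) $ k = 0" by (simp add: Zk)
          from b(2)[OF this] have "\<bar>f (s *\<^sub>R Z z)\<bar> \<le> a \<epsilon> * (K * exp (- (1 / 8) * (norm (Z z))\<^sup>2))"
            unfolding n .
          from mult_left_mono[OF this I01[of z]]
          show "norm (I z * f (s *\<^sub>R Z z)) \<le> norm (a \<epsilon> * K * (I z * exp (- (1 / 8) * (norm (Z z))\<^sup>2)))"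
            using I01[of z] a[rule_format, OF \<epsilon>(1)] K0 by (simp add: abs_mult mult_ac)
        qed
      qed
      have int1: "integrable lborel (\<lambda>z. I z * f (Z z))" and int2: "integrable lborel (\<lambda>z. I z * f (- Z z))"
        using int[of 1] int[of "- 1"] by auto
      \<comment> \<open>One of the two copies of \<open>J\<close> is replaced by its reflection, so
        the integrand becomes the average over opposite points.\<close>
      have "J - a \<epsilon> * \<omega> x * \<kappa> = (J + J) / 2 - a \<epsilon> * \<omega> x * \<kappa>" by simp
      also have "\<dots> = (LINT z|lborel. (I z * f (Z z) + I z * f (- Z z)) / 2 - a \<epsilon> * \<omega> x * (I z * exp (- (1 / 2) * (norm (Z z))\<^sup>2)))"
        using int1 int2 i2 by (subst (2) J') (simp add: J_def \<kappa>_def)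
      also have "\<dots> = (LINT z|lborel. I z * ((f (Z z) + f (- Z z)) / 2 - a \<epsilon> * (exp (- (1 / 2) * (norm (Z z))\<^sup>2) * \<omega> x)))"
        by (intro Bochner_Integration.integral_cong) (auto simp: algebra_simps add_divide_distrib)
      finally have eq: "J - a \<epsilon> * \<omega> x * \<kappa> = (LINT z|lborel. I z * ((f (Z z) + f (- Z z)) / 2 - a \<epsilon> * (exp (- (1 / 2) * (norm (Z z))\<^sup>2) * \<omega> x)))" .
      have "\<bar>J - a \<epsilon> * \<omega> x * \<kappa>\<bar> \<le> (LINT z|lborel. a \<epsilon> * K * \<epsilon> * (I z * exp (- (1 / 8) * (norm (Z z))\<^sup>2)))"
        unfolding eq real_norm_def[symmetric]
      proof (rule Bochner_Integration.integral_norm_bound_integral)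
        show "integrable lborel (\<lambda>z. a \<epsilon> * K * \<epsilon> * (I z * exp (- (1 / 8) * (norm (Z z))\<^sup>2)))"
          by (rule integrable_mult_right[OF i8])
        have "integrable lborel (\<lambda>z. (I z * f (Z z) + I z * f (- Z z)) / 2 - a \<epsilon> * \<omega> x * (I z * exp (- (1 / 2) * (norm (Z z))\<^sup>2)))"
          using int1 int2 i2 by (intro Bochner_Integration.integrable_diff integrable_divide Bochner_Integration.integrable_add integrable_mult_right)
        then show "integrable lborel (\<lambda>z. I z * ((f (Z z) + f (- Z z)) / 2 - a \<epsilon> * (exp (- (1 / 2) * (norm (Z z))\<^sup>2) * \<omega> x)))"
          by (rule Bochner_Integration.integrable_cong[THEN iffD1, rotated 2]) (auto simp: algebra_simps add_divide_distrib)
        show "norm (I z * ((f (Z z) + f (- Z z)) / 2 - a \<epsilon> * (exp (- (1 / 2) * (norm (Z z))\<^sup>2) * \<omega> x)))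
            \<le> a \<epsilon> * K * \<epsilon> * (I z * exp (- (1 / 8) * (norm (Z z))\<^sup>2))" for z
          using mult_left_mono[OF b(1)[OF Zk] I01[of z]] I01[of z] by (simp add: abs_mult mult_ac)
      qed
      also have "\<dots> = a \<epsilon> * K * \<epsilon> * \<mu>" by (simp add: \<mu>_def)
      finally have Jb: "\<bar>J - a \<epsilon> * \<omega> x * \<kappa>\<bar> \<le> a \<epsilon> * K * \<epsilon> * \<mu>" .
      have e0: "0 < sqrt \<epsilon> ^ (CARD('n) - 1)" using \<epsilon>(1) by simp
      have "cross_section_mass \<gamma> \<delta> (\<rho> \<epsilon>) x - A \<epsilon> * (\<omega> x * vx) = sqrt \<epsilon> ^ (CARD('n) - 1) * vx * (J - a \<epsilon> * \<omega> x * \<kappa>)"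
        by (simp add: mass A_def algebra_simps)
      also have "\<bar>\<dots>\<bar> \<le> sqrt \<epsilon> ^ (CARD('n) - 1) * V * (a \<epsilon> * K * \<epsilon> * \<mu>)"
        unfolding abs_mult using Jb V[OF x] e0 V0 by (intro mult_mono) (auto simp: vx_def)
      also have "\<dots> = A \<epsilon> * ((V * K * \<mu> / \<kappa>) * \<epsilon>)" using \<kappa>0 by (simp add: A_def)
      finally show ?thesis by (simp add: vx_def)
    qed
    moreover have "V * K * \<mu> / \<kappa> \<ge> 0" using V0 K0 \<mu>0 \<kappa>0 by simp
    ultimately show ?thesis using \<epsilon>1 by blast
  qed
  then show ?thesis using A0 \<delta>0 by (intro exI[of _ A] conjI exI[of _ \<delta>0]) auto
qed

end

section \<open>Measurability of the mass and perturbation of quotients\<close>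

text \<open>With a distance condition in place of the ball that moves with \<open>x\<close>, the
  integrand is jointly measurable, and the integral over \<open>y\<close> is then measurable in the
  parameter.\<close>

lemma borel_measurable_cross_section_mass:
  fixes g :: "real^'n \<Rightarrow> real^'n"
  assumes [measurable]: "g \<in> borel \<rightarrow>\<^sub>M borel" "\<rho> \<in> borel_measurable borel"
  shows "cross_section_mass g \<delta> \<rho> \<in> borel_measurable borel"
proof -
  have eq: "cross_section_mass g \<delta> \<rho> = (\<lambda>x. LINT y|lborel.
      (if 0 \<le> (y - x) \<bullet> sgn (g x) \<and> (y - x) \<bullet> sgn (g x) \<le> 1
         \<and> dist x (y - ((y - x) \<bullet> sgn (g x)) *\<^sub>R sgn (g x)) < \<delta>
       then \<rho> (y - ((y - x) \<bullet> sgn (g x)) *\<^sub>R sgn (g x)) else 0))"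
    unfolding cross_section_mass_def hyperplane_integral_def set_lebesgue_integral_def
    by (intro ext Bochner_Integration.integral_cong) (auto simp: indicator_def)
  have [measurable]: "(\<lambda>x. sgn (g x)) \<in> borel \<rightarrow>\<^sub>M borel" unfolding sgn_div_norm by measurable
  show ?thesis
    unfolding eq by (rule lborel.borel_measurable_lebesgue_integral) measurable
qed

text \<open>Both errors are measured relative to the unknown scale \<open>A\<close>, which therefore
  cancels. The bound on \<open>e2\<close> keeps the denominator above half of its leading term
  \<open>A * n0\<close>.\<close>

lemma quotient_perturbation:
  fixes A s m n n0 :: real
  assumes A: "A > 0" and n0: "n0 > 0" and s: "\<bar>s - A * m\<bar> \<le> A * e1" and n: "\<bar>n - A * n0\<bar> \<le> A * e2"
    and e2: "e2 \<le> n0 / 2" and m: "\<bar>m\<bar> \<le> B"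
  shows "\<bar>s / n - m / n0\<bar> \<le> 2 * (e1 * n0 + B * e2) / n0\<^sup>2"
proof -
  have "A * e2 \<le> A * (n0 / 2)" using A e2 by (intro mult_left_mono) auto
  then have nlow: "A * n0 / 2 \<le> n" using n by auto
  have An0: "0 < A * n0" using A n0 by simp
  then have npos: "0 < n" using nlow by linarith
  have "s / n - m / n0 = ((s - A * m) * n0 - m * (n - A * n0)) / (n * n0)"
    using npos n0 by (simp add: field_simps)
  also have "\<bar>\<dots>\<bar> = \<bar>(s - A * m) * n0 - m * (n - A * n0)\<bar> / (n * n0)"
    using npos n0 by simp
  also have "\<dots> \<le> ((A * e1) * n0 + B * (A * e2)) / ((A * n0 / 2) * n0)"
  proof (rule frac_le)
    have "\<bar>(s - A * m) * n0\<bar> \<le> (A * e1) * n0"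
      unfolding abs_mult using s n0 by (intro mult_mono) auto
    moreover have "\<bar>m * (n - A * n0)\<bar> \<le> B * (A * e2)"
      unfolding abs_mult using m n by (intro mult_mono) auto
    ultimately show "\<bar>(s - A * m) * n0 - m * (n - A * n0)\<bar> \<le> (A * e1) * n0 + B * (A * e2)" by linarith
    then show "0 \<le> (A * e1) * n0 + B * (A * e2)" by linarith
    show "0 < (A * n0 / 2) * n0" using An0 n0 by simp
    show "(A * n0 / 2) * n0 \<le> n * n0" using nlow n0 by (intro mult_right_mono) auto
  qed
  also have "\<dots> = 2 * (e1 * n0 + B * e2) / n0\<^sup>2"
    using A n0 by (simp add: field_simps power2_eq_square)
  finally show ?thesis .
qed

subsection \<open>The marginal density\<close>

theorem theorem3:
  fixes D :: "real^'n^'n"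
    and b \<gamma> :: "real^'n \<Rightarrow> real^'n"
    and \<phi> \<omega> :: "real^'n \<Rightarrow> real"
    and p :: "real \<Rightarrow> real^'n" and T :: real
    and \<Gamma> :: "(real^'n) set"
    and \<pi> :: "real \<Rightarrow> real^'n \<Rightarrow> real"
    and a :: "real \<Rightarrow> real"
  assumes D_sym: "transpose D = D"
    and D_pos: "\<And>y. y \<noteq> 0 \<Longrightarrow> y \<bullet> (D *v y) > 0"
    and b_smooth: "smooth_on UNIV b"
    and \<phi>_smooth: "smooth_on UNIV \<phi>"
    and \<omega>_smooth: "smooth_on UNIV \<omega>"
    and \<phi>_nonneg: "\<And>x. \<phi> x \<ge> 0"
    and \<omega>_pos: "\<And>x. \<omega> x > 0"
    and decomp: "\<And>x. b x = - (D *v grad \<phi> x) + \<gamma> x"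
    and orth: "\<And>x. grad \<phi> x \<bullet> \<gamma> x = 0"
    and transport: "\<And>x. divg (\<lambda>y. \<omega> y *\<^sub>R \<gamma> y) x = - (grad \<phi> x \<bullet> (D *v grad \<omega> x))"
    \<comment> \<open>\<Gamma> is a periodic orbit of x' = b(x), with minimal period T, and it is orbitally asymptotically stable\<close>
    and T_pos: "T > 0"
    and p_ode: "\<And>t. (p has_vector_derivative b (p t)) (at t)"
    and p_periodic: "\<And>t. p (t + T) = p t"
    and p_inj: "inj_on p {0..<T}"
    and \<Gamma>_def: "\<Gamma> = p ` {0..T}"
    and \<Gamma>_stable: "orbitally_asymptotically_stable b \<Gamma>"
    \<comment> \<open>structure of \<phi> near \<Gamma>\<close>
    and \<phi>_zero: "\<exists>U. open U \<and> \<Gamma> \<subseteq> U \<and> (\<forall>x\<in>U. \<phi> x = 0 \<longleftrightarrow> x \<in> \<Gamma>)"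
    and grad_zero: "\<And>x. x \<in> \<Gamma> \<Longrightarrow> grad \<phi> x = 0"
    and hess_simple_zero: "\<And>x. x \<in> \<Gamma> \<Longrightarrow> order 0 (charpoly (hess \<phi> x)) = 1"
    and hess_tangent: "\<And>x. x \<in> \<Gamma> \<Longrightarrow> hess \<phi> x *v \<gamma> x = 0"
    and hess_normal_pos: "\<And>x y l. x \<in> \<Gamma> \<Longrightarrow> y \<noteq> 0 \<Longrightarrow> y \<bullet> \<gamma> x = 0 \<Longrightarrow>
                              hess \<phi> x *v y = l *\<^sub>R y \<Longrightarrow> l > 0"
    \<comment> \<open>\<pi> \<epsilon> is the stationary density: smooth probability density with divergence-free flux\<close>
    and \<pi>_smooth: "\<And>\<epsilon>. \<epsilon> > 0 \<Longrightarrow> smooth_on UNIV (\<pi> \<epsilon>)"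
    and \<pi>_nonneg: "\<And>\<epsilon> x. \<epsilon> > 0 \<Longrightarrow> \<pi> \<epsilon> x \<ge> 0"
    and \<pi>_integrable: "\<And>\<epsilon>. \<epsilon> > 0 \<Longrightarrow> integrable lborel (\<pi> \<epsilon>)"
    and \<pi>_normalised: "\<And>\<epsilon>. \<epsilon> > 0 \<Longrightarrow> (LINT x | lborel. \<pi> \<epsilon> x) = 1"
    and \<pi>_stationary: "\<And>\<epsilon> x. \<epsilon> > 0 \<Longrightarrow>
          divg (\<lambda>y. \<pi> \<epsilon> y *\<^sub>R b y - \<epsilon> *\<^sub>R (D *v grad (\<pi> \<epsilon>) y)) x = 0"
    \<comment> \<open>WKB form: \<pi> \<epsilon> = a(\<epsilon>) exp(-\<phi>/\<epsilon> + ln \<omega> + O(\<epsilon>)), uniformly on a neighbourhood of \<Gamma>\<close>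
    and a_pos: "\<And>\<epsilon>. \<epsilon> > 0 \<Longrightarrow> a \<epsilon> > 0"
    and \<pi>_wkb: "\<exists>U C \<epsilon>0 r. open U \<and> \<Gamma> \<subseteq> U \<and> \<epsilon>0 > 0 \<and>
          (\<forall>\<epsilon> x. 0 < \<epsilon> \<and> \<epsilon> < \<epsilon>0 \<and> x \<in> U \<longrightarrow>
             \<pi> \<epsilon> x = a \<epsilon> * exp (- \<phi> x / \<epsilon> + ln (\<omega> x) + r \<epsilon> x) \<and> \<bar>r \<epsilon> x\<bar> \<le> C * \<epsilon>)"
    and flux_limit: "\<And>x. ((\<lambda>\<epsilon>. (1 / \<pi> \<epsilon> x) *\<^sub>R
                (\<pi> \<epsilon> x *\<^sub>R b x - \<epsilon> *\<^sub>R (D *v grad (\<pi> \<epsilon>) x))) \<longlongrightarrow> \<gamma> x) (at_right 0)"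
  shows "(\<exists>c. \<forall>x\<in>\<Gamma>. sqrt (1 / prod_nonzero_eigenvalues (hess \<phi> x)) * norm (\<omega> x *\<^sub>R \<gamma> x) = c)
       \<and> (\<exists>K. \<exists>\<delta>0>0. \<forall>\<delta>. 0 < \<delta> \<and> \<delta> < \<delta>0 \<longrightarrow>
            (\<exists>C \<epsilon>1. \<epsilon>1 > 0 \<and> (\<forall>\<epsilon> x. 0 < \<epsilon> \<and> \<epsilon> < \<epsilon>1 \<and> x \<in> \<Gamma> \<longrightarrow>
               \<bar>marginal_density p T b \<gamma> \<delta> (\<pi> \<epsilon>) x
                 - \<omega> x * sqrt (1 / prod_nonzero_eigenvalues (hess \<phi> x))
                   / cycle_integral p T b (\<lambda>y. \<omega> y * sqrt (1 / prod_nonzero_eigenvalues (hess \<phi> y)))\<bar> \<le> C * \<epsilon>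
               \<and> \<bar>marginal_density p T b \<gamma> \<delta> (\<pi> \<epsilon>) x * norm (\<gamma> x) - K\<bar> \<le> C * \<epsilon>)))"
proof -
  have \<gamma>_eq: "\<gamma> = (\<lambda>x. b x + D *v grad \<phi> x)" using decomp by (auto simp: fun_eq_iff)
  have \<gamma>_smooth: "smooth_on UNIV \<gamma>"
    unfolding \<gamma>_eq
    by (intro smooth_add b_smooth smooth_linear_image[OF smooth_grad[OF \<phi>_smooth] matrix_vector_mul_bounded_linear])
  have b\<gamma>: "b x = \<gamma> x" if "x \<in> \<Gamma>" for x using decomp[of x] grad_zero[OF that] by simp
  have p\<Gamma>: "p t \<in> \<Gamma>" if "t \<in> {0..T}" for t using that \<Gamma>_def by blast
  have p_cont: "continuous_on UNIV p"
    using has_vector_derivative_continuous[OF p_ode] by (intro continuous_at_imp_continuous_on ballI)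
  interpret cycle_potential \<phi> \<omega> \<gamma> p T \<Gamma>
  proof
    show "divg (\<lambda>y. \<omega> y *\<^sub>R \<gamma> y) x = 0" if "x \<in> \<Gamma>" for x
      using transport[of x] grad_zero[OF that] by simp
    show "(p has_vector_derivative \<gamma> (p t)) (at t)" if "t \<in> {0..T}" for t
      using p_ode[of t] b\<gamma>[OF p\<Gamma>[OF that]] by simp
    show "\<phi> x = 0" if "x \<in> \<Gamma>" for x using \<phi>_zero that by blast
  qed (use \<phi>_smooth \<omega>_smooth \<gamma>_smooth \<omega>_pos orth T_pos \<Gamma>_def grad_zero hess_simple_zero hess_tangent hess_normal_pos in auto)
  define m where "m = (\<lambda>x. \<omega> x * sqrt (1 / prod_nonzero_eigenvalues (hess \<phi> x)))"
  obtain c where c: "c > 0" "\<forall>x\<in>\<Gamma>. sqrt (1 / prod_nonzero_eigenvalues (hess \<phi> x)) * norm (\<omega> x *\<^sub>R \<gamma> x) = c"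
    using sqrt_det_flux_constant by blast
  have m\<gamma>: "m x * norm (\<gamma> x) = c" if "x \<in> \<Gamma>" for x
    using c(2)[rule_format, OF that] \<omega>_pos[of x] by (simp add: m_def mult_ac)
  \<comment> \<open>On the cycle the arc-length factor is the norm of \<gamma>, and \<open>m\<close>
    times it is \<open>c\<close>; so the normaliser is \<open>c * T\<close>, and the constant in the
    last claim is \<open>1 / T\<close>.\<close>
  have n0: "cycle_integral p T b m = c * T"
  proof -
    have "cycle_integral p T b m = integral {0..T} (\<lambda>t. c)"
      unfolding cycle_integral_def using m\<gamma>[OF p\<Gamma>] b\<gamma>[OF p\<Gamma>] by (intro Henstock_Kurzweil_Integration.integral_cong) simp
    then show ?thesis using T_pos by simp
  qed
  have cT: "c * T > 0" using c(1) T_pos by simp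
  have cont\<gamma>: "continuous_on S \<gamma>" for S using smooth_continuous[OF \<gamma>_smooth, of S "[]"] by simp
  obtain B where B: "\<And>x. x \<in> \<Gamma> \<Longrightarrow> norm (\<gamma> x) \<le> B"
    using compact_imp_bounded[OF compact_continuous_image[OF cont\<gamma> compact_cycle]] by (auto simp: bounded_iff)
  have ne: "\<Gamma> \<noteq> {}" using T_pos by (simp add: \<Gamma>_eq)
  have "continuous_on \<Gamma> (\<lambda>x. norm (\<gamma> x))" by (intro continuous_on_norm cont\<gamma>)
  then obtain x0 where x0: "x0 \<in> \<Gamma>" "\<And>x. x \<in> \<Gamma> \<Longrightarrow> norm (\<gamma> x0) \<le> norm (\<gamma> x)"
    using continuous_attains_inf[OF compact_cycle ne] by blast
  have g0: "norm (\<gamma> x0) > 0" using \<gamma>_nonzero[OF x0(1)] by simp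
  have B0: "B > 0" using B[OF x0(1)] g0 by linarith
  \<comment> \<open>\<open>m\<close> equals \<open>c\<close> divided by the speed, so the minimal
    speed bounds it.\<close>
  define Bm where "Bm = c / norm (\<gamma> x0)"
  have Bm: "\<bar>m x\<bar> \<le> Bm" if "x \<in> \<Gamma>" for x
  proof -
    have m0: "m x \<ge> 0" using \<omega>_pos[of x] det_filled_hess(2)[OF that] by (simp add: m_def)
    have "m x * norm (\<gamma> x0) \<le> c" using mult_left_mono[OF x0(2)[OF that] m0] m\<gamma>[OF that] by simp
    then show ?thesis using g0 m0 by (simp add: Bm_def field_simps)
  qed
  have Bm0: "Bm \<ge> 0" using c(1) by (simp add: Bm_def)
  have \<pi>_meas: "\<pi> \<epsilon> \<in> borel_measurable borel" if "\<epsilon> > 0" for \<epsilon>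
    using smooth_continuous[OF \<pi>_smooth[OF that], of UNIV "[]"] by (simp add: borel_measurable_continuous_onI)
  obtain U C \<epsilon>0 r where U: "open U" "\<Gamma> \<subseteq> U" "\<epsilon>0 > 0" and wkb: "\<forall>\<epsilon> x. 0 < \<epsilon> \<and> \<epsilon> < \<epsilon>0 \<and> x \<in> U \<longrightarrow>
      \<pi> \<epsilon> x = a \<epsilon> * exp (- \<phi> x / \<epsilon> + ln (\<omega> x) + r \<epsilon> x) \<and> \<bar>r \<epsilon> x\<bar> \<le> C * \<epsilon>"
    using \<pi>_wkb by blast
  have a': "\<forall>\<epsilon>>0. a \<epsilon> > 0" using a_pos by blast
  obtain A \<delta>0 where A: "\<And>\<epsilon>. \<epsilon> > 0 \<Longrightarrow> A \<epsilon> > 0" and \<delta>0: "\<delta>0 > 0"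
    and asym: "\<forall>\<delta>. 0 < \<delta> \<and> \<delta> < \<delta>0 \<longrightarrow> (\<exists>K\<ge>0. \<exists>\<epsilon>1>0. \<forall>\<epsilon> x. 0 < \<epsilon> \<longrightarrow> \<epsilon> < \<epsilon>1 \<longrightarrow> x \<in> \<Gamma> \<longrightarrow>
      \<bar>cross_section_mass \<gamma> \<delta> (\<pi> \<epsilon>) x - A \<epsilon> * m x\<bar> \<le> A \<epsilon> * (K * \<epsilon>))"
    using cross_section_asymptotics[OF a' \<pi>_meas U wkb] unfolding m_def by blast
  have "\<exists>C \<epsilon>1. \<epsilon>1 > 0 \<and> (\<forall>\<epsilon> x. 0 < \<epsilon> \<and> \<epsilon> < \<epsilon>1 \<and> x \<in> \<Gamma> \<longrightarrow>
      \<bar>marginal_density p T b \<gamma> \<delta> (\<pi> \<epsilon>) x - m x / cycle_integral p T b m\<bar> \<le> C * \<epsilon>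
      \<and> \<bar>marginal_density p T b \<gamma> \<delta> (\<pi> \<epsilon>) x * norm (\<gamma> x) - 1 / T\<bar> \<le> C * \<epsilon>)" if \<delta>: "0 < \<delta>" "\<delta> < \<delta>0" for \<delta>
  proof -
    obtain K \<epsilon>1 where K0: "K \<ge> 0" and \<epsilon>1: "\<epsilon>1 > 0" and K: "\<And>\<epsilon> x. 0 < \<epsilon> \<Longrightarrow> \<epsilon> < \<epsilon>1 \<Longrightarrow> x \<in> \<Gamma> \<Longrightarrow>
      \<bar>cross_section_mass \<gamma> \<delta> (\<pi> \<epsilon>) x - A \<epsilon> * m x\<bar> \<le> A \<epsilon> * (K * \<epsilon>)"
      using asym \<delta> by blast
    \<comment> \<open>The bound of \<open>quotient_perturbation\<close> for the errors
      \<open>K * \<epsilon>\<close> of the mass and \<open>K * B * T * \<epsilon>\<close> of the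
      normaliser, with \<epsilon> taken out.\<close>
    define C1 where "C1 = 2 * (K * (c * T) + Bm * (K * B * T)) / (c * T)\<^sup>2"
    have C10: "C1 \<ge> 0" using K0 cT Bm0 B0 T_pos by (simp add: C1_def)
    \<comment> \<open>Keeps the error of the normaliser below half of \<open>c * T\<close>; the
      added 1 keeps the denominator positive.\<close>
    define \<epsilon>2 where "\<epsilon>2 = min \<epsilon>1 (c * T / (2 * (K * B * T + 1)))"
    have kbt: "K * B * T \<ge> 0" using K0 B0 T_pos by simp
    have \<epsilon>2: "\<epsilon>2 > 0" using \<epsilon>1 cT kbt by (simp add: \<epsilon>2_def)
    \<comment> \<open>The factor \<open>1 + B\<close> covers both estimates, the second error being
      the first times the speed.\<close>
    have "\<bar>marginal_density p T b \<gamma> \<delta> (\<pi> \<epsilon>) x - m x / cycle_integral p T b m\<bar> \<le> C1 * (1 + B) * \<epsilon>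
      \<and> \<bar>marginal_density p T b \<gamma> \<delta> (\<pi> \<epsilon>) x * norm (\<gamma> x) - 1 / T\<bar> \<le> C1 * (1 + B) * \<epsilon>"
      if \<epsilon>: "0 < \<epsilon>" "\<epsilon> < \<epsilon>2" and x: "x \<in> \<Gamma>" for \<epsilon> x
    proof -
      have \<epsilon>1': "\<epsilon> < \<epsilon>1" using \<epsilon>(2) by (simp add: \<epsilon>2_def)
      define s where "s = cross_section_mass \<gamma> \<delta> (\<pi> \<epsilon>)"
      have sK: "\<bar>s y - A \<epsilon> * m y\<bar> \<le> A \<epsilon> * (K * \<epsilon>)" if "y \<in> \<Gamma>" for y
        unfolding s_def by (rule K[OF \<epsilon>(1) \<epsilon>1' that])
      define h where "h = (\<lambda>t. s (p t) * norm (\<gamma> (p t)))"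
      have hK: "\<bar>h t - A \<epsilon> * c\<bar> \<le> A \<epsilon> * (K * \<epsilon>) * B" if "t \<in> {0..T}" for t
      proof -
        have "h t - A \<epsilon> * c = (s (p t) - A \<epsilon> * m (p t)) * norm (\<gamma> (p t))"
          using m\<gamma>[OF p\<Gamma>[OF that]] by (simp add: h_def left_diff_distrib mult.assoc)
        also have "\<bar>\<dots>\<bar> \<le> A \<epsilon> * (K * \<epsilon>) * B"
          unfolding abs_mult using sK[OF p\<Gamma>[OF that]] B[OF p\<Gamma>[OF that]] by (intro mult_mono) auto
        finally show ?thesis .
      qed
      have [measurable]: "p \<in> borel \<rightarrow>\<^sub>M borel" "\<gamma> \<in> borel \<rightarrow>\<^sub>M borel"
        using p_cont cont\<gamma> by (auto intro: borel_measurable_continuous_onI)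
      have [measurable]: "s \<in> borel_measurable borel"
        unfolding s_def using \<pi>_meas[OF \<epsilon>(1)] by (intro borel_measurable_cross_section_mass) measurable
      have hm: "h \<in> borel_measurable borel" unfolding h_def by measurable
      \<comment> \<open>Measurability and the uniform estimate take the place of continuity of the
        mass along the orbit.\<close>
      have hi: "h integrable_on {0..T}"
      proof (rule measurable_bounded_by_integrable_imp_integrable)
        show "h \<in> borel_measurable (lebesgue_on {0..T})"
          using hm by (intro measurable_restrict_space1 measurable_completion) auto
        show "(\<lambda>t. A \<epsilon> * c + A \<epsilon> * (K * \<epsilon>) * B) integrable_on {0..T}" by (rule integrable_const_ivl)
        show "norm (h t) \<le> A \<epsilon> * c + A \<epsilon> * (K * \<epsilon>) * B" if "t \<in> {0..T}" for t
        proof -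
          have "0 \<le> A \<epsilon> * c" using A[OF \<epsilon>(1)] c(1) by simp
          then show ?thesis using hK[OF that] unfolding real_norm_def by linarith
        qed
      qed simp
      define N where "N = cycle_integral p T b s"
      have Nh: "N = integral {0..T} h"
        unfolding N_def cycle_integral_def h_def using b\<gamma>[OF p\<Gamma>] by (intro Henstock_Kurzweil_Integration.integral_cong) simp
      have "N - A \<epsilon> * (c * T) = integral {0..T} (\<lambda>t. h t - A \<epsilon> * c)"
        unfolding Nh using hi T_pos by (subst Henstock_Kurzweil_Integration.integral_diff) auto
      also have "norm \<dots> \<le> integral {0..T} (\<lambda>t. A \<epsilon> * (K * \<epsilon>) * B)"
        using hi hK by (intro Henstock_Kurzweil_Integration.integral_norm_bound_integral
            Henstock_Kurzweil_Integration.integrable_diff integrable_const_ivl) auto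
      also have "\<dots> = A \<epsilon> * (K * B * T * \<epsilon>)" using T_pos by simp
      finally have NK: "\<bar>N - A \<epsilon> * (c * T)\<bar> \<le> A \<epsilon> * (K * B * T * \<epsilon>)" by simp
      have small: "K * B * T * \<epsilon> \<le> c * T / 2"
      proof -
        have "\<epsilon> * (2 * (K * B * T + 1)) \<le> c * T"
          using \<epsilon>(2) kbt by (simp add: \<epsilon>2_def pos_less_divide_eq)
        then show ?thesis using \<epsilon>(1) by (simp add: algebra_simps)
      qed
      have "\<bar>s x / N - m x / (c * T)\<bar> \<le> 2 * (K * \<epsilon> * (c * T) + Bm * (K * B * T * \<epsilon>)) / (c * T)\<^sup>2"
        by (rule quotient_perturbation[OF A[OF \<epsilon>(1)] cT sK[OF x] NK small Bm[OF x]])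
      also have "\<dots> = C1 * \<epsilon>" by (simp add: C1_def algebra_simps)
      finally have est: "\<bar>marginal_density p T b \<gamma> \<delta> (\<pi> \<epsilon>) x - m x / (c * T)\<bar> \<le> C1 * \<epsilon>"
        by (simp add: marginal_density_def s_def N_def)
      have C1\<epsilon>: "0 \<le> C1 * \<epsilon>" using C10 \<epsilon>(1) by simp
      have "marginal_density p T b \<gamma> \<delta> (\<pi> \<epsilon>) x * norm (\<gamma> x) - 1 / T
          = (marginal_density p T b \<gamma> \<delta> (\<pi> \<epsilon>) x - m x / (c * T)) * norm (\<gamma> x)"
        using m\<gamma>[OF x] c(1) by (simp add: left_diff_distrib)
      also have "\<bar>\<dots>\<bar> \<le> C1 * \<epsilon> * B"
        unfolding abs_mult using est B[OF x] C1\<epsilon> by (intro mult_mono) auto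
      finally have est2: "\<bar>marginal_density p T b \<gamma> \<delta> (\<pi> \<epsilon>) x * norm (\<gamma> x) - 1 / T\<bar> \<le> C1 * \<epsilon> * B" .
      have "C1 * (1 + B) * \<epsilon> = C1 * \<epsilon> + C1 * \<epsilon> * B" "0 \<le> C1 * \<epsilon> * B"
        using C1\<epsilon> B0 by (auto simp: algebra_simps)
      then show ?thesis unfolding n0 using est est2 C1\<epsilon> by linarith
    qed
    then show ?thesis using \<epsilon>2 by blast
  qed
  then show ?thesis
    using c(2) \<delta>0 unfolding m_def by blast
qed

end
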